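(* Let $\delta\in(0,1)$. Suppose that $\rho_{\min}(R)>0$ and set $$\alpha_i=c_\delta K\frac{\tau^2}{n}\rho(\Sigma)^i\,\mathrm{Tr}(\Sigma^i)\quad\text{for all } i\in\{1,\dots,K\},\qquad\text{with } c_\delta=16\,C_\delta .$$ Then, with probability larger than $1-\delta$, $$\frac1n\|X\hat\beta_{K,\alpha}-X\beta\|^2\le\frac2n\inf_{v\in[G]}\|X(\beta-v)\|^2+D'_{\delta,R}\frac{\tau^2}{n}\max\left(\mathrm{Cond}(D)\|\Lambda\|^2\,K\sum_{i=1}^K\rho(\Sigma^i)\mathrm{Tr}(\Sigma^i),\ \sqrt{\mathrm{Cond}(D)\|\Lambda\|^2\sum_{i=1}^K\mathrm{Tr}(\Sigma^i)^2}\right),$$ where $D'_{\delta,R}=c'_\delta\,\mathrm{Cond}(R)^4$ and $c'_\delta$ is a positive constant depending on $\delta$.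
   Context: Model: $X\in\mathbb{R}^{n\times p}$ is a deterministic matrix, $\beta\in\mathbb{R}^p$, $\tau>0$, $\varepsilon\sim\mathcal N_n(0,\tau^2I_n)$ and $Y=X\beta+\varepsilon$. Put $\Sigma=\frac1nX^TX$, $\hat\sigma=\frac1nX^TY$ and $\sigma=\mathbb{E}(\hat\sigma)=\Sigma\beta$ (expectation and probability are with respect to $\varepsilon$). Fix $K\in\{1,\dots,p\}$. Krylov matrices: $G=(\sigma,\Sigma\sigma,\dots,\Sigma^{K-1}\sigma)\in\mathbb{R}^{p\times K}$, $\hat G=(\hat\sigma,\Sigma\hat\sigma,\dots,\Sigma^{K-1}\hat\sigma)$, $\Theta=G^T\Sigma G=(\sigma^T\Sigma^{i+j-1}\sigma)_{i,j=1}^K$, $\hat\Theta=\hat G^T\Sigma\hat G$. $D=\mathrm{diag}(\Theta)$ is the diagonal matrix with the same diagonal as $\Theta$, and $R=D^{-1/2}\Theta D^{-1/2}\in\mathbb{R}^{K\times K}$ (the condition $\rho_{\min}(R)>0$ includes that the diagonal entries of $D$ are positive, so that $R$ is well defined; then $\Theta$ is invertible). $\Lambda=\Theta^{-1}G^T\sigma\in\mathbb{R}^K$. Ridge PLS estimator: $\hat\beta_{K,\alpha}=\hat G(\hat\Theta+\Delta_\alpha)^{-1}\hat G^T\hat\sigma$ with $\Delta_\alpha=\mathrm{diag}(\alpha_1,\dots,\alpha_K)$. Constants: $x_\delta=\ln(6K/\delta)$, $g(x)=1+2x+2\sqrt x$, $C_\delta=\max(g(x_\delta),2\sqrt{2x_\delta})$.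 Notation: $[A]$ is the column span of a matrix $A$; $\rho(A)$ and $\rho_{\min}(A)$ are the largest and smallest eigenvalues of a symmetric positive (semi-)definite matrix $A$; $\mathrm{Tr}$ is the trace; $\mathrm{Cond}(A)=\rho(A)/\rho_{\min}(A)$ is the condition number; $\|\cdot\|$ is the Euclidean norm. *)

theory Defs
  imports
    "HOL-Probability.Probability"
    "Jordan_Normal_Form.Spectral_Radius"
    "Jordan_Normal_Form.Gauss_Jordan_Elimination"
    "Jordan_Normal_Form.VS_Connect"
begin

text \<open>
  The sample size, the number of covariates and the number of components are all quantified inside
  the theorem (its constant may not depend on them), so dimensions cannot be types here; vectors and
  matrices are the carrier-based ones of the Jordan normal form library, whose indices start at 0.
\<close>

definition vec_norm :: "real vec \<Rightarrow> real" where
  "vec_norm v = sqrt (scalar_prod v v)"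

definition mat_trace :: "real mat \<Rightarrow> real" where
  "mat_trace A = (\<Sum>i<dim_row A. A $$ (i, i))"

text \<open>
  The two functions below are applied to nonempty symmetric matrices only. Such a matrix has a
  finite nonempty set of real eigenvalues, so the maximum and the minimum exist.
\<close>

definition rho :: "real mat \<Rightarrow> real" where
  "rho A = Max (spectrum A)"

definition rho_min :: "real mat \<Rightarrow> real" where
  "rho_min A = Min (spectrum A)"

definition cond_number :: "real mat \<Rightarrow> real" where
  "cond_number A = rho A / rho_min A"

text \<open>Unspecified for singular matrices.\<close>

definition minv :: "real mat \<Rightarrow> real mat" where
  "minv A = the (mat_inverse A)"

definition col_span :: "real mat \<Rightarrow> real vec set" where
  "col_span A = vec_space.col_space (dim_row A) A"


text \<open>The number of rows of \<open>X\<close> is the sample size.\<close>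

definition Sig :: "real mat \<Rightarrow> real mat" where
  "Sig X = (1 / real (dim_row X)) \<cdot>\<^sub>m (X\<^sup>T * X)"

definition sigma_hat :: "real mat \<Rightarrow> real vec \<Rightarrow> real vec" where
  "sigma_hat X Y = (1 / real (dim_row X)) \<cdot>\<^sub>v (X\<^sup>T *\<^sub>v Y)"

text \<open>The expectation of \<open>sigma_hat X (X *\<^sub>v \<beta> + \<epsilon>)\<close> for centred noise \<open>\<epsilon>\<close>.\<close>

definition sigma :: "real mat \<Rightarrow> real vec \<Rightarrow> real vec" where
  "sigma X \<beta> = Sig X *\<^sub>v \<beta>"

text \<open>
  The next two are used both for the population quantities (\<open>s = sigma X \<beta>\<close>) and for the
  empirical ones (\<open>s = sigma_hat X Y\<close>).
\<close>

definition krylov :: "nat \<Rightarrow> real mat \<Rightarrow> real vec \<Rightarrow> real mat" where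
  "krylov K S s = mat_of_cols (dim_vec s) (map (\<lambda>j. (S ^\<^sub>m j) *\<^sub>v s) [0..<K])"

definition Theta :: "nat \<Rightarrow> real mat \<Rightarrow> real vec \<Rightarrow> real mat" where
  "Theta K S s = (krylov K S s)\<^sup>T * S * krylov K S s"

definition diag_part :: "real mat \<Rightarrow> real mat" where
  "diag_part A = mat_diag (dim_row A) (\<lambda>i. A $$ (i, i))"

text \<open>\<open>D\<^sup>-\<^sup>1\<^sup>/\<^sup>2 A D\<^sup>-\<^sup>1\<^sup>/\<^sup>2\<close> with \<open>D\<close> the diagonal part of \<open>A\<close>.\<close>

definition normalized :: "real mat \<Rightarrow> real mat" where
  "normalized A = (let E = mat_diag (dim_row A) (\<lambda>i. 1 / sqrt (A $$ (i, i))) in E * A * E)"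

definition Lambda :: "nat \<Rightarrow> real mat \<Rightarrow> real vec \<Rightarrow> real vec" where
  "Lambda K S s = minv (Theta K S s) *\<^sub>v ((krylov K S s)\<^sup>T *\<^sub>v s)"

text \<open>
  The penalties are numbered \<open>\<alpha> 1, \<dots>, \<alpha> K\<close>, whence the shift in the diagonal matrix.
\<close>

definition ridge_pls :: "nat \<Rightarrow> (nat \<Rightarrow> real) \<Rightarrow> real mat \<Rightarrow> real vec \<Rightarrow> real vec" where
  "ridge_pls K \<alpha> X Y =
     (let S = Sig X; s = sigma_hat X Y; G = krylov K S s
      in G *\<^sub>v (minv (Theta K S s + mat_diag K (\<lambda>i. \<alpha> (Suc i))) *\<^sub>v (G\<^sup>T *\<^sub>v s)))"


definition x_const :: "real \<Rightarrow> nat \<Rightarrow> real" where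
  "x_const \<delta> K = ln (6 * real K / \<delta>)"

definition g_fun :: "real \<Rightarrow> real" where
  "g_fun x = 1 + 2 * x + 2 * sqrt x"

definition C_const :: "real \<Rightarrow> nat \<Rightarrow> real" where
  "C_const \<delta> K = max (g_fun (x_const \<delta> K)) (2 * sqrt (2 * x_const \<delta> K))"

definition alpha :: "real \<Rightarrow> nat \<Rightarrow> real \<Rightarrow> real mat \<Rightarrow> nat \<Rightarrow> real" where
  "alpha \<delta> K \<tau> X i =
     16 * C_const \<delta> K * real K * (\<tau>\<^sup>2 / real (dim_row X)) * rho (Sig X) ^ i * mat_trace (Sig X ^\<^sub>m i)"


text \<open>
  The law \<open>N(0, \<tau>\<^sup>2 I)\<close> on \<open>n\<close> coordinates: independent centred normals with standard
  deviation \<open>\<tau>\<close>. Its points are functions; \<open>Matrix.vec n\<close> turns them into vectors.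
\<close>

definition gauss_noise :: "nat \<Rightarrow> real \<Rightarrow> (nat \<Rightarrow> real) measure" where
  "gauss_noise n \<tau> = Pi\<^sub>M {..<n} (\<lambda>_. density lborel (\<lambda>x. ennreal (normal_density 0 \<tau> x)))"

definition response :: "real mat \<Rightarrow> real vec \<Rightarrow> (nat \<Rightarrow> real) \<Rightarrow> real vec" where
  "response X \<beta> \<epsilon> = X *\<^sub>v \<beta> + Matrix.vec (dim_row X) \<epsilon>"

end

theory Submission
  imports Defs
begin

text \<open>
  Strong convexity of the ridge criterion, compared with the population coefficients \<open>\<Lambda>\<close>, bounds the
  loss by twice the approximation error plus the penalty \<open>\<Sum>\<alpha>\<^sub>i \<Lambda>\<^sub>i\<^sup>2\<close> and a few quadratic forms of the
  noise \<open>X\<^sup>T \<epsilon> / n\<close>. As the final constant may depend on \<open>\<delta>\<close> arbitrarily, Markov's inequality for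
  one weighted sum of these forms suffices.

  Two facts turn the resulting bound into the stated one. The first coefficient of \<open>\<Lambda>\<close> is a trace
  that is at least \<open>1 / \<rho>(\<Sigma>)\<close>, so \<open>\<parallel>\<Lambda>\<parallel>\<^sup>2 \<Sum>\<rho>(\<Sigma>)\<^sup>i Tr(\<Sigma>\<^sup>i)\<close> dominates the effective rank
  \<open>Tr(\<Sigma>) / \<rho>(\<Sigma>)\<close>. And the logarithmic growth in \<open>K\<close> of the penalties is absorbed by the condition
  numbers, because the Hankel structure of \<open>\<Theta>\<close> forces \<open>K \<le> 2 Cond(R) Cond(D)\<close>.
\<close>

text \<open>Let \<open>F\<close> be the residual of the ridge fit, \<open>E\<close> that of
  \<open>\<Lambda>\<close> in the same noisy Krylov design, \<open>u\<close> the difference of the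
  coefficients and \<open>H = F - E\<close>. Testing the normal equations with \<open>u\<close>
  leaves terms linear in \<open>u\<close>, which
  \<open>|H|^2 + \<Sum>\<alpha>\<^sub>i u\<^sub>i\<^sup>2\<close> must absorb. The pure noise part
  is paid by the penalty. The cross term of signal and noise is paid by
  \<open>\<Sum>D\<^sub>i u\<^sub>i\<^sup>2\<close>, and here lies the obstacle:
  \<open>rho_min R\<close> controls that sum through the population design, whereas \<open>H\<close>
  lives in the noisy one. Passing from one to the other costs a further noise term, again paid by
  the penalty. The factor 2 of the approximation error comes from separating the noise from
  \<open>E\<close>. The noise enters through second moments only. After division by the penalty, the
  squares of \<open>\<eta> \<bullet> S\<^sup>i \<eta>\<close> leave a multiple of
  \<open>Tr(\<Sigma>) / \<rho>(\<Sigma>)\<close> without any \<open>\<Lambda>\<close>, which is why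
  a lower bound on \<open>\<Lambda>\<close> is required. The constant is chosen before
  \<open>K\<close>, so the growth of \<open>C_const\<close> in \<open>K\<close> has to be paid by
  quantities in the bound. The whole estimate is made against the first argument of the
  maximum.\<close>

unbundle no vec_syntax
unbundle no inner_syntax

section \<open>Deviation of a ridge estimator\<close>

lemma square_add_le: "(x + y)\<^sup>2 \<le> 2 * x\<^sup>2 + 2 * y\<^sup>2" for x y :: real
  using sum_squares_bound[of x y] by (simp add: power2_sum)

text \<open>Young's inequality in every coordinate. The weights \<open>a\<close> are the diagonal of
  a quadratic form that later absorbs the part in \<open>u\<close>; \<open>s\<close> tunes how much
  of it is spent.\<close>

lemma double_sum_prod_le_weighted:
  fixes u z a :: "'i \<Rightarrow> real"
  assumes "\<And>i. i \<in> I \<Longrightarrow> 0 < a i" and "0 < s"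
  shows "2 * (\<Sum>i\<in>I. u i * z i) \<le> s * (\<Sum>i\<in>I. a i * (u i)\<^sup>2) + (\<Sum>i\<in>I. (z i)\<^sup>2 / a i) / s"
proof -
  have "2 * (u i * z i) \<le> s * (a i * (u i)\<^sup>2) + (z i)\<^sup>2 / a i / s" if "i \<in> I" for i
  proof -
    have a: "0 < a i" using assms that by auto
    have "0 \<le> (s * a i * u i - z i)\<^sup>2 / (s * a i)"
      using a assms(2) by simp
    also have "\<dots> = s * (a i * (u i)\<^sup>2) + (z i)\<^sup>2 / a i / s - 2 * (u i * z i)"
      using a assms(2) by (simp add: field_simps power2_eq_square)
    finally show ?thesis by simp
  qed
  then have "(\<Sum>i\<in>I. 2 * (u i * z i)) \<le> (\<Sum>i\<in>I. s * (a i * (u i)\<^sup>2) + (z i)\<^sup>2 / a i / s)"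
    by (rule sum_mono)
  then show ?thesis by (simp only: sum.distrib sum_distrib_left sum_divide_distrib)
qed

text \<open>Cauchy-Schwarz for each \<open>k\<close>, with weights \<open>sqrt (a i)\<close>. It
  measures a noise design by the penalty: for \<open>a = \<alpha>\<close> the first factor is the
  penalty of \<open>u\<close>, for \<open>a = 1\<close> the squared Euclidean norm of the
  coefficients.\<close>

lemma sum_square_lincomb_le_weighted:
  fixes u a :: "'i \<Rightarrow> real" and v :: "'i \<Rightarrow> 'k \<Rightarrow> real"
  assumes "\<And>i. i \<in> I \<Longrightarrow> 0 < a i"
  shows "(\<Sum>k\<in>J. (\<Sum>i\<in>I. u i * v i k)\<^sup>2)
    \<le> (\<Sum>i\<in>I. a i * (u i)\<^sup>2) * (\<Sum>i\<in>I. (\<Sum>k\<in>J. (v i k)\<^sup>2) / a i)"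
proof -
  have "(\<Sum>i\<in>I. u i * v i k)\<^sup>2 \<le> (\<Sum>i\<in>I. a i * (u i)\<^sup>2) * (\<Sum>i\<in>I. (v i k)\<^sup>2 / a i)" for k
  proof -
    have "(\<Sum>i\<in>I. u i * v i k) = (\<Sum>i\<in>I. (sqrt (a i) * u i) * (v i k / sqrt (a i)))"
      using assms by (intro sum.cong refl) (simp add: order_less_imp_not_eq2)
    also have "\<dots>\<^sup>2 \<le> (\<Sum>i\<in>I. (sqrt (a i) * u i)\<^sup>2) * (\<Sum>i\<in>I. (v i k / sqrt (a i))\<^sup>2)"
      by (rule Cauchy_Schwarz_ineq_sum)
    also have "(\<Sum>i\<in>I. (sqrt (a i) * u i)\<^sup>2) = (\<Sum>i\<in>I. a i * (u i)\<^sup>2)"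
      using assms by (intro sum.cong) (auto simp: power_mult_distrib less_imp_le)
    also have "(\<Sum>i\<in>I. (v i k / sqrt (a i))\<^sup>2) = (\<Sum>i\<in>I. (v i k)\<^sup>2 / a i)"
      using assms by (intro sum.cong) (auto simp: power_divide less_imp_le)
    finally show ?thesis .
  qed
  then have "(\<Sum>k\<in>J. (\<Sum>i\<in>I. u i * v i k)\<^sup>2)
      \<le> (\<Sum>k\<in>J. (\<Sum>i\<in>I. a i * (u i)\<^sup>2) * (\<Sum>i\<in>I. (v i k)\<^sup>2 / a i))"
    by (intro sum_mono)
  also have "\<dots> = (\<Sum>i\<in>I. a i * (u i)\<^sup>2) * (\<Sum>i\<in>I. (\<Sum>k\<in>J. (v i k)\<^sup>2) / a i)"
    unfolding sum_divide_distrib by (subst sum.swap) (simp only: sum_distrib_left)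
  finally show ?thesis .
qed

text \<open>Roles: \<open>\<phi>\<close> and \<open>\<psi>\<close> are the signal and noise parts of
  the fitted Krylov vectors, \<open>f\<close> is the true fit, \<open>l\<close> the ridge
  coefficients, \<open>L\<close> any competitor, and \<open>a + z\<close> the error in the normal
  equations, with \<open>a\<close> linear and \<open>z\<close> quadratic in the noise. Testing the
  equations with \<open>l - L\<close> gives an energy identity whose surplus
  \<open>|H|^2 + A\<close> absorbs \<open>a\<close> and \<open>z\<close>; the hypothesis on
  \<open>m\<close> makes the signal design coercive.\<close>

lemma ridge_deterministic_bound:
  fixes \<phi> \<psi> :: "nat \<Rightarrow> nat \<Rightarrow> real" and f l L a z \<alpha> D :: "nat \<Rightarrow> real"
    and K n :: nat and m :: real
  defines "N \<equiv> \<Sum>i<K. (a i)\<^sup>2 / D i"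
    and "c \<equiv> \<Sum>i<K. (\<Sum>k<n. (\<psi> i k)\<^sup>2) / \<alpha> i"
  assumes \<alpha>: "\<And>i. i < K \<Longrightarrow> 0 < \<alpha> i" and D: "\<And>i. i < K \<Longrightarrow> 0 < D i" and m: "0 < m"
    and normal: "\<And>i. i < K \<Longrightarrow>
      (\<Sum>k<n. (\<phi> i k + \<psi> i k) * ((\<Sum>j<K. l j * (\<phi> j k + \<psi> j k)) - f k)) + \<alpha> i * l i = a i + z i"
    and lower: "\<And>u. m * (\<Sum>i<K. D i * (u i)\<^sup>2) \<le> (\<Sum>k<n. (\<Sum>i<K. u i * \<phi> i k)\<^sup>2)"
  shows "(\<Sum>k<n. ((\<Sum>j<K. l j * (\<phi> j k + \<psi> j k)) - f k)\<^sup>2)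
    \<le> 2 * (\<Sum>k<n. ((\<Sum>j<K. L j * \<phi> j k) - f k)\<^sup>2)
      + 2 * (\<Sum>i<K. (L i)\<^sup>2) * (\<Sum>i<K. \<Sum>k<n. (\<psi> i k)\<^sup>2)
      + (\<Sum>i<K. \<alpha> i * (L i)\<^sup>2) + 4 * (1 + c) * N / m + 2 * (\<Sum>i<K. (z i)\<^sup>2 / \<alpha> i)"
proof -
  define u where "u i = l i - L i" for i
  define h where "h i k = \<phi> i k + \<psi> i k" for i k
  define F where "F k = (\<Sum>j<K. l j * h j k) - f k" for k
  define E where "E k = (\<Sum>j<K. L j * h j k) - f k" for k
  define H where "H k = (\<Sum>j<K. u j * h j k)" for k
  define P where "P k = (\<Sum>j<K. u j * \<phi> j k)" for k
  define Q where "Q k = (\<Sum>j<K. u j * \<psi> j k)" for k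
  define A where "A = (\<Sum>i<K. \<alpha> i * (u i)\<^sup>2)"
  \<comment> \<open>Makes both \<open>2 * s\<close> and \<open>2 * s * c\<close> at most 1/2, so
    that the cross term uses up at most half of \<open>|H|^2\<close> and half of
    \<open>A\<close>.\<close>
  define s where "s = 1 / (4 * (1 + c))"
  have c0: "0 \<le> c" unfolding c_def using \<alpha> by (intro sum_nonneg divide_nonneg_pos) auto
  then have s0: "0 < s" by (simp add: s_def)
  have A0: "0 \<le> A" unfolding A_def using \<alpha> by (intro sum_nonneg) (auto simp: less_imp_le)
  have FEH: "F k = E k + H k" for k
    by (simp add: F_def E_def H_def u_def algebra_simps sum_subtractf)
  have "(\<Sum>i<K. u i * ((\<Sum>k<n. h i k * F k) + \<alpha> i * l i)) = (\<Sum>i<K. u i * (a i + z i))"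
    using normal by (intro sum.cong) (auto simp: h_def F_def)
  moreover have "(\<Sum>i<K. u i * (\<Sum>k<n. h i k * F k)) = (\<Sum>k<n. H k * F k)"
    unfolding H_def sum_distrib_left sum_distrib_right
    by (subst sum.swap) (simp add: mult.assoc)
  ultimately have stat: "(\<Sum>k<n. H k * F k) + (\<Sum>i<K. \<alpha> i * l i * u i)
      = (\<Sum>i<K. u i * a i) + (\<Sum>i<K. u i * z i)"
    by (simp add: distrib_left sum.distrib mult_ac)
  \<comment> \<open>Polarization, here and for the penalties below: the surplus squares
    \<open>|H|^2\<close> and \<open>A\<close> are the gain from strong convexity.\<close>
  have "2 * (\<Sum>k<n. H k * F k) = (\<Sum>k<n. (F k)\<^sup>2) + (\<Sum>k<n. (H k)\<^sup>2) - (\<Sum>k<n. (E k)\<^sup>2)"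
    unfolding sum_distrib_left FEH sum.distrib[symmetric] sum_subtractf[symmetric]
    by (intro sum.cong) (auto simp: power2_eq_square algebra_simps)
  moreover have "2 * (\<Sum>i<K. \<alpha> i * l i * u i)
      = (\<Sum>i<K. \<alpha> i * (l i)\<^sup>2) + A - (\<Sum>i<K. \<alpha> i * (L i)\<^sup>2)"
    unfolding sum_distrib_left u_def A_def sum.distrib[symmetric] sum_subtractf[symmetric]
    by (intro sum.cong) (auto simp: power2_eq_square algebra_simps)
  moreover have "0 \<le> (\<Sum>i<K. \<alpha> i * (l i)\<^sup>2)"
    using \<alpha> by (intro sum_nonneg) (auto simp: less_imp_le)
  moreover have "(\<Sum>k<n. (E k)\<^sup>2) \<le> 2 * (\<Sum>k<n. ((\<Sum>j<K. L j * \<phi> j k) - f k)\<^sup>2)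
      + 2 * ((\<Sum>i<K. (L i)\<^sup>2) * (\<Sum>i<K. \<Sum>k<n. (\<psi> i k)\<^sup>2))"
  proof -
    have "(E k)\<^sup>2 \<le> 2 * ((\<Sum>j<K. L j * \<phi> j k) - f k)\<^sup>2 + 2 * (\<Sum>j<K. L j * \<psi> j k)\<^sup>2" for k
    proof -
      have "E k = ((\<Sum>j<K. L j * \<phi> j k) - f k) + (\<Sum>j<K. L j * \<psi> j k)"
        by (simp add: E_def h_def algebra_simps sum.distrib)
      then show ?thesis by (simp only: square_add_le)
    qed
    then have "(\<Sum>k<n. (E k)\<^sup>2)
      \<le> (\<Sum>k<n. 2 * ((\<Sum>j<K. L j * \<phi> j k) - f k)\<^sup>2 + 2 * (\<Sum>j<K. L j * \<psi> j k)\<^sup>2)"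
      by (intro sum_mono)
    also have "\<dots> = 2 * (\<Sum>k<n. ((\<Sum>j<K. L j * \<phi> j k) - f k)\<^sup>2)
        + 2 * (\<Sum>k<n. (\<Sum>j<K. L j * \<psi> j k)\<^sup>2)"
      by (simp add: sum.distrib sum_distrib_left)
    finally show ?thesis
      using sum_square_lincomb_le_weighted[of "{..<K}" "\<lambda>_. 1" L \<psi> "{..<n}"] by simp
  qed
  moreover have "2 * (\<Sum>i<K. u i * a i) \<le> (\<Sum>k<n. (H k)\<^sup>2) / 2 + A / 2 + 4 * (1 + c) * N / m"
  proof -
    have "2 * (\<Sum>i<K. u i * a i) \<le> s * m * (\<Sum>i<K. D i * (u i)\<^sup>2) + N / (s * m)"
      unfolding N_def using D m s0 by (intro double_sum_prod_le_weighted) auto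
    also have "N / (s * m) = 4 * (1 + c) * N / m" by (simp add: s_def)
    also have "s * m * (\<Sum>i<K. D i * (u i)\<^sup>2) \<le> s * (\<Sum>k<n. (P k)\<^sup>2)"
      using lower[of u] s0 by (simp add: P_def mult.assoc)
    \<comment> \<open>Coercivity holds for the signal design \<open>P = H - Q\<close>; the noise
      design \<open>Q\<close> is charged to the penalty through \<open>c\<close>.\<close>
    also have "(\<Sum>k<n. (P k)\<^sup>2) \<le> 2 * (\<Sum>k<n. (H k)\<^sup>2) + 2 * (\<Sum>k<n. (Q k)\<^sup>2)"
    proof -
      have "(P k)\<^sup>2 \<le> 2 * (H k)\<^sup>2 + 2 * (Q k)\<^sup>2" for k
      proof -
        have "P k = H k + - Q k" by (simp add: P_def H_def Q_def h_def algebra_simps sum.distrib)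
        then show ?thesis using square_add_le[of "H k" "- Q k"] by simp
      qed
      then show ?thesis
        unfolding sum_distrib_left sum.distrib[symmetric] by (intro sum_mono)
    qed
    also have "(\<Sum>k<n. (Q k)\<^sup>2) \<le> A * c"
      unfolding Q_def A_def c_def by (rule sum_square_lincomb_le_weighted) (use \<alpha> in auto)
    also have "s * (2 * (\<Sum>k<n. (H k)\<^sup>2) + 2 * (A * c)) \<le> (\<Sum>k<n. (H k)\<^sup>2) / 2 + A / 2"
    proof -
      have "s * 2 \<le> 1 / 2" using c0 by (simp add: s_def field_simps)
      moreover have "s * (2 * c) \<le> 1 / 2" using c0 by (simp add: s_def field_simps)
      moreover have "0 \<le> (\<Sum>k<n. (H k)\<^sup>2)" by (intro sum_nonneg) auto
      ultimately have "(s * 2) * (\<Sum>k<n. (H k)\<^sup>2) \<le> 1 / 2 * (\<Sum>k<n. (H k)\<^sup>2)"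
        "(s * (2 * c)) * A \<le> 1 / 2 * A"
        using A0 by (blast intro: mult_right_mono)+
      then show ?thesis by (simp add: algebra_simps)
    qed
    finally show ?thesis using s0 by simp
  qed
  \<comment> \<open>The parameter 1/2 spends the remaining half of \<open>A\<close>.\<close>
  moreover have "2 * (\<Sum>i<K. u i * z i) \<le> A / 2 + 2 * (\<Sum>i<K. (z i)\<^sup>2 / \<alpha> i)"
    using double_sum_prod_le_weighted[of "{..<K}" \<alpha> "1 / 2" u z] \<alpha> by (simp add: A_def)
  moreover have "0 \<le> (\<Sum>k<n. (H k)\<^sup>2)" by (intro sum_nonneg) auto
  ultimately have "(\<Sum>k<n. (F k)\<^sup>2)
    \<le> 2 * (\<Sum>k<n. ((\<Sum>j<K. L j * \<phi> j k) - f k)\<^sup>2)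
      + 2 * ((\<Sum>i<K. (L i)\<^sup>2) * (\<Sum>i<K. \<Sum>k<n. (\<psi> i k)\<^sup>2))
      + (\<Sum>i<K. \<alpha> i * (L i)\<^sup>2) + 4 * (1 + c) * N / m + 2 * (\<Sum>i<K. (z i)\<^sup>2 / \<alpha> i)"
    using stat by linarith
  then show ?thesis by (simp add: F_def h_def mult.assoc)
qed

section \<open>Real symmetric matrices\<close>

lemma nonneg_quadratic_imp_square_le:
  fixes a b c :: real
  assumes "\<And>t. 0 \<le> a + 2 * t * b + t\<^sup>2 * c" and "0 \<le> c"
  shows "b\<^sup>2 \<le> a * c"
proof (cases "c = 0")
  case True
  have "b = 0"
  proof (rule ccontr)
    assume "b \<noteq> 0"
    define t where "t = (- a - 1) / (2 * b)"
    have "t * (2 * b) = - a - 1"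
      using nonzero_eq_divide_eq[of "2 * b" t "- a - 1"] \<open>b \<noteq> 0\<close> by (simp add: t_def)
    then show False using assms(1)[of t] True by simp
  qed
  then show ?thesis using True by simp
next
  case False
  then have "0 < c" using assms(2) by simp
  with assms(1)[of "- b / c"] show ?thesis
    by (simp add: field_simps power2_eq_square)
qed

lemma scalar_prod_self_nonneg: "0 \<le> v \<bullet> v" for v :: "real vec"
  by (simp add: scalar_prod_def sum_nonneg)

lemma scalar_prod_self_pos:
  fixes v :: "real vec"
  assumes "v \<in> carrier_vec m" "v \<noteq> 0\<^sub>v m"
  shows "0 < v \<bullet> v"
proof -
  obtain i where i: "i < m" "v $ i \<noteq> 0" using assms by (auto simp: vec_eq_iff)
  have "0 < (\<Sum>i\<in>{0..<m}. v $ i * v $ i)"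
    using i by (intro sum_pos2[of _ i]) (auto simp flip: power2_eq_square)
  then show ?thesis using assms(1) by (simp add: scalar_prod_def)
qed

lemma scalar_prod_sym_mat:
  fixes A :: "real mat"
  assumes "A \<in> carrier_mat m m" "A\<^sup>T = A" "x \<in> carrier_vec m" "y \<in> carrier_vec m"
  shows "(A *\<^sub>v x) \<bullet> y = x \<bullet> (A *\<^sub>v y)"
proof -
  have "(A *\<^sub>v x) \<bullet> y = y \<bullet> (A *\<^sub>v x)"
    by (rule comm_scalar_prod) (use assms in auto)
  also have "\<dots> = (A *\<^sub>v y) \<bullet> x"
    using transpose_vec_mult_scalar[OF assms(1,3,4)] assms(2) by simp
  also have "\<dots> = x \<bullet> (A *\<^sub>v y)"
    by (rule comm_scalar_prod) (use assms in auto)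
  finally show ?thesis .
qed

text \<open>The form at \<open>x + t y\<close> is a nonnegative quadratic polynomial in
  \<open>t\<close>, so its discriminant has a sign. The semidefinite version is required because
  \<open>S\<close> may be singular and because \<open>c I - A\<close> turns out to be singular at
  the top eigenvalue.\<close>

lemma psd_Cauchy_Schwarz:
  fixes A :: "real mat"
  assumes A: "A \<in> carrier_mat m m" and sym: "A\<^sup>T = A"
    and psd: "\<And>x. x \<in> carrier_vec m \<Longrightarrow> 0 \<le> x \<bullet> (A *\<^sub>v x)"
    and x: "x \<in> carrier_vec m" and y: "y \<in> carrier_vec m"
  shows "(x \<bullet> (A *\<^sub>v y))\<^sup>2 \<le> (x \<bullet> (A *\<^sub>v x)) * (y \<bullet> (A *\<^sub>v y))"
proof (rule nonneg_quadratic_imp_square_le)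
  fix t :: real
  have Ax: "A *\<^sub>v x \<in> carrier_vec m" and Ay: "A *\<^sub>v y \<in> carrier_vec m" using A x y by auto
  have yx: "y \<bullet> (A *\<^sub>v x) = x \<bullet> (A *\<^sub>v y)"
    using scalar_prod_sym_mat[OF A sym x y] comm_scalar_prod[OF Ax y] by simp
  have "A *\<^sub>v (x + t \<cdot>\<^sub>v y) = A *\<^sub>v x + t \<cdot>\<^sub>v (A *\<^sub>v y)"
    using A x y by (simp add: mult_add_distrib_mat_vec mult_mat_vec)
  then have "(x + t \<cdot>\<^sub>v y) \<bullet> (A *\<^sub>v (x + t \<cdot>\<^sub>v y))
    = x \<bullet> (A *\<^sub>v x) + t * (x \<bullet> (A *\<^sub>v y)) + (t * (y \<bullet> (A *\<^sub>v x)) + t * (t * (y \<bullet> (A *\<^sub>v y))))"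
    using x y Ax Ay
    by (simp add: add_scalar_prod_distrib[of _ m] scalar_prod_add_distrib[of _ m] algebra_simps)
  then show "0 \<le> x \<bullet> (A *\<^sub>v x) + 2 * t * (x \<bullet> (A *\<^sub>v y)) + t\<^sup>2 * (y \<bullet> (A *\<^sub>v y))"
    using psd[of "x + t \<cdot>\<^sub>v y"] x y yx by (simp add: power2_eq_square algebra_simps)
qed (use psd y in auto)

lemma scalar_prod_Cauchy_Schwarz:
  fixes x y :: "real vec"
  assumes "x \<in> carrier_vec m" "y \<in> carrier_vec m"
  shows "(x \<bullet> y)\<^sup>2 \<le> (x \<bullet> x) * (y \<bullet> y)"
  using psd_Cauchy_Schwarz[of "1\<^sub>m m" m x y] assms by (simp add: scalar_prod_self_nonneg)

lemma mult_mat_vec_bounded: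
  fixes A :: "real mat"
  assumes A: "A \<in> carrier_mat m m"
  shows "\<exists>C>0. \<forall>x\<in>carrier_vec m. (A *\<^sub>v x) \<bullet> (A *\<^sub>v x) \<le> C * (x \<bullet> x)"
proof (intro exI conjI ballI)
  \<comment> \<open>The squared Frobenius norm; the added 1 keeps the bound positive for the zero
    matrix.\<close>
  let ?C = "(\<Sum>i<m. row A i \<bullet> row A i) + 1"
  show "0 < ?C" by (simp add: add_nonneg_pos sum_nonneg scalar_prod_self_nonneg)
  fix x :: "real vec" assume x: "x \<in> carrier_vec m"
  have "(A *\<^sub>v x) \<bullet> (A *\<^sub>v x) = (\<Sum>i<m. (row A i \<bullet> x)\<^sup>2)"
    using A by (simp add: scalar_prod_def[of "A *\<^sub>v x"] power2_eq_square atLeast0LessThan)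
  also have "\<dots> \<le> (\<Sum>i<m. (row A i \<bullet> row A i) * (x \<bullet> x))"
    using A x by (intro sum_mono scalar_prod_Cauchy_Schwarz[of _ m]) auto
  also have "\<dots> \<le> ?C * (x \<bullet> x)"
    by (simp add: sum_distrib_right[symmetric] distrib_right scalar_prod_self_nonneg)
  finally show "(A *\<^sub>v x) \<bullet> (A *\<^sub>v x) \<le> ?C * (x \<bullet> x)" .
qed

lemma quadratic_form_bounded:
  fixes A :: "real mat"
  assumes A: "A \<in> carrier_mat m m"
  shows "\<exists>C>0. \<forall>x\<in>carrier_vec m. x \<bullet> (A *\<^sub>v x) \<le> C * (x \<bullet> x)"
proof -
  obtain C where C: "C > 0" "\<And>x. x \<in> carrier_vec m \<Longrightarrow> (A *\<^sub>v x) \<bullet> (A *\<^sub>v x) \<le> C * (x \<bullet> x)"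
    using mult_mat_vec_bounded[OF A] by auto
  have "x \<bullet> (A *\<^sub>v x) \<le> sqrt C * (x \<bullet> x)" if x: "x \<in> carrier_vec m" for x
  proof -
    have "(x \<bullet> (A *\<^sub>v x))\<^sup>2 \<le> (x \<bullet> x) * ((A *\<^sub>v x) \<bullet> (A *\<^sub>v x))"
      using A x by (intro scalar_prod_Cauchy_Schwarz[of _ m]) auto
    also have "\<dots> \<le> (x \<bullet> x) * (C * (x \<bullet> x))"
      using C(2)[OF x] by (intro mult_left_mono scalar_prod_self_nonneg)
    also have "\<dots> = (sqrt C * (x \<bullet> x))\<^sup>2"
      using C(1) by (simp add: power_mult_distrib power2_eq_square)
    finally show ?thesis
      by (rule power2_le_imp_le) (intro mult_nonneg_nonneg scalar_prod_self_nonneg real_sqrt_ge_zero less_imp_le[OF C(1)])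
  qed
  then show ?thesis using C(1) by (intro exI[of _ "sqrt C"]) auto
qed

text \<open>
  No compactness is needed: if \<open>c\<close> is the least upper bound of the Rayleigh quotient but
  \<open>c I - A\<close> is invertible, then the positive semidefinite matrix \<open>c I - A\<close> is bounded below by a
  positive multiple of the identity, so \<open>c\<close> could be lowered.
\<close>
lemma sym_mat_top_eigenvalue:
  fixes A :: "real mat"
  assumes A: "A \<in> carrier_mat m m" and sym: "A\<^sup>T = A" and m: "0 < m"
  shows "\<exists>c\<in>spectrum A. \<forall>x\<in>carrier_vec m. x \<bullet> (A *\<^sub>v x) \<le> c * (x \<bullet> x)"
proof -
  define U where "U = {c. \<forall>x\<in>carrier_vec m. x \<bullet> (A *\<^sub>v x) \<le> c * (x \<bullet> x)}"
  define c where "c = Inf U"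
  define N where "N = c \<cdot>\<^sub>m 1\<^sub>m m - A"
  have neU: "U \<noteq> {}" using quadratic_form_bounded[OF A] by (auto simp: U_def)
  let ?e = "unit_vec m 0 :: real vec"
  have e: "?e \<in> carrier_vec m" by simp
  have "?e \<bullet> ?e = 1" using m by simp
  then have bdd: "bdd_below U"
    using e by (intro bdd_belowI[of _ "?e \<bullet> (A *\<^sub>v ?e)"]) (auto simp: U_def dest!: bspec[of _ _ ?e])
  have cU: "c \<in> U"
    unfolding U_def
  proof (clarify, rule ccontr)
    fix x :: "real vec" assume x: "x \<in> carrier_vec m" and "\<not> x \<bullet> (A *\<^sub>v x) \<le> c * (x \<bullet> x)"
    then have less: "c * (x \<bullet> x) < x \<bullet> (A *\<^sub>v x)" by simp
    have "x \<bullet> x \<noteq> 0"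
    proof
      assume 0: "x \<bullet> x = 0"
      then have "x \<bullet> (A *\<^sub>v x) \<le> 0" using neU x by (auto simp: U_def)
      with less 0 show False by simp
    qed
    then have pos: "0 < x \<bullet> x" using scalar_prod_self_nonneg[of x] by simp
    then have "c < (x \<bullet> (A *\<^sub>v x)) / (x \<bullet> x)" using less by (simp add: field_simps)
    then obtain d where "d \<in> U" "d < (x \<bullet> (A *\<^sub>v x)) / (x \<bullet> x)"
      using neU bdd unfolding c_def by (meson cInf_lessD)
    then have "d * (x \<bullet> x) < x \<bullet> (A *\<^sub>v x)" "x \<bullet> (A *\<^sub>v x) \<le> d * (x \<bullet> x)"
      using pos x by (auto simp: U_def pos_less_divide_eq)
    then show False by simp
  qed
  have N: "N \<in> carrier_mat m m" unfolding N_def using A by (intro minus_carrier_mat) auto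
  have Nsym: "N\<^sup>T = N"
  proof -
    have "N\<^sup>T = (c \<cdot>\<^sub>m 1\<^sub>m m)\<^sup>T - A\<^sup>T" unfolding N_def using A by (intro transpose_minus[of _ m m]) auto
    also have "(c \<cdot>\<^sub>m 1\<^sub>m m)\<^sup>T = c \<cdot>\<^sub>m (1\<^sub>m m :: real mat)" by (intro eq_matI) auto
    finally show ?thesis using sym by (simp add: N_def)
  qed
  have Nmult: "N *\<^sub>v x = c \<cdot>\<^sub>v x - A *\<^sub>v x" if x: "x \<in> carrier_vec m" for x
  proof -
    have "N *\<^sub>v x = (c \<cdot>\<^sub>m 1\<^sub>m m) *\<^sub>v x - A *\<^sub>v x"
      unfolding N_def using A x by (intro minus_mult_distrib_mat_vec) auto
    also have "(c \<cdot>\<^sub>m 1\<^sub>m m) *\<^sub>v x = c \<cdot>\<^sub>v x"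
      using x by (intro eq_vecI) auto
    finally show ?thesis .
  qed
  have Nx: "x \<bullet> (N *\<^sub>v x) = c * (x \<bullet> x) - x \<bullet> (A *\<^sub>v x)" if x: "x \<in> carrier_vec m" for x
  proof -
    show ?thesis unfolding Nmult[OF x] using A x by (subst scalar_prod_minus_distrib[of _ m]) auto
  qed
  have psd: "0 \<le> x \<bullet> (N *\<^sub>v x)" if "x \<in> carrier_vec m" for x
    using Nx[OF that] cU that by (auto simp: U_def)
  have "det N = 0"
  proof (rule ccontr)
    assume "det N \<noteq> 0"
    then obtain B where B: "B \<in> carrier_mat m m" "B * N = 1\<^sub>m m"
      using det_non_zero_imp_unit[OF N] N unfolding Units_def ring_mat_def by auto
    obtain C where C: "C > 0" "\<And>x. x \<in> carrier_vec m \<Longrightarrow> (B *\<^sub>v x) \<bullet> (B *\<^sub>v x) \<le> C * (x \<bullet> x)"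
      using mult_mat_vec_bounded[OF B(1)] by auto
    obtain C' where C': "C' > 0" "\<And>x. x \<in> carrier_vec m \<Longrightarrow> x \<bullet> (N *\<^sub>v x) \<le> C' * (x \<bullet> x)"
      using quadratic_form_bounded[OF N] by auto
    \<comment> \<open>\<open>B\<close> bounds \<open>x\<close> by \<open>N x\<close>, and
      Cauchy-Schwarz for the form of \<open>N\<close>, at \<open>x\<close> and \<open>N x\<close>,
      bounds \<open>|N x|^2\<close> by \<open>C'\<close> times the form at \<open>x\<close>.\<close>
    have low: "x \<bullet> x \<le> C * C' * (x \<bullet> (N *\<^sub>v x))" if x: "x \<in> carrier_vec m" for x
    proof -
      let ?y = "N *\<^sub>v x"
      have y: "?y \<in> carrier_vec m" using N x by simp
      have "B *\<^sub>v ?y = x" using B N x by (metis assoc_mult_mat_vec one_mult_mat_vec)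
      then have "x \<bullet> x \<le> C * (?y \<bullet> ?y)" using C(2)[OF y] by simp
      moreover have "C * (?y \<bullet> ?y) \<le> C * (C' * (x \<bullet> ?y))"
      proof -
      have "?y \<bullet> ?y \<le> C' * (x \<bullet> ?y)"
      proof (cases "?y \<bullet> ?y = 0")
        case True then show ?thesis using psd[OF x] C'(1) by simp
      next
        case False
        then have pos: "0 < ?y \<bullet> ?y" using scalar_prod_self_nonneg[of ?y] by simp
        have "(?y \<bullet> ?y)\<^sup>2 = (x \<bullet> (N *\<^sub>v ?y))\<^sup>2" using scalar_prod_sym_mat[OF N Nsym x y] by simp
        also have "\<dots> \<le> (x \<bullet> ?y) * (?y \<bullet> (N *\<^sub>v ?y))"
          by (rule psd_Cauchy_Schwarz[OF N Nsym psd x y])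
        also have "\<dots> \<le> (x \<bullet> ?y) * (C' * (?y \<bullet> ?y))"
          by (rule mult_left_mono[OF C'(2)[OF y] psd[OF x]])
        finally show ?thesis using pos by (simp add: power2_eq_square mult.commute)
      qed
      then show ?thesis using C(1) by simp
      qed
      ultimately show ?thesis by (simp add: mult.assoc)
    qed
    have "c - 1 / (C * C') \<in> U"
      unfolding U_def
    proof (clarify)
      fix x :: "real vec" assume x: "x \<in> carrier_vec m"
      have "(x \<bullet> x) / (C * C') \<le> x \<bullet> (N *\<^sub>v x)"
        using low[OF x] C(1) C'(1) by (simp add: field_simps)
      then show "x \<bullet> (A *\<^sub>v x) \<le> (c - 1 / (C * C')) * (x \<bullet> x)"
        using Nx[OF x] by (simp add: algebra_simps)
    qed
    then have "c \<le> c - 1 / (C * C')" unfolding c_def using bdd by (intro cInf_lower)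
    then show False using C(1) C'(1) by (simp add: field_simps)
  qed
  then obtain v where v: "v \<in> carrier_vec m" "v \<noteq> 0\<^sub>v m" "N *\<^sub>v v = 0\<^sub>v m"
    using det_0_iff_vec_prod_zero[OF N] by auto
  have "A *\<^sub>v v = c \<cdot>\<^sub>v v"
  proof -
    have "(c \<cdot>\<^sub>v v - A *\<^sub>v v) $ i = 0" if "i < m" for i
      using that v(3) unfolding Nmult[OF v(1)] by simp
    then show ?thesis using A v(1) by (intro eq_vecI) auto
  qed
  then have "c \<in> spectrum A"
    using A v unfolding spectrum_def eigenvalue_def eigenvector_def by auto
  then show ?thesis using cU by (auto simp: U_def)
qed

lemma
  fixes A :: "real mat"
  assumes A: "A \<in> carrier_mat m m" and sym: "A\<^sup>T = A" and m: "0 < m"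
  shows rho_in_spectrum: "rho A \<in> spectrum A"
    and rayleigh_le_rho: "x \<in> carrier_vec m \<Longrightarrow> x \<bullet> (A *\<^sub>v x) \<le> rho A * (x \<bullet> x)"
    and rho_min_le_rayleigh: "x \<in> carrier_vec m \<Longrightarrow> rho_min A * (x \<bullet> x) \<le> x \<bullet> (A *\<^sub>v x)"
proof -
  have fin: "finite (spectrum A)" by (rule card_finite_spectrum[OF A])
  obtain c where c: "c \<in> spectrum A" "\<And>x. x \<in> carrier_vec m \<Longrightarrow> x \<bullet> (A *\<^sub>v x) \<le> c * (x \<bullet> x)"
    using sym_mat_top_eigenvalue[OF A sym m] by auto
  then show "rho A \<in> spectrum A"
    using fin unfolding rho_def by (auto intro!: Max_in)
  have "c \<le> rho A" using fin c(1) by (simp add: rho_def)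
  then show "x \<in> carrier_vec m \<Longrightarrow> x \<bullet> (A *\<^sub>v x) \<le> rho A * (x \<bullet> x)"
    using c(2)[of x] mult_right_mono[OF _ scalar_prod_self_nonneg, of c "rho A" x] by simp
  \<comment> \<open>The lower bound is the upper one for \<open>- A\<close>, whose top eigenvalue is
    the negative of an eigenvalue of \<open>A\<close>.\<close>
  have nA: "- A \<in> carrier_mat m m" "(- A)\<^sup>T = - A" using A sym by (auto simp: transpose_uminus)
  have neg: "(- A) *\<^sub>v y = - (A *\<^sub>v y)" if "y \<in> carrier_vec m" for y
    using A that by (intro uminus_mult_mat_vec) auto
  obtain d where d: "d \<in> spectrum (- A)"
      "\<And>x. x \<in> carrier_vec m \<Longrightarrow> x \<bullet> ((- A) *\<^sub>v x) \<le> d * (x \<bullet> x)"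
    using sym_mat_top_eigenvalue[OF nA m] by auto
  obtain v where v: "v \<in> carrier_vec m" "v \<noteq> 0\<^sub>v m" "(- A) *\<^sub>v v = d \<cdot>\<^sub>v v"
    using d(1) A unfolding spectrum_def eigenvalue_def eigenvector_def by auto
  have "A *\<^sub>v v = (- d) \<cdot>\<^sub>v v"
  proof (intro eq_vecI)
    fix i assume "i < dim_vec (- d \<cdot>\<^sub>v v)"
    then have i: "i < m" using v(1) by simp
    have "(- (A *\<^sub>v v)) $ i = (d \<cdot>\<^sub>v v) $ i" using v neg[OF v(1)] by simp
    then show "(A *\<^sub>v v) $ i = (- d \<cdot>\<^sub>v v) $ i" using i A v(1) by simp
  qed (use A v in auto)
  then have "- d \<in> spectrum A"
    using A v(1,2) unfolding spectrum_def eigenvalue_def eigenvector_def by auto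
  then have "rho_min A \<le> - d" using fin by (simp add: rho_min_def)
  then show "rho_min A * (x \<bullet> x) \<le> x \<bullet> (A *\<^sub>v x)" if x: "x \<in> carrier_vec m"
    using d(2)[OF x] neg[OF x] A x mult_right_mono[OF _ scalar_prod_self_nonneg, of "rho_min A" "- d" x]
    by simp
qed

text \<open>Induction on \<open>K\<close> by Schur complements: removing the rank one term built
  from the last column leaves a semidefinite array on the remaining indices. The result stands in
  for a diagonalization in the trace inequalities below.\<close>

lemma psd_rank_one_decomposition:
  fixes N :: "nat \<Rightarrow> nat \<Rightarrow> real"
  assumes sym: "\<And>i j. i < K \<Longrightarrow> j < K \<Longrightarrow> N i j = N j i"
    and psd: "\<And>x. 0 \<le> (\<Sum>i<K. \<Sum>j<K. x i * N i j * x j)"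
  shows "\<exists>B :: nat \<Rightarrow> nat \<Rightarrow> real. \<forall>i<K. \<forall>j<K. N i j = (\<Sum>k<K. B k i * B k j)"
  using assms
proof (induction K arbitrary: N)
  case 0
  then show ?case by simp
next
  case (Suc K)
  define d where "d = N K K"
  have form: "(\<Sum>i<Suc K. \<Sum>j<Suc K. x i * N i j * x j)
    = (\<Sum>i<K. \<Sum>j<K. x i * N i j * x j) + 2 * x K * (\<Sum>i<K. x i * N i K) + (x K)\<^sup>2 * d" for x
  proof -
    have "(\<Sum>j<K. x K * N K j * x j) = x K * (\<Sum>i<K. x i * N i K)"
      using Suc.prems(1)[of K] by (simp add: sum_distrib_left mult_ac)
    moreover have "(\<Sum>i<K. x i * N i K * x K) = x K * (\<Sum>i<K. x i * N i K)"
      by (simp add: sum_distrib_left mult_ac)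
    ultimately show ?thesis
      by (simp add: sum.distrib d_def power2_eq_square)
  qed
  have d0: "0 \<le> d"
    using Suc.prems(2)[of "\<lambda>i. if i = K then 1 else 0"] unfolding form by simp
  have col: "N i K = 0" if "d = 0" "i < K" for i
  proof (rule ccontr)
    assume n: "N i K \<noteq> 0"
    \<comment> \<open>Makes the form equal to -1 at \<open>e_i + t e_K\<close>, since
      \<open>t^2\<close> has the coefficient \<open>d = 0\<close>.\<close>
    define t where "t = (- N i i - 1) / (2 * N i K)"
    define x where "x j = (if j = K then t else if j = i then 1 else 0)" for j
    have "t * (2 * N i K) = - N i i - 1"
      using nonzero_eq_divide_eq[of "2 * N i K" t "- N i i - 1"] n by (simp add: t_def)
    moreover have "(\<Sum>i<K. \<Sum>j<K. x i * N i j * x j) = N i i"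
    proof -
      have "(\<Sum>a<K. \<Sum>j<K. x a * N a j * x j) = (\<Sum>a<K. if a = i then (\<Sum>j<K. if j = i then N i i else 0) else 0)"
      proof (intro sum.cong refl)
        fix a assume "a \<in> {..<K}"
        have "(\<Sum>j<K. x a * N a j * x j) = (\<Sum>j<K. if a = i \<and> j = i then N i i else 0)"
          using \<open>a \<in> {..<K}\<close> by (intro sum.cong refl) (auto simp: x_def)
        then show "(\<Sum>j<K. x a * N a j * x j) = (if a = i then (\<Sum>j<K. if j = i then N i i else 0) else 0)"
          by simp
      qed
      then show ?thesis using that by simp
    qed
    moreover have "(\<Sum>a<K. x a * N a K) = N i K"
    proof -
      have "(\<Sum>a<K. x a * N a K) = (\<Sum>a<K. if a = i then N i K else 0)"
        by (intro sum.cong refl) (auto simp: x_def)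
      then show ?thesis using that by simp
    qed
    moreover have "x K = t" by (simp add: x_def)
    ultimately show False using Suc.prems(2)[of x] that(1) unfolding form by simp
  qed
  \<comment> \<open>For \<open>d = 0\<close> the quotient is 0 by convention, and \<open>col\<close>
    says that nothing had to be removed, so both cases share one formula.\<close>
  define N' where "N' i j = N i j - N i K * N j K / d" for i j
  have "\<exists>B. \<forall>i<K. \<forall>j<K. N' i j = (\<Sum>k<K. B k i * B k j)"
  proof (rule Suc.IH)
    show "N' i j = N' j i" if "i < K" "j < K" for i j
      using Suc.prems(1)[of i j] that by (simp add: N'_def mult.commute)
  next
    fix x :: "nat \<Rightarrow> real"
    define b where "b = (\<Sum>i<K. x i * N i K)"
    \<comment> \<open>For \<open>d > 0\<close> the value \<open>- b / d\<close> minimizes the form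
      over its last coordinate, and the minimum is the form of \<open>N'\<close>.\<close>
    define y where "y i = (if i = K then - b / d else x i)" for i
    have "b * b = (\<Sum>i<K. \<Sum>j<K. x i * N i K * (x j * N j K))"
      by (simp add: b_def sum_product)
    then have "(\<Sum>i<K. \<Sum>j<K. x i * N' i j * x j) = (\<Sum>i<K. \<Sum>j<K. x i * N i j * x j) - b * b / d"
      unfolding N'_def by (simp add: algebra_simps sum_subtractf sum_divide_distrib)
    also have "\<dots> = (\<Sum>i<Suc K. \<Sum>j<Suc K. y i * N i j * y j)"
    proof -
      have y1: "(\<Sum>i<K. \<Sum>j<K. y i * N i j * y j) = (\<Sum>i<K. \<Sum>j<K. x i * N i j * x j)"
        by (intro sum.cong refl) (auto simp: y_def)
      have y2: "(\<Sum>i<K. y i * N i K) = b"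
        unfolding b_def by (intro sum.cong refl) (auto simp: y_def)
      have yK: "y K = - b / d" by (simp add: y_def)
      show ?thesis unfolding form y1 y2 yK
        by (cases "d = 0") (simp_all add: field_simps power2_eq_square)
    qed
    also have "0 \<le> \<dots>" by (rule Suc.prems(2))
    finally show "0 \<le> (\<Sum>i<K. \<Sum>j<K. x i * N' i j * x j)" .
  qed
  then obtain B where B: "\<And>i j. i < K \<Longrightarrow> j < K \<Longrightarrow> N' i j = (\<Sum>k<K. B k i * B k j)" by auto
  define C where "C k i = (if k = K then N i K / sqrt d else if i = K then 0 else B k i)" for k i
  have "N i j = (\<Sum>k<Suc K. C k i * C k j)" if ij: "i < Suc K" "j < Suc K" for i j
  proof -
    have last: "C K i * C K j = N i K * N j K / d" using d0 by (simp add: C_def)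
    consider "i < K" "j < K" | "i = K \<or> j = K" using ij by (auto simp: less_Suc_eq)
    then show ?thesis
    proof cases
      case 1
      then have "(\<Sum>k<K. C k i * C k j) = N' i j" by (simp add: B C_def)
      then show ?thesis using last by (simp add: N'_def)
    next
      case 2
      then have "(\<Sum>k<K. C k i * C k j) = 0" by (auto simp: C_def intro!: sum.neutral)
      moreover have "N i K * N j K / d = N i j"
        using 2 ij Suc.prems(1)[of K j] col[of i] col[of j]
        by (cases "d = 0") (auto simp: d_def less_Suc_eq)
      ultimately show ?thesis using last by simp
    qed
  qed
  then show ?case by auto
qed

text \<open>Each rank one summand is bounded by Cauchy-Schwarz. At an eigenvector this says that an
  eigenvalue is at most the trace.\<close>

lemma psd_quadratic_form_le_trace:
  fixes N :: "nat \<Rightarrow> nat \<Rightarrow> real"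
  assumes sym: "\<And>i j. i < K \<Longrightarrow> j < K \<Longrightarrow> N i j = N j i"
    and psd: "\<And>x. 0 \<le> (\<Sum>i<K. \<Sum>j<K. x i * N i j * x j)"
  shows "(\<Sum>i<K. \<Sum>j<K. x i * N i j * x j) \<le> (\<Sum>i<K. N i i) * (\<Sum>i<K. (x i)\<^sup>2)"
proof -
  obtain B where B: "\<And>i j. i < K \<Longrightarrow> j < K \<Longrightarrow> N i j = (\<Sum>k<K. B k i * B k j)"
    using psd_rank_one_decomposition[OF assms] by blast
  have "(\<Sum>i<K. \<Sum>j<K. x i * N i j * x j)
      = (\<Sum>i<K. \<Sum>j<K. \<Sum>k<K. x i * B k i * (x j * B k j))"
    by (intro sum.cong refl) (simp add: B sum_distrib_left sum_distrib_right mult_ac)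
  also have "\<dots> = (\<Sum>k<K. \<Sum>i<K. \<Sum>j<K. x i * B k i * (x j * B k j))"
    by (subst sum.swap[of _ "{..<K}" "{..<K}", where g = "\<lambda>j k. _ j k"])
      (subst sum.swap, simp)
  also have "\<dots> = (\<Sum>k<K. (\<Sum>i<K. x i * B k i)\<^sup>2)"
    by (simp add: power2_eq_square sum_product)
  also have "\<dots> \<le> (\<Sum>k<K. (\<Sum>i<K. (x i)\<^sup>2) * (\<Sum>i<K. (B k i)\<^sup>2))"
    by (intro sum_mono Cauchy_Schwarz_ineq_sum)
  also have "\<dots> = (\<Sum>i<K. \<Sum>k<K. (B k i)\<^sup>2) * (\<Sum>i<K. (x i)\<^sup>2)"
    unfolding sum.swap[of "\<lambda>i k. (B k i)\<^sup>2"] by (simp only: sum_distrib_left mult.commute)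
  also have "(\<Sum>i<K. \<Sum>k<K. (B k i)\<^sup>2) = (\<Sum>i<K. N i i)"
    by (intro sum.cong) (auto simp: B power2_eq_square)
  finally show ?thesis .
qed

text \<open>Writing \<open>T\<close> as a sum of terms \<open>b b^T\<close> turns the trace of the
  product into a sum of values \<open>b^T N b\<close>.\<close>

lemma psd_trace_product_nonneg:
  fixes T N :: "nat \<Rightarrow> nat \<Rightarrow> real"
  assumes sym: "\<And>i j. i < K \<Longrightarrow> j < K \<Longrightarrow> T i j = T j i"
    and psd: "\<And>x. 0 \<le> (\<Sum>i<K. \<Sum>j<K. x i * T i j * x j)"
    and psd': "\<And>x. 0 \<le> (\<Sum>i<K. \<Sum>j<K. x i * N i j * x j)"
  shows "0 \<le> (\<Sum>i<K. \<Sum>j<K. T i j * N i j)"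
proof -
  obtain B where B: "\<And>i j. i < K \<Longrightarrow> j < K \<Longrightarrow> T i j = (\<Sum>k<K. B k i * B k j)"
    using psd_rank_one_decomposition[OF sym psd] by blast
  have "(\<Sum>i<K. \<Sum>j<K. T i j * N i j) = (\<Sum>i<K. \<Sum>j<K. \<Sum>k<K. B k i * N i j * B k j)"
    by (intro sum.cong refl) (simp add: B sum_distrib_left mult_ac)
  also have "\<dots> = (\<Sum>i<K. \<Sum>k<K. \<Sum>j<K. B k i * N i j * B k j)"
    by (intro sum.cong refl sum.swap)
  also have "\<dots> = (\<Sum>k<K. \<Sum>i<K. \<Sum>j<K. B k i * N i j * B k j)"
    by (rule sum.swap)
  also have "0 \<le> \<dots>" by (intro sum_nonneg psd')
  finally show ?thesis .
qed

text \<open>Consecutive ratios of \<open>D\<close> grow by a factor of at least \<open>q^2\<close>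
  per step, yet \<open>d\<close> confines all of them to the interval from \<open>1 / d\<close> to
  \<open>d\<close>. Hence \<open>q ^ (K - 2) \<le> d\<close>, and Bernoulli's inequality makes this
  linear in \<open>K\<close>.\<close>

lemma dimension_le_condition_numbers:
  fixes D :: "nat \<Rightarrow> real"
  assumes K: "1 \<le> K" and \<kappa>: "1 \<le> \<kappa>"
    and pos: "\<And>i. i < K \<Longrightarrow> 0 < D i"
    and cond: "\<And>i j. i < K \<Longrightarrow> j < K \<Longrightarrow> D i \<le> d * D j"
    and convex: "\<And>i. i + 2 < K \<Longrightarrow> D (i + 1) \<le> (1 - 1 / \<kappa>) * sqrt (D i * D (i + 2))"
  shows "real K \<le> 2 * \<kappa> * d"
proof -
  have d1: "1 \<le> d" using cond[of 0 0] pos[of 0] K by simp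
  \<comment> \<open>A substitute for \<open>1 / (1 - 1 / \<kappa>)\<close> that stays meaningful at
    \<open>\<kappa> = 1\<close>; its product with \<open>1 - 1 / \<kappa>\<close> is at most
    1.\<close>
  define q where "q = 1 + 1 / \<kappa>"
  have q1: "1 \<le> q" using \<kappa> by (simp add: q_def)
  have "real K \<le> 2 * (\<kappa> + real K - 2)" if "2 \<le> K"
  proof -
    have "2 \<le> real K" using that by simp
    then show ?thesis using \<kappa> by (simp add: algebra_simps)
  qed
  moreover have "\<kappa> + real K - 2 \<le> \<kappa> * d" if K2: "2 \<le> K"
  proof -
    define r where "r i = D (i + 1) / D i" for i
    have r_pos: "0 < r i" if "i + 1 < K" for i using pos[of i] pos[of "i + 1"] that by (simp add: r_def)
    have step: "q\<^sup>2 * r i \<le> r (i + 1)" if i: "i + 2 < K" for i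
    proof -
      have D: "0 < D i" "0 < D (i + 1)" "0 < D (i + 2)" using pos i by auto
      have "q * D (i + 1) \<le> q * ((1 - 1 / \<kappa>) * sqrt (D i * D (i + 2)))"
        using convex[OF i] q1 by (intro mult_left_mono) auto
      also have "\<dots> = (1 - 1 / \<kappa> * (1 / \<kappa>)) * sqrt (D i * D (i + 2))"
      proof -
        have "(1 + e) * ((1 - e) * w) = (1 - e * e) * w" for e w :: real
          by (simp add: algebra_simps)
        then show ?thesis by (simp only: q_def)
      qed
      also have "\<dots> \<le> 1 * sqrt (D i * D (i + 2))"
        using \<kappa> D by (intro mult_right_mono) auto
      finally have "(q * D (i + 1))\<^sup>2 \<le> (sqrt (D i * D (i + 2)))\<^sup>2"
        using D q1 by (intro power_mono) auto
      then have "q\<^sup>2 * D (i + 1) * D (i + 1) \<le> D i * D (i + 2)"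
        using D by (simp add: power_mult_distrib power2_eq_square mult_ac)
      then show ?thesis using D by (simp add: r_def field_simps)
    qed
    have grow: "(q ^ i)\<^sup>2 * r 0 \<le> r i" if "i + 1 < K" for i
      using that
    proof (induction i)
      case (Suc i)
      have "(q ^ Suc i)\<^sup>2 * r 0 = q\<^sup>2 * ((q ^ i)\<^sup>2 * r 0)" by (simp add: power_mult_distrib)
      also have "\<dots> \<le> q\<^sup>2 * r i" using Suc by (intro mult_left_mono) auto
      also have "\<dots> \<le> r (Suc i)" using step[of i] Suc.prems by simp
      finally show ?case .
    qed simp
    have "r (K - 2) \<le> d" using cond[of "K - 1" "K - 2"] pos[of "K - 2"] K2
      by (simp add: r_def Suc_diff_Suc numeral_2_eq_2 field_simps)
    then have "(q ^ (K - 2))\<^sup>2 * r 0 \<le> d" using grow[of "K - 2"] K2 by linarith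
    moreover have "1 \<le> d * r 0" using cond[of 0 1] pos[of 0] K2 by (simp add: r_def field_simps)
    ultimately have "(q ^ (K - 2))\<^sup>2 \<le> d\<^sup>2"
    proof -
      assume a: "(q ^ (K - 2))\<^sup>2 * r 0 \<le> d" and b: "1 \<le> d * r 0"
      have "(q ^ (K - 2))\<^sup>2 * 1 \<le> (q ^ (K - 2))\<^sup>2 * (d * r 0)" using b by (intro mult_left_mono) auto
      also have "\<dots> = d * ((q ^ (K - 2))\<^sup>2 * r 0)" by simp
      also have "\<dots> \<le> d * d" using a d1 by (intro mult_left_mono) auto
      finally show ?thesis by (simp add: power2_eq_square)
    qed
    then have "q ^ (K - 2) \<le> d" by (rule power2_le_imp_le) (use d1 in simp)
    moreover have "1 + real (K - 2) * (1 / \<kappa>) \<le> q ^ (K - 2)"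
      unfolding q_def
    proof (rule Bernoulli_inequality)
      have "0 \<le> 1 / \<kappa>" using \<kappa> by simp
      then show "- 1 \<le> 1 / \<kappa>" by linarith
    qed
    ultimately have "\<kappa> * (1 + real (K - 2) * (1 / \<kappa>)) \<le> \<kappa> * d" using \<kappa> by (intro mult_left_mono) auto
    moreover have "\<kappa> * (1 + real (K - 2) * (1 / \<kappa>)) = \<kappa> + real K - 2"
      using \<kappa> K2 by (simp add: distrib_left of_nat_diff)
    ultimately show ?thesis by simp
  qed
  moreover have "1 \<le> \<kappa> * d" using \<kappa> d1 mult_mono[of 1 \<kappa> 1 d] by simp
  ultimately show ?thesis using K by (cases "2 \<le> K") auto
qed

section \<open>Measurability of determinants and inverses of random matrices\<close>

lemma measurable_det:
  fixes A :: "'a \<Rightarrow> real mat"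
  assumes A: "\<And>x. A x \<in> carrier_mat m m"
    and meas: "\<And>i j. i < m \<Longrightarrow> j < m \<Longrightarrow> (\<lambda>x. A x $$ (i, j)) \<in> borel_measurable M"
  shows "(\<lambda>x. det (A x)) \<in> borel_measurable M"
proof -
  have "(\<lambda>x. det (A x)) = (\<lambda>x. \<Sum>p | p permutes {0..<m}. signof p * (\<Prod>i = 0..<m. A x $$ (i, p i)))"
    by (intro ext) (rule Determinant.det_def'[OF A])
  also have "\<dots> \<in> borel_measurable M"
    using permutes_in_image[of _ "{0..<m}"]
    by (intro borel_measurable_sum borel_measurable_times borel_measurable_const
        borel_measurable_prod meas) auto
  finally show ?thesis .
qed

lemma minv_mat:
  fixes A :: "real mat"
  assumes A: "A \<in> carrier_mat m m" and det: "det A \<noteq> 0"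
  shows "minv A \<in> carrier_mat m m" "A * minv A = 1\<^sub>m m" "minv A * A = 1\<^sub>m m"
proof -
  have "A \<in> Units (ring_mat TYPE(real) m ())" using det_non_zero_imp_unit[OF A det] .
  then obtain B where "mat_inverse A = Some B" using mat_inverse(1)[OF A] by fastforce
  then show "minv A \<in> carrier_mat m m" "A * minv A = 1\<^sub>m m" "minv A * A = 1\<^sub>m m"
    using mat_inverse(2)[OF A] by (auto simp: minv_def)
qed

text \<open>Cramer's rule for the inverse returned by \<open>mat_inverse\<close>: it exhibits the
  entries as quotients of polynomials, hence as measurable functions of the entries of
  \<open>A\<close>.\<close>

lemma minv_adj_mat:
  fixes A :: "real mat"
  assumes A: "A \<in> carrier_mat m m" and det: "det A \<noteq> 0" and i: "i < m" "j < m"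
  shows "minv A $$ (i, j) = adj_mat A $$ (i, j) / det A"
proof -
  note V = minv_mat[OF A det] and J = adj_mat[OF A]
  have "adj_mat A = adj_mat A * (A * minv A)" using V J by simp
  also have "\<dots> = (adj_mat A * A) * minv A" using V J A by (intro assoc_mult_mat[symmetric]) auto
  also have "\<dots> = det A \<cdot>\<^sub>m minv A" using V J by (simp add: mult_smult_assoc_mat[of _ m m])
  finally have "adj_mat A $$ (i, j) = det A * minv A $$ (i, j)" using i V(1) by simp
  then show ?thesis using det by simp
qed

lemma measurable_minv:
  fixes A :: "'a \<Rightarrow> real mat"
  assumes A: "\<And>x. A x \<in> carrier_mat m m" and det: "\<And>x. det (A x) \<noteq> 0"
    and meas: "\<And>i j. i < m \<Longrightarrow> j < m \<Longrightarrow> (\<lambda>x. A x $$ (i, j)) \<in> borel_measurable M"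
    and i: "i < m" "j < m"
  shows "(\<lambda>x. minv (A x) $$ (i, j)) \<in> borel_measurable M"
proof -
  have "(\<lambda>x. det (mat_delete (A x) j i)) \<in> borel_measurable M"
  proof (rule measurable_det)
    show "mat_delete (A x) j i \<in> carrier_mat (m - 1) (m - 1)" for x
      using A[of x] by (rule mat_delete_carrier)
    fix a b assume ab: "a < m - 1" "b < m - 1"
    have "mat_delete (A x) j i $$ (a, b)
        = A x $$ (if a < j then a else Suc a, if b < i then b else Suc b)" for x
      using A[of x] ab by (simp add: mat_delete_def)
    then show "(\<lambda>x. mat_delete (A x) j i $$ (a, b)) \<in> borel_measurable M"
      using ab by (simp add: meas)
  qed
  then have "(\<lambda>x. cofactor (A x) j i) \<in> borel_measurable M"
    unfolding cofactor_def by measurable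
  then have "(\<lambda>x. cofactor (A x) j i / det (A x)) \<in> borel_measurable M"
    using measurable_det[OF A meas] by measurable
  moreover have "minv (A x) $$ (i, j) = cofactor (A x) j i / det (A x)" for x
    using minv_adj_mat[OF A det i, of x] A[of x] i by (simp add: adj_mat_def)
  ultimately show ?thesis by simp
qed

section \<open>Gaussian noise\<close>

lemma prob_space_gauss_noise:
  assumes "0 < \<tau>" shows "prob_space (gauss_noise n \<tau>)"
  unfolding gauss_noise_def using prob_space_normal_density[OF assms] by (intro prob_space_PiM)

lemma measurable_gauss_noise_component [measurable]:
  "i < n \<Longrightarrow> (\<lambda>\<epsilon>. \<epsilon> i) \<in> borel_measurable (gauss_noise n \<tau>)"
  unfolding gauss_noise_def by measurable

lemma
  assumes \<tau>: "0 < \<tau>" and k: "k < n" and l: "l < n"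
  shows integrable_gauss_noise_prod: "integrable (gauss_noise n \<tau>) (\<lambda>\<epsilon>. \<epsilon> k * \<epsilon> l)"
    and integral_gauss_noise_prod:
      "(\<integral>\<epsilon>. \<epsilon> k * \<epsilon> l \<partial>gauss_noise n \<tau>) = (if k = l then \<tau>\<^sup>2 else 0)"
proof -
  let ?M = "density lborel (\<lambda>x. ennreal (normal_density 0 \<tau> x))"
  interpret N: prob_space ?M by (rule prob_space_normal_density[OF \<tau>])
  interpret product_sigma_finite "\<lambda>_ :: nat. ?M" by standard
  \<comment> \<open>Writes \<open>\<epsilon> k * \<epsilon> l\<close> as a product over all
    coordinates, with a squared factor when \<open>k = l\<close>, so that one product formula treats
    both cases.\<close>
  define f where "f i x = (if i = k then x else 1) * (if i = l then x else 1)" for i and x :: real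
  have prod: "(\<Prod>i<n. f i (\<epsilon> i)) = \<epsilon> k * \<epsilon> l" for \<epsilon> :: "nat \<Rightarrow> real"
    using k l by (simp add: f_def prod.distrib)
  have mom: "integrable ?M (\<lambda>x. x ^ j)" for j
    using integrable_normal_moment[OF \<tau>, of 0 j]
    by (subst integrable_density) (auto simp: mult.commute)
  have int: "integrable ?M (f i)" for i
    using mom[of 0] mom[of 1] mom[of 2] unfolding f_def
    by (cases "i = k"; cases "i = l") (auto simp: power2_eq_square)
  show "integrable (gauss_noise n \<tau>) (\<lambda>\<epsilon>. \<epsilon> k * \<epsilon> l)"
    using product_integrable_prod[of "{..<n}" f] int unfolding prod gauss_noise_def by auto
  have "(\<integral>\<epsilon>. \<epsilon> k * \<epsilon> l \<partial>gauss_noise n \<tau>) = (\<Prod>i<n. integral\<^sup>L ?M (f i))"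
    using product_integral_prod[of "{..<n}" f] int unfolding prod gauss_noise_def by auto
  also have "\<dots> = (if k = l then \<tau>\<^sup>2 else 0)"
  proof -
    have 1: "(\<integral>x. x \<partial>?M) = 0"
      using integral_normal_moment_nz_1[OF \<tau>, of 0]
      by (subst integral_density) auto
    have 2: "(\<integral>x. x * x \<partial>?M) = \<tau>\<^sup>2"
      using integral_normal_moment_even[OF \<tau>, of 0 1]
      by (subst integral_density) (auto simp: power2_eq_square fact_numeral)
    show ?thesis
    proof (cases "k = l")
      case True
      have "integral\<^sup>L ?M (f i) = (if i = k then \<tau>\<^sup>2 else 1)" for i
        using 2 N.prob_space True by (simp add: f_def[abs_def])
      then show ?thesis using True k by simp
    next
      case False
      then have "integral\<^sup>L ?M (f k) = 0" using 1 by (simp add: f_def[abs_def])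
      then show ?thesis using False k by (auto intro!: prod_zero)
    qed
  qed
  finally show "(\<integral>\<epsilon>. \<epsilon> k * \<epsilon> l \<partial>gauss_noise n \<tau>) = (if k = l then \<tau>\<^sup>2 else 0)" .
qed

section \<open>Krylov moments of a design\<close>

lemma quadratic_form_sum:
  fixes A :: "real mat"
  assumes "A \<in> carrier_mat m m" "x \<in> carrier_vec m" "y \<in> carrier_vec m"
  shows "x \<bullet> (A *\<^sub>v y) = (\<Sum>i<m. \<Sum>j<m. x $ i * A $$ (i, j) * y $ j)"
  using assms by (simp add: scalar_prod_def atLeast0LessThan sum_distrib_left mult.assoc)

lemma quadratic_form_sum_vec:
  fixes A :: "real mat"
  assumes "A \<in> carrier_mat m m"
  shows "(\<Sum>i<m. \<Sum>j<m. x i * A $$ (i, j) * x j) = Matrix.vec m x \<bullet> (A *\<^sub>v Matrix.vec m x)"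
  by (subst quadratic_form_sum[OF assms]) auto

lemma smult_mat_mult_vec:
  fixes A :: "real mat"
  assumes "A \<in> carrier_mat m k" "x \<in> carrier_vec k"
  shows "(c \<cdot>\<^sub>m A) *\<^sub>v x = c \<cdot>\<^sub>v (A *\<^sub>v x)"
  using assms by (intro eq_vecI) (simp_all add: scalar_prod_def sum_distrib_left mult.assoc)

lemma mat_entry_scalar_prod:
  fixes A :: "real mat"
  assumes "A \<in> carrier_mat m m" "i < m" "j < m"
  shows "unit_vec m i \<bullet> (A *\<^sub>v unit_vec m j) = A $$ (i, j)"
  using assms by simp

lemma krylov_carrier [simp]: "s \<in> carrier_vec p \<Longrightarrow> krylov K S s \<in> carrier_mat p K"
  unfolding krylov_def using mat_of_cols_carrier(1)[of p "map (\<lambda>j. (S ^\<^sub>m j) *\<^sub>v s) [0..<K]"] by simp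

lemma krylov_dims [simp]: "dim_row (krylov K S s) = dim_vec s" "dim_col (krylov K S s) = K"
  by (simp_all add: krylov_def)

locale design =
  fixes X :: "real mat" and n p :: nat
  assumes X_carrier [simp]: "X \<in> carrier_mat n p" and n_pos: "0 < n" and p_pos: "0 < p"
begin

abbreviation "S \<equiv> Sig X"

declare pow_mat.simps [simp del]

abbreviation Spow :: "nat \<Rightarrow> real vec \<Rightarrow> real vec" where "Spow i x \<equiv> (S ^\<^sub>m i) *\<^sub>v x"

lemma S_carrier [simp]: "S \<in> carrier_mat p p"
  unfolding Sig_def using X_carrier by (intro smult_carrier_mat mult_carrier_mat[of _ p n]) auto

lemma design_dims [simp]: "dim_row X = n" "dim_col X = p" "dim_row S = p" "dim_col S = p"
  by (fact carrier_matD[OF X_carrier] carrier_matD[OF S_carrier])+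

lemma Spow_carrier [simp]: "x \<in> carrier_vec p \<Longrightarrow> Spow i x \<in> carrier_vec p"
  by (rule mult_mat_vec_carrier[of _ p p]) auto

lemma S_mult_carrier [simp]: "x \<in> carrier_vec p \<Longrightarrow> S *\<^sub>v x \<in> carrier_vec p"
  by (rule mult_mat_vec_carrier[of _ p p]) auto

lemma X_mult_carrier [simp]: "x \<in> carrier_vec p \<Longrightarrow> X *\<^sub>v x \<in> carrier_vec n"
  by (rule mult_mat_vec_carrier[of _ n p]) auto

lemma S_mult_vec: "x \<in> carrier_vec p \<Longrightarrow> S *\<^sub>v x = (1 / real n) \<cdot>\<^sub>v (X\<^sup>T *\<^sub>v (X *\<^sub>v x))"
proof -
  assume x: "x \<in> carrier_vec p"
  have "X\<^sup>T * X \<in> carrier_mat p p" by (rule mult_carrier_mat[of _ p n]) simp_all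
  from smult_mat_mult_vec[OF this x, of "1 / real n"]
  have "S *\<^sub>v x = (1 / real n) \<cdot>\<^sub>v ((X\<^sup>T * X) *\<^sub>v x)"
    by (simp only: Sig_def design_dims)
  also have "(X\<^sup>T * X) *\<^sub>v x = X\<^sup>T *\<^sub>v (X *\<^sub>v x)"
    by (rule assoc_mult_mat_vec[of _ p n _ p]) (use x in simp_all)
  finally show ?thesis .
qed

lemma scalar_prod_S:
  assumes "x \<in> carrier_vec p" "y \<in> carrier_vec p"
  shows "x \<bullet> (S *\<^sub>v y) = (1 / real n) * ((X *\<^sub>v x) \<bullet> (X *\<^sub>v y))"
proof -
  have "x \<bullet> (X\<^sup>T *\<^sub>v (X *\<^sub>v y)) = (X\<^sup>T *\<^sub>v (X *\<^sub>v y)) \<bullet> x"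
    using assms by (intro comm_scalar_prod[of _ p]) (auto intro: mult_mat_vec_carrier[of _ p n])
  also have "\<dots> = (X *\<^sub>v y) \<bullet> (X *\<^sub>v x)"
    by (rule transpose_vec_mult_scalar[of _ n p]) (use assms in auto)
  also have "\<dots> = (X *\<^sub>v x) \<bullet> (X *\<^sub>v y)"
    by (rule comm_scalar_prod[of _ n]) (use assms in auto)
  finally show ?thesis
    unfolding S_mult_vec[OF assms(2)] using assms
    by (subst scalar_prod_smult_distrib[of _ p]) (simp_all add: mult_mat_vec_carrier[of _ p n])
qed

lemma S_sym: "S\<^sup>T = S"
proof (rule eq_matI)
  fix i j assume ij: "i < dim_row S" "j < dim_col S"
  then have ij: "i < p" "j < p" by auto
  have "S $$ (j, i) = unit_vec p j \<bullet> (S *\<^sub>v unit_vec p i)"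
    using ij by (subst mat_entry_scalar_prod[of _ p]) auto
  also have "\<dots> = unit_vec p i \<bullet> (S *\<^sub>v unit_vec p j)"
    using ij by (simp add: scalar_prod_S comm_scalar_prod[of _ n])
  also have "\<dots> = S $$ (i, j)"
    using ij by (subst mat_entry_scalar_prod[of _ p]) auto
  finally show "S\<^sup>T $$ (i, j) = S $$ (i, j)" using ij by simp
qed auto

lemma Spow_Suc: "x \<in> carrier_vec p \<Longrightarrow> Spow (Suc i) x = Spow i (S *\<^sub>v x)"
  by (simp add: pow_mat.simps assoc_mult_mat_vec[of _ p p _ p])

lemma Spow_0 [simp]: "x \<in> carrier_vec p \<Longrightarrow> Spow 0 x = x"
  by (simp add: pow_mat.simps)

lemma Spow_Spow: "x \<in> carrier_vec p \<Longrightarrow> Spow i (Spow j x) = Spow (i + j) x"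
  by (induction j arbitrary: x) (simp_all add: Spow_Suc)

lemma S_Spow: "x \<in> carrier_vec p \<Longrightarrow> S *\<^sub>v Spow j x = Spow (Suc j) x"
  using Spow_Spow[of x 1 j] S_carrier by (simp add: Spow_Suc[of _ 0, simplified])

lemma Spow_scalar_prod:
  assumes "x \<in> carrier_vec p" "y \<in> carrier_vec p"
  shows "Spow i x \<bullet> y = x \<bullet> Spow i y"
  using assms
proof (induction i arbitrary: x)
  case (Suc i)
  have "Spow (Suc i) x \<bullet> y = (S *\<^sub>v x) \<bullet> Spow i y"
    using Suc by (simp add: Spow_Suc)
  also have "\<dots> = x \<bullet> (S *\<^sub>v Spow i y)"
    using Suc.prems by (intro scalar_prod_sym_mat[OF S_carrier S_sym]) auto
  also have "S *\<^sub>v Spow i y = Spow (Suc i) y" using Suc.prems by (intro S_Spow) auto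
  finally show ?case .
qed simp

lemma Spow_scalar_prod_Spow:
  assumes "x \<in> carrier_vec p" "y \<in> carrier_vec p"
  shows "Spow i x \<bullet> Spow j y = x \<bullet> Spow (i + j) y"
  using assms by (simp add: Spow_scalar_prod Spow_Spow)

lemma S_psd: "x \<in> carrier_vec p \<Longrightarrow> 0 \<le> x \<bullet> (S *\<^sub>v x)"
  by (simp add: scalar_prod_S scalar_prod_self_nonneg)

text \<open>Splitting a moment in the middle replaces the diagonalization of \<open>S\<close>: every
  moment is a squared norm or a value of the form of \<open>S\<close>, so statements about powers
  reduce to \<open>S\<close> itself.\<close>

lemma moment_split:
  assumes x: "x \<in> carrier_vec p"
  shows "x \<bullet> Spow (2 * l) x = Spow l x \<bullet> Spow l x"
    and "x \<bullet> Spow (Suc (2 * l)) x = Spow l x \<bullet> (S *\<^sub>v Spow l x)"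
    and "x \<bullet> Spow (Suc (Suc (2 * l))) x = (S *\<^sub>v Spow l x) \<bullet> (S *\<^sub>v Spow l x)"
  by (simp_all only: S_Spow[OF x] Spow_scalar_prod_Spow[OF x x] mult_2 add_Suc add_Suc_right)

lemma moment_nonneg:
  assumes x: "x \<in> carrier_vec p"
  shows "0 \<le> x \<bullet> Spow i x"
proof (cases "even i")
  case True
  then obtain l where "i = 2 * l" by blast
  then show ?thesis by (simp only: moment_split[OF x] scalar_prod_self_nonneg)
next
  case False
  then obtain l where "i = Suc (2 * l)" by (auto elim: oddE)
  then show ?thesis using S_psd[of "Spow l x"] x by (simp only: moment_split[OF x] Spow_carrier)
qed

lemma rho_nonneg: "0 \<le> rho S"
proof -
  let ?e = "unit_vec p 0 :: real vec"
  have "0 \<le> ?e \<bullet> (S *\<^sub>v ?e)" by (rule S_psd) simp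
  also have "\<dots> \<le> rho S * (?e \<bullet> ?e)" by (rule rayleigh_le_rho[OF S_carrier S_sym p_pos]) simp
  also have "?e \<bullet> ?e = 1" using p_pos by simp
  finally show ?thesis by simp
qed

text \<open>From an even to an odd moment this is the Rayleigh bound at \<open>Spow l x\<close>.
  From odd to even it reads \<open>|S y|^2 \<le> rho S * (y \<bullet> S y)\<close>, which follows
  from Cauchy-Schwarz for the form of \<open>S\<close> at \<open>y\<close> and
  \<open>S y\<close>.\<close>

lemma moment_Suc_le:
  assumes x: "x \<in> carrier_vec p"
  shows "x \<bullet> Spow (Suc i) x \<le> rho S * (x \<bullet> Spow i x)"
proof (cases "even i")
  case True
  then obtain l where i: "i = 2 * l" by blast
  show ?thesis
    unfolding i moment_split[OF x] using x by (intro rayleigh_le_rho[OF S_carrier S_sym p_pos]) auto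
next
  case False
  then obtain l where i: "i = Suc (2 * l)" by (auto elim: oddE)
  define y where "y = Spow l x"
  have y: "y \<in> carrier_vec p" using x by (simp add: y_def)
  let ?z = "S *\<^sub>v y"
  have "?z \<bullet> ?z \<le> rho S * (y \<bullet> ?z)"
  proof (cases "?z \<bullet> ?z = 0")
    case True
    then show ?thesis using S_psd[OF y] rho_nonneg by simp
  next
    case False
    then have pos: "0 < ?z \<bullet> ?z" using scalar_prod_self_nonneg[of ?z] by simp
    have "(?z \<bullet> ?z)\<^sup>2 = (y \<bullet> (S *\<^sub>v ?z))\<^sup>2"
      using y by (simp add: scalar_prod_sym_mat[OF S_carrier S_sym])
    also have "\<dots> \<le> (y \<bullet> ?z) * (?z \<bullet> (S *\<^sub>v ?z))"
      using y by (intro psd_Cauchy_Schwarz[OF S_carrier S_sym S_psd]) auto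
    also have "\<dots> \<le> (y \<bullet> ?z) * (rho S * (?z \<bullet> ?z))"
      using y by (intro mult_left_mono rayleigh_le_rho[OF S_carrier S_sym p_pos] S_psd) auto
    finally show ?thesis using pos by (simp add: power2_eq_square mult_ac)
  qed
  then show ?thesis unfolding i moment_split[OF x] y_def .
qed

lemma moment_add_le:
  assumes x: "x \<in> carrier_vec p"
  shows "x \<bullet> Spow (i + j) x \<le> rho S ^ i * (x \<bullet> Spow j x)"
proof (induction i)
  case (Suc i)
  have "x \<bullet> Spow (Suc i + j) x \<le> rho S * (x \<bullet> Spow (i + j) x)"
    using moment_Suc_le[OF x, of "i + j"] by (simp only: add_Suc)
  also have "\<dots> \<le> rho S * (rho S ^ i * (x \<bullet> Spow j x))"
    using Suc rho_nonneg by (intro mult_left_mono) auto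
  finally show ?case by (simp add: mult.assoc)
qed simp

section \<open>Traces and spectral radii of the powers of \<open>S\<close>\<close>

lemma trace_Spow: "mat_trace (S ^\<^sub>m i) = (\<Sum>a<p. unit_vec p a \<bullet> Spow i (unit_vec p a))"
  unfolding mat_trace_def using S_carrier
  by (intro sum.cong) (auto simp: mat_entry_scalar_prod[of _ p])

lemma trace_add_le: "mat_trace (S ^\<^sub>m (i + j)) \<le> rho S ^ i * mat_trace (S ^\<^sub>m j)"
  unfolding trace_Spow sum_distrib_left by (intro sum_mono moment_add_le) auto

lemma Spow_entry_sym: "a < p \<Longrightarrow> b < p \<Longrightarrow> (S ^\<^sub>m i) $$ (a, b) = (S ^\<^sub>m i) $$ (b, a)"
proof -
  assume ab: "a < p" "b < p"
  have "(S ^\<^sub>m i) $$ (a, b) = unit_vec p a \<bullet> Spow i (unit_vec p b)"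
    using ab by (subst mat_entry_scalar_prod[of _ p]) auto
  also have "\<dots> = Spow i (unit_vec p a) \<bullet> unit_vec p b"
    using ab by (subst Spow_scalar_prod) auto
  also have "\<dots> = unit_vec p b \<bullet> Spow i (unit_vec p a)"
    by (rule comm_scalar_prod[of _ p]) auto
  also have "\<dots> = (S ^\<^sub>m i) $$ (b, a)"
    using ab by (subst mat_entry_scalar_prod[of _ p]) auto
  finally show ?thesis .
qed

lemma rho_eigenvector:
  obtains v where "v \<in> carrier_vec p" "v \<noteq> 0\<^sub>v p" "\<And>i. Spow i v = rho S ^ i \<cdot>\<^sub>v v"
proof -
  have "rho S \<in> spectrum S" by (rule rho_in_spectrum[OF S_carrier S_sym p_pos])
  then obtain v where v: "eigenvector S v (rho S)" unfolding spectrum_def eigenvalue_def by auto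
  then have "v \<in> carrier_vec p" "v \<noteq> 0\<^sub>v p" unfolding eigenvector_def using S_carrier by auto
  then show ?thesis using that eigenvector_pow[OF S_carrier v] by blast
qed

text \<open>Later makes all traces positive and the effective rank, the trace of \<open>S\<close>
  over \<open>rho S\<close>, at least 1.\<close>

lemma rho_power_le_trace: "rho S ^ i \<le> mat_trace (S ^\<^sub>m i)"
proof -
  obtain v where v: "v \<in> carrier_vec p" "v \<noteq> 0\<^sub>v p" "Spow i v = rho S ^ i \<cdot>\<^sub>v v"
    using rho_eigenvector by metis
  have C: "S ^\<^sub>m i \<in> carrier_mat p p" by simp
  have "rho S ^ i * (v \<bullet> v) = v \<bullet> Spow i v" using v by simp
  also have "\<dots> = (\<Sum>a<p. \<Sum>b<p. v $ a * (S ^\<^sub>m i) $$ (a, b) * v $ b)"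
    using v by (intro quadratic_form_sum) auto
  also have "\<dots> \<le> (\<Sum>a<p. (S ^\<^sub>m i) $$ (a, a)) * (\<Sum>a<p. (v $ a)\<^sup>2)"
    by (rule psd_quadratic_form_le_trace)
      (auto simp: Spow_entry_sym quadratic_form_sum_vec[OF C] intro: moment_nonneg)
  also have "\<dots> = mat_trace (S ^\<^sub>m i) * (v \<bullet> v)"
    using v(1) S_carrier by (simp add: mat_trace_def scalar_prod_def power2_eq_square atLeast0LessThan)
  finally show ?thesis using scalar_prod_self_pos[OF v(1,2)] by simp
qed

text \<open>The penalties contain powers of \<open>rho S\<close>, the final bound the spectral radii
  of powers of \<open>S\<close>; this passes from the former to the latter.\<close>

lemma rho_power_le_rho: "rho S ^ i \<le> rho (S ^\<^sub>m i)"
proof -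
  obtain v where v: "v \<in> carrier_vec p" "v \<noteq> 0\<^sub>v p" "Spow i v = rho S ^ i \<cdot>\<^sub>v v"
    using rho_eigenvector by metis
  then have "rho S ^ i \<in> spectrum (S ^\<^sub>m i)"
    using S_carrier unfolding spectrum_def eigenvalue_def eigenvector_def by auto
  then show ?thesis
    unfolding rho_def[of "S ^\<^sub>m i"] using card_finite_spectrum(1)[of "S ^\<^sub>m i" p] by auto
qed

section \<open>Krylov matrices and their Gram matrix\<close>

lemma krylov_mult_vec:
  assumes "s \<in> carrier_vec p" "z \<in> carrier_vec K" "a < p"
  shows "(krylov K S s *\<^sub>v z) $ a = (\<Sum>j<K. z $ j * Spow j s $ a)"
  using assms unfolding krylov_def
  by (simp add: scalar_prod_def mat_of_cols_index atLeast0LessThan mult.commute)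

lemma krylov_col:
  assumes s: "s \<in> carrier_vec p" and j: "j < K"
  shows "col (krylov K S s) j = Spow j s"
proof -
  have "map (\<lambda>j. Spow j s) [0..<K] ! j = Spow j s" using j by simp
  then show ?thesis
    unfolding krylov_def carrier_vecD[OF s] using s j by (subst col_mat_of_cols) simp_all
qed

lemma krylov_transpose_mult_vec:
  "s \<in> carrier_vec p \<Longrightarrow> i < K \<Longrightarrow> ((krylov K S s)\<^sup>T *\<^sub>v v) $ i = Spow i s \<bullet> v"
  using krylov_carrier[of s p K S] by (simp add: krylov_col)

lemma Theta_carrier [simp]: "s \<in> carrier_vec p \<Longrightarrow> Theta K S s \<in> carrier_mat K K"
  unfolding Theta_def
  by (intro mult_carrier_mat[of _ K p] mult_carrier_mat[of _ K p _ p]) auto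

lemma Theta_index:
  assumes s: "s \<in> carrier_vec p" and ij: "i < K" "j < K"
  shows "Theta K S s $$ (i, j) = Spow i s \<bullet> (S *\<^sub>v Spow j s)"
proof -
  have G: "krylov K S s \<in> carrier_mat p K" using s by simp
  have "Theta K S s = (krylov K S s)\<^sup>T * (S * krylov K S s)"
    unfolding Theta_def by (rule assoc_mult_mat[of _ K p _ p _ K]) (use G in auto)
  then have "Theta K S s $$ (i, j) = row ((krylov K S s)\<^sup>T) i \<bullet> col (S * krylov K S s) j"
    using G ij S_carrier by simp
  also have "row ((krylov K S s)\<^sup>T) i = Spow i s" using G ij s by (simp add: krylov_col)
  also have "col (S * krylov K S s) j = S *\<^sub>v Spow j s"
    using G ij s by (subst col_mult2[of _ p p _ K]) (auto simp: krylov_col)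
  finally show ?thesis .
qed

text \<open>The Hankel structure: an entry depends on \<open>i + j\<close> alone. Indices start at
  0, whence the exponent \<open>i + j + 1\<close>.\<close>

lemma Theta_index_moment:
  assumes s: "s \<in> carrier_vec p" and ij: "i < K" "j < K"
  shows "Theta K S s $$ (i, j) = s \<bullet> Spow (Suc (i + j)) s"
  using assms by (simp add: Theta_index S_Spow Spow_scalar_prod_Spow)

text \<open>The fitted values are scaled so that the seminorm of \<open>S\<close> becomes a Euclidean norm.\<close>

definition fit :: "real vec \<Rightarrow> nat \<Rightarrow> real" where "fit x k = (X *\<^sub>v x) $ k / sqrt (real n)"

lemma sum_fit_fit:
  assumes "x \<in> carrier_vec p" "y \<in> carrier_vec p"
  shows "(\<Sum>k<n. fit x k * fit y k) = x \<bullet> (S *\<^sub>v y)"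
proof -
  have "(\<Sum>k<n. fit x k * fit y k) = (\<Sum>k<n. (X *\<^sub>v x) $ k * (X *\<^sub>v y) $ k) / real n"
    using n_pos by (simp add: fit_def sum_divide_distrib)
  also have "\<dots> = (1 / real n) * ((X *\<^sub>v x) \<bullet> (X *\<^sub>v y))"
    using X_carrier by (simp add: scalar_prod_def atLeast0LessThan)
  finally show ?thesis using assms by (simp add: scalar_prod_S)
qed

lemma fit_lincomb:
  assumes "\<And>j. j < K \<Longrightarrow> v j \<in> carrier_vec p" and x: "x \<in> carrier_vec p"
    and "\<And>a. a < p \<Longrightarrow> x $ a = (\<Sum>j<K. z j * v j $ a)" and k: "k < n"
  shows "fit x k = (\<Sum>j<K. z j * fit (v j) k)"
proof -
  have "(X *\<^sub>v x) $ k = (\<Sum>a<p. X $$ (k, a) * (\<Sum>j<K. z j * v j $ a))"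
    using assms X_carrier by (simp add: scalar_prod_def atLeast0LessThan)
  also have "\<dots> = (\<Sum>j<K. z j * (\<Sum>a<p. X $$ (k, a) * v j $ a))"
    unfolding sum_distrib_left by (subst sum.swap) (simp add: mult_ac)
  also have "\<dots> = (\<Sum>j<K. z j * (X *\<^sub>v v j) $ k)"
  proof (intro sum.cong refl)
    fix j assume "j \<in> {..<K}"
    then have "v j \<in> carrier_vec p" using assms(1) by simp
    then show "z j * (\<Sum>a<p. X $$ (k, a) * v j $ a) = z j * (X *\<^sub>v v j) $ k"
      using k X_carrier by (simp add: scalar_prod_def atLeast0LessThan)
  qed
  finally show ?thesis by (simp only: fit_def sum_divide_distrib times_divide_eq_right)
qed

lemma fit_krylov:
  assumes "s \<in> carrier_vec p" "z \<in> carrier_vec K" "k < n"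
  shows "fit (krylov K S s *\<^sub>v z) k = (\<Sum>j<K. z $ j * fit (Spow j s) k)"
proof -
  have 1: "Spow j s \<in> carrier_vec p" if "j < K" for j using assms(1) by simp
  have 2: "krylov K S s *\<^sub>v z \<in> carrier_vec p"
    by (rule mult_mat_vec_carrier[OF krylov_carrier[OF assms(1)] assms(2)])
  have 3: "(krylov K S s *\<^sub>v z) $ a = (\<Sum>j<K. z $ j * Spow j s $ a)" if "a < p" for a
    by (rule krylov_mult_vec[OF assms(1,2) that])
  show ?thesis by (rule fit_lincomb[OF 1 2 3 assms(3)])
qed

lemma fit_add:
  assumes "x \<in> carrier_vec p" "y \<in> carrier_vec p" "k < n"
  shows "fit (x + y) k = fit x k + fit y k"
  using assms by (simp add: fit_def mult_add_distrib_mat_vec[of _ n p] add_divide_distrib)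

lemma fit_diff:
  assumes "x \<in> carrier_vec p" "y \<in> carrier_vec p" "k < n"
  shows "fit (x - y) k = fit x k - fit y k"
  using assms by (simp add: fit_def mult_minus_distrib_mat_vec[of _ n p] diff_divide_distrib)

lemma norm_X_eq_fit:
  assumes "x \<in> carrier_vec p"
  shows "(vec_norm (X *\<^sub>v x))\<^sup>2 = real n * (\<Sum>k<n. (fit x k)\<^sup>2)"
  using sum_fit_fit[OF assms assms] scalar_prod_S[OF assms assms] n_pos
  by (simp add: vec_norm_def power2_eq_square[of "fit _ _"] scalar_prod_self_nonneg)

section \<open>The error of \<open>sigma_hat\<close>, with covariance
  \<open>\<tau>\<^sup>2 S / n\<close>, and its quadratic forms\<close>

definition noise :: "(nat \<Rightarrow> real) \<Rightarrow> real vec" where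
  "noise \<epsilon> = (1 / real n) \<cdot>\<^sub>v (X\<^sup>T *\<^sub>v Matrix.vec n \<epsilon>)"

lemma noise_carrier [simp]: "noise \<epsilon> \<in> carrier_vec p"
  unfolding noise_def smult_carrier_vec by (rule mult_mat_vec_carrier[of _ p n]) auto

lemma dim_noise [simp]: "dim_vec (noise \<epsilon>) = p"
  by (rule carrier_vecD[OF noise_carrier])

lemma noise_index:
  assumes "a < p" shows "noise \<epsilon> $ a = (\<Sum>k<n. X $$ (k, a) * \<epsilon> k) / real n"
  using assms by (simp add: noise_def scalar_prod_def atLeast0LessThan)

lemma sigma_hat_response:
  assumes "\<beta> \<in> carrier_vec p"
  shows "sigma_hat X (response X \<beta> \<epsilon>) = sigma X \<beta> + noise \<epsilon>"
proof -
  have "X\<^sup>T *\<^sub>v (X *\<^sub>v \<beta> + Matrix.vec n \<epsilon>) = X\<^sup>T *\<^sub>v (X *\<^sub>v \<beta>) + X\<^sup>T *\<^sub>v Matrix.vec n \<epsilon>"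
    using assms by (intro mult_add_distrib_mat_vec[of _ p n]) auto
  then show ?thesis
    unfolding sigma_hat_def response_def sigma_def design_dims noise_def S_mult_vec[OF assms]
    using assms by (subst smult_add_distrib_vec[of _ p, symmetric]) (auto intro: mult_mat_vec_carrier[of _ p n])
qed

lemma S_index:
  assumes "a < p" "b < p" shows "S $$ (a, b) = (\<Sum>k<n. X $$ (k, a) * X $$ (k, b)) / real n"
proof -
  have "S $$ (a, b) = unit_vec p a \<bullet> (S *\<^sub>v unit_vec p b)"
    using assms by (subst mat_entry_scalar_prod[of _ p]) auto
  also have "\<dots> = (1 / real n) * ((X *\<^sub>v unit_vec p a) \<bullet> (X *\<^sub>v unit_vec p b))"
    by (intro scalar_prod_S) auto
  also have "(X *\<^sub>v unit_vec p a) \<bullet> (X *\<^sub>v unit_vec p b) = (\<Sum>k<n. X $$ (k, a) * X $$ (k, b))"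
    unfolding scalar_prod_def[of "X *\<^sub>v unit_vec p a"] using assms
    by (intro sum.cong) (auto simp: scalar_prod_right_unit[of _ p])
  finally show ?thesis by simp
qed

lemma
  assumes \<tau>: "0 < \<tau>" and a: "a < p" and b: "b < p"
  shows integrable_noise_prod: "integrable (gauss_noise n \<tau>) (\<lambda>\<epsilon>. noise \<epsilon> $ a * noise \<epsilon> $ b)"
    and integral_noise_prod:
      "(\<integral>\<epsilon>. noise \<epsilon> $ a * noise \<epsilon> $ b \<partial>gauss_noise n \<tau>) = \<tau>\<^sup>2 / real n * S $$ (a, b)"
proof -
  have eq: "noise \<epsilon> $ a * noise \<epsilon> $ b
      = (\<Sum>k<n. \<Sum>l<n. (X $$ (k, a) * X $$ (l, b) / (real n)\<^sup>2) * (\<epsilon> k * \<epsilon> l))" for \<epsilon>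
    unfolding noise_index[OF a] noise_index[OF b] times_divide_times_eq sum_product sum_divide_distrib
    by (intro sum.cong refl) (simp add: power2_eq_square)
  show "integrable (gauss_noise n \<tau>) (\<lambda>\<epsilon>. noise \<epsilon> $ a * noise \<epsilon> $ b)"
    unfolding eq by (intro Bochner_Integration.integrable_sum integrable_mult_right integrable_gauss_noise_prod[OF \<tau>]) auto
  have int: "integrable (gauss_noise n \<tau>) (\<lambda>\<epsilon>. (X $$ (k, a) * X $$ (l, b) / (real n)\<^sup>2) * (\<epsilon> k * \<epsilon> l))"
    if "k < n" "l < n" for k l
    using that by (intro integrable_mult_right integrable_gauss_noise_prod[OF \<tau>])
  have "(\<integral>\<epsilon>. noise \<epsilon> $ a * noise \<epsilon> $ b \<partial>gauss_noise n \<tau>)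
      = (\<Sum>k<n. \<integral>\<epsilon>. (\<Sum>l<n. (X $$ (k, a) * X $$ (l, b) / (real n)\<^sup>2) * (\<epsilon> k * \<epsilon> l)) \<partial>gauss_noise n \<tau>)"
    unfolding eq by (intro Bochner_Integration.integral_sum Bochner_Integration.integrable_sum int) auto
  also have "\<dots> = (\<Sum>k<n. \<Sum>l<n. \<integral>\<epsilon>. (X $$ (k, a) * X $$ (l, b) / (real n)\<^sup>2) * (\<epsilon> k * \<epsilon> l) \<partial>gauss_noise n \<tau>)"
    by (intro sum.cong refl Bochner_Integration.integral_sum int) auto
  also have "\<dots> = (\<Sum>k<n. \<Sum>l<n. (X $$ (k, a) * X $$ (l, b) / (real n)\<^sup>2) * (if k = l then \<tau>\<^sup>2 else 0))"
    by (intro sum.cong refl) (simp add: integral_gauss_noise_prod[OF \<tau>])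
  also have "\<dots> = (\<Sum>k<n. (X $$ (k, a) * X $$ (k, b) / (real n)\<^sup>2) * \<tau>\<^sup>2)"
    by (intro sum.cong refl) (simp add: if_distrib[of "(*) _"] cong: if_cong)
  also have "\<dots> = \<tau>\<^sup>2 / real n * S $$ (a, b)"
    unfolding S_index[OF a b]
    by (simp add: sum_distrib_left sum_divide_distrib power2_eq_square mult_ac)
  finally show "(\<integral>\<epsilon>. noise \<epsilon> $ a * noise \<epsilon> $ b \<partial>gauss_noise n \<tau>) = \<tau>\<^sup>2 / real n * S $$ (a, b)" .
qed

text \<open>Covers both kinds of noise term: \<open>A = S ^\<^sub>m i\<close> yields the moments of
  the noise, \<open>A = v v^T\<close> the squares of linear forms.\<close>

lemma
  fixes A :: "real mat"
  assumes \<tau>: "0 < \<tau>" and A: "A \<in> carrier_mat p p"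
  shows integrable_noise_form: "integrable (gauss_noise n \<tau>) (\<lambda>\<epsilon>. noise \<epsilon> \<bullet> (A *\<^sub>v noise \<epsilon>))"
    and integral_noise_form: "(\<integral>\<epsilon>. noise \<epsilon> \<bullet> (A *\<^sub>v noise \<epsilon>) \<partial>gauss_noise n \<tau>)
      = \<tau>\<^sup>2 / real n * (\<Sum>a<p. \<Sum>b<p. A $$ (a, b) * S $$ (a, b))"
proof -
  have eq: "noise \<epsilon> \<bullet> (A *\<^sub>v noise \<epsilon>)
      = (\<Sum>a<p. \<Sum>b<p. A $$ (a, b) * (noise \<epsilon> $ a * noise \<epsilon> $ b))" for \<epsilon>
    unfolding quadratic_form_sum[OF A noise_carrier noise_carrier] by (simp add: mult_ac)
  have int: "integrable (gauss_noise n \<tau>) (\<lambda>\<epsilon>. A $$ (a, b) * (noise \<epsilon> $ a * noise \<epsilon> $ b))"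
    if "a < p" "b < p" for a b
    using that by (intro integrable_mult_right integrable_noise_prod[OF \<tau>])
  show "integrable (gauss_noise n \<tau>) (\<lambda>\<epsilon>. noise \<epsilon> \<bullet> (A *\<^sub>v noise \<epsilon>))"
    unfolding eq by (intro Bochner_Integration.integrable_sum int) auto
  have "(\<integral>\<epsilon>. noise \<epsilon> \<bullet> (A *\<^sub>v noise \<epsilon>) \<partial>gauss_noise n \<tau>)
      = (\<Sum>a<p. \<integral>\<epsilon>. (\<Sum>b<p. A $$ (a, b) * (noise \<epsilon> $ a * noise \<epsilon> $ b)) \<partial>gauss_noise n \<tau>)"
    unfolding eq by (rule Bochner_Integration.integral_sum) (auto intro!: Bochner_Integration.integrable_sum int)
  also have "\<dots> = (\<Sum>a<p. \<Sum>b<p. \<integral>\<epsilon>. A $$ (a, b) * (noise \<epsilon> $ a * noise \<epsilon> $ b) \<partial>gauss_noise n \<tau>)"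
    by (intro sum.cong refl Bochner_Integration.integral_sum int) auto
  also have "\<dots> = (\<Sum>a<p. \<Sum>b<p. A $$ (a, b) * (\<tau>\<^sup>2 / real n * S $$ (a, b)))"
    by (intro sum.cong refl) (simp add: integral_noise_prod[OF \<tau>])
  also have "\<dots> = \<tau>\<^sup>2 / real n * (\<Sum>a<p. \<Sum>b<p. A $$ (a, b) * S $$ (a, b))"
    by (simp add: sum_distrib_left mult_ac)
  finally show "(\<integral>\<epsilon>. noise \<epsilon> \<bullet> (A *\<^sub>v noise \<epsilon>) \<partial>gauss_noise n \<tau>)
      = \<tau>\<^sup>2 / real n * (\<Sum>a<p. \<Sum>b<p. A $$ (a, b) * S $$ (a, b))" .
qed

lemma
  assumes \<tau>: "0 < \<tau>"
  shows integrable_noise_moment: "integrable (gauss_noise n \<tau>) (\<lambda>\<epsilon>. noise \<epsilon> \<bullet> Spow i (noise \<epsilon>))"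
    and integral_noise_moment: "(\<integral>\<epsilon>. noise \<epsilon> \<bullet> Spow i (noise \<epsilon>) \<partial>gauss_noise n \<tau>)
      = \<tau>\<^sup>2 / real n * mat_trace (S ^\<^sub>m Suc i)"
proof -
  have C: "S ^\<^sub>m i \<in> carrier_mat p p" by simp
  show "integrable (gauss_noise n \<tau>) (\<lambda>\<epsilon>. noise \<epsilon> \<bullet> Spow i (noise \<epsilon>))"
    by (rule integrable_noise_form[OF \<tau> C])
  have "(\<Sum>a<p. \<Sum>b<p. (S ^\<^sub>m i) $$ (a, b) * S $$ (a, b)) = mat_trace (S ^\<^sub>m Suc i)"
  proof -
    have "(S ^\<^sub>m Suc i) $$ (a, a) = (\<Sum>b<p. (S ^\<^sub>m i) $$ (a, b) * S $$ (a, b))" if a: "a < p" for a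
    proof -
      have "(S ^\<^sub>m Suc i) $$ (a, a) = row (S ^\<^sub>m i) a \<bullet> col S a"
        using a C by (simp add: pow_mat.simps)
      also have "\<dots> = (\<Sum>b<p. (S ^\<^sub>m i) $$ (a, b) * S $$ (b, a))"
        using a C by (simp add: scalar_prod_def atLeast0LessThan)
      also have "\<dots> = (\<Sum>b<p. (S ^\<^sub>m i) $$ (a, b) * S $$ (a, b))"
        using a by (intro sum.cong refl) (auto simp: S_index mult.commute)
      finally show ?thesis .
    qed
    then show ?thesis by (simp add: mat_trace_def)
  qed
  then show "(\<integral>\<epsilon>. noise \<epsilon> \<bullet> Spow i (noise \<epsilon>) \<partial>gauss_noise n \<tau>)
      = \<tau>\<^sup>2 / real n * mat_trace (S ^\<^sub>m Suc i)"
    using integral_noise_form[OF \<tau> C] by simp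
qed

lemma
  assumes \<tau>: "0 < \<tau>" and v: "v \<in> carrier_vec p"
  shows integrable_noise_linear: "integrable (gauss_noise n \<tau>) (\<lambda>\<epsilon>. (v \<bullet> noise \<epsilon>)\<^sup>2)"
    and integral_noise_linear: "(\<integral>\<epsilon>. (v \<bullet> noise \<epsilon>)\<^sup>2 \<partial>gauss_noise n \<tau>)
      = \<tau>\<^sup>2 / real n * (v \<bullet> (S *\<^sub>v v))"
proof -
  define A where "A = Matrix.mat p p (\<lambda>(a, b). v $ a * v $ b)"
  have A: "A \<in> carrier_mat p p" by (simp add: A_def)
  have eq: "(v \<bullet> noise \<epsilon>)\<^sup>2 = noise \<epsilon> \<bullet> (A *\<^sub>v noise \<epsilon>)" for \<epsilon>
  proof -
    have "(v \<bullet> noise \<epsilon>)\<^sup>2 = (\<Sum>a<p. \<Sum>b<p. v $ a * noise \<epsilon> $ a * (v $ b * noise \<epsilon> $ b))"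
      by (simp add: scalar_prod_def power2_eq_square sum_product atLeast0LessThan)
    also have "\<dots> = noise \<epsilon> \<bullet> (A *\<^sub>v noise \<epsilon>)"
      unfolding quadratic_form_sum[OF A noise_carrier noise_carrier]
      by (intro sum.cong refl) (auto simp: A_def)
    finally show ?thesis .
  qed
  show "integrable (gauss_noise n \<tau>) (\<lambda>\<epsilon>. (v \<bullet> noise \<epsilon>)\<^sup>2)"
    unfolding eq by (rule integrable_noise_form[OF \<tau> A])
  have "(\<Sum>a<p. \<Sum>b<p. A $$ (a, b) * S $$ (a, b)) = v \<bullet> (S *\<^sub>v v)"
    unfolding quadratic_form_sum[OF S_carrier v v]
    by (intro sum.cong refl) (auto simp: A_def)
  then show "(\<integral>\<epsilon>. (v \<bullet> noise \<epsilon>)\<^sup>2 \<partial>gauss_noise n \<tau>) = \<tau>\<^sup>2 / real n * (v \<bullet> (S *\<^sub>v v))"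
    unfolding eq integral_noise_form[OF \<tau> A] by simp
qed

lemma measurable_noise [measurable]:
  "a < p \<Longrightarrow> (\<lambda>\<epsilon>. noise \<epsilon> $ a) \<in> borel_measurable (gauss_noise n \<tau>)"
  unfolding noise_index by measurable

end

lemma measurable_scalar_prod:
  fixes x y :: "'a \<Rightarrow> real vec"
  assumes "\<And>w. y w \<in> carrier_vec m"
    and "\<And>i. i < m \<Longrightarrow> (\<lambda>w. x w $ i) \<in> borel_measurable M"
    and "\<And>i. i < m \<Longrightarrow> (\<lambda>w. y w $ i) \<in> borel_measurable M"
  shows "(\<lambda>w. x w \<bullet> y w) \<in> borel_measurable M"
  using assms unfolding scalar_prod_def carrier_vecD[OF assms(1)]
  by (intro borel_measurable_sum borel_measurable_times) auto

lemma measurable_mult_mat_vec: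
  fixes A :: "'a \<Rightarrow> real mat" and x :: "'a \<Rightarrow> real vec"
  assumes A: "\<And>w. A w \<in> carrier_mat m k" and x: "\<And>w. x w \<in> carrier_vec k"
    and mA: "\<And>i j. i < m \<Longrightarrow> j < k \<Longrightarrow> (\<lambda>w. A w $$ (i, j)) \<in> borel_measurable M"
    and mx: "\<And>i. i < k \<Longrightarrow> (\<lambda>w. x w $ i) \<in> borel_measurable M"
    and i: "i < m"
  shows "(\<lambda>w. (A w *\<^sub>v x w) $ i) \<in> borel_measurable M"
proof -
  have "(A w *\<^sub>v x w) $ i = (\<Sum>j<k. A w $$ (i, j) * x w $ j)" for w
    using A[of w] x[of w] i by (simp add: scalar_prod_def atLeast0LessThan)
  moreover have "(\<lambda>w. \<Sum>j<k. A w $$ (i, j) * x w $ j) \<in> borel_measurable M"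
    using i by (intro borel_measurable_sum borel_measurable_times mA mx) auto
  ultimately show ?thesis by simp
qed

section \<open>The population problem\<close>

lemma gram_quadratic_form:
  fixes v :: "nat \<Rightarrow> nat \<Rightarrow> real"
  shows "(\<Sum>i<K. \<Sum>j<K. x i * (\<Sum>k<m. v i k * v j k) * x j) = (\<Sum>k<m. (\<Sum>i<K. x i * v i k)\<^sup>2)"
proof -
  have "(\<Sum>i<K. \<Sum>j<K. x i * (\<Sum>k<m. v i k * v j k) * x j)
      = (\<Sum>i<K. \<Sum>j<K. \<Sum>k<m. x i * v i k * (x j * v j k))"
    by (intro sum.cong refl) (simp add: sum_distrib_left sum_distrib_right mult_ac)
  also have "\<dots> = (\<Sum>i<K. \<Sum>k<m. \<Sum>j<K. x i * v i k * (x j * v j k))"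
    by (intro sum.cong refl sum.swap)
  also have "\<dots> = (\<Sum>k<m. \<Sum>i<K. \<Sum>j<K. x i * v i k * (x j * v j k))"
    by (rule sum.swap)
  finally show ?thesis by (simp add: power2_eq_square sum_product)
qed

lemma spectrum_mat_diag: "spectrum (mat_diag K f) = f ` {..<K}" for f :: "nat \<Rightarrow> real"
proof -
  have C: "mat_diag K f \<in> carrier_mat K K" by simp
  have mult: "(mat_diag K f *\<^sub>v v) $ i = f i * v $ i" if "v \<in> carrier_vec K" "i < K" for v i
  proof -
    have "(mat_diag K f *\<^sub>v v) $ i = (\<Sum>j<K. (if i = j then f j else 0) * v $ j)"
      using that by (simp add: mat_diag_def scalar_prod_def atLeast0LessThan)
    also have "\<dots> = (\<Sum>j<K. if j = i then f i * v $ i else 0)"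
      by (intro sum.cong) auto
    finally show ?thesis using that by simp
  qed
  show ?thesis
  proof (intro equalityI subsetI)
    fix e assume "e \<in> spectrum (mat_diag K f)"
    then obtain v where v: "v \<in> carrier_vec K" "v \<noteq> 0\<^sub>v K" "mat_diag K f *\<^sub>v v = e \<cdot>\<^sub>v v"
      unfolding spectrum_def eigenvalue_def eigenvector_def using C by auto
    then obtain i where i: "i < K" "v $ i \<noteq> 0" by (auto simp: vec_eq_iff)
    then have "f i * v $ i = e * v $ i" using mult[OF v(1) i(1)] v by simp
    then show "e \<in> f ` {..<K}" using i by auto
  next
    fix e assume "e \<in> f ` {..<K}"
    then obtain i where i: "i < K" "e = f i" by auto
    have "mat_diag K f *\<^sub>v unit_vec K i = e \<cdot>\<^sub>v unit_vec K i"
    proof (rule eq_vecI)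
      fix j assume "j < dim_vec (e \<cdot>\<^sub>v unit_vec K i)"
      then have j: "j < K" by simp
      show "(mat_diag K f *\<^sub>v unit_vec K i) $ j = (e \<cdot>\<^sub>v unit_vec K i) $ j"
        unfolding mult[OF unit_vec_carrier j] using i j by simp
    qed (simp add: mat_diag_def)
    moreover have "unit_vec K i \<noteq> (0\<^sub>v K :: real vec)" using i(1) by (rule unit_vec_nonzero)
    ultimately show "e \<in> spectrum (mat_diag K f)"
      unfolding spectrum_def eigenvalue_def eigenvector_def carrier_matD(1)[OF C] mem_Collect_eq
      by (intro exI[of _ "unit_vec K i"]) simp
  qed
qed

lemma le_cond_number_diag:
  fixes f :: "nat \<Rightarrow> real"
  assumes pos: "\<And>i. i < K \<Longrightarrow> 0 < f i" and ij: "i < K" "j < K"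
  shows "f i \<le> cond_number (mat_diag K f) * f j"
proof -
  have rho: "f i \<le> rho (mat_diag K f)"
    unfolding rho_def spectrum_mat_diag using ij by (intro Max_ge) auto
  have "rho_min (mat_diag K f) \<in> f ` {..<K}"
    unfolding rho_min_def spectrum_mat_diag using ij by (intro Min_in) auto
  then have min_pos: "0 < rho_min (mat_diag K f)" using pos by auto
  have min: "rho_min (mat_diag K f) \<le> f j"
    unfolding rho_min_def spectrum_mat_diag using ij by (intro Min_le) auto
  have rho_pos: "0 \<le> rho (mat_diag K f)" using rho pos[OF ij(1)] by simp
  have "f i \<le> cond_number (mat_diag K f) * rho_min (mat_diag K f)"
    using rho min_pos by (simp add: cond_number_def)
  also have "\<dots> \<le> cond_number (mat_diag K f) * f j"
    using min min_pos rho_pos by (intro mult_left_mono) (auto simp: cond_number_def)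
  finally show ?thesis .
qed

locale pls = design +
  fixes \<beta> :: "real vec" and K :: nat
  assumes \<beta>_carrier [simp]: "\<beta> \<in> carrier_vec p" and K_pos: "1 \<le> K"
    and diag_pos: "\<And>i. i < K \<Longrightarrow> 0 < diag_part (Theta K (Sig X) (sigma X \<beta>)) $$ (i, i)"
    and rho_min_pos: "0 < rho_min (normalized (Theta K (Sig X) (sigma X \<beta>)))"
begin

abbreviation "\<sigma> \<equiv> sigma X \<beta>"
abbreviation "G \<equiv> krylov K S \<sigma>"
abbreviation "\<Theta> \<equiv> Theta K S \<sigma>"
abbreviation "R \<equiv> normalized \<Theta>"
abbreviation "D i \<equiv> \<Theta> $$ (i, i)"
abbreviation "\<Lambda> \<equiv> Lambda K S \<sigma>"
abbreviation "\<phi> i \<equiv> fit (Spow i \<sigma>)"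
abbreviation "T i \<equiv> mat_trace (S ^\<^sub>m Suc i)"
abbreviation "\<rho> \<equiv> rho S"

lemma \<sigma>_carrier [simp]: "\<sigma> \<in> carrier_vec p" by (simp add: sigma_def)

lemma \<Theta>_carrier: "\<Theta> \<in> carrier_mat K K" by (rule Theta_carrier) simp

lemma \<Theta>_dims [simp]: "dim_row \<Theta> = K" "dim_col \<Theta> = K"
  by (fact carrier_matD[OF \<Theta>_carrier])+

lemma \<Theta>_index: "i < K \<Longrightarrow> j < K \<Longrightarrow> \<Theta> $$ (i, j) = (\<Sum>k<n. \<phi> i k * \<phi> j k)"
  by (simp only: Theta_index[OF \<sigma>_carrier] sum_fit_fit[OF Spow_carrier[OF \<sigma>_carrier] Spow_carrier[OF \<sigma>_carrier]])

lemma \<Theta>_sym: "i < K \<Longrightarrow> j < K \<Longrightarrow> \<Theta> $$ (i, j) = \<Theta> $$ (j, i)"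
  by (simp add: \<Theta>_index mult.commute)

lemma \<Theta>_form: "(\<Sum>i<K. \<Sum>j<K. u i * \<Theta> $$ (i, j) * u j) = (\<Sum>k<n. (\<Sum>i<K. u i * \<phi> i k)\<^sup>2)"
  unfolding gram_quadratic_form[symmetric] by (intro sum.cong refl) (simp add: \<Theta>_index)

lemma D_pos: "i < K \<Longrightarrow> 0 < D i"
  using diag_pos[of i] by (simp add: diag_part_def mat_diag_def)

lemma R_carrier: "R \<in> carrier_mat K K"
  unfolding normalized_def Let_def \<Theta>_dims
  by (intro mult_carrier_mat[of _ K K] mat_diag_dim \<Theta>_carrier)

lemma R_dims [simp]: "dim_row R = K" "dim_col R = K"
  by (fact carrier_matD[OF R_carrier])+

lemma R_index:
  assumes "i < K" "j < K"
  shows "R $$ (i, j) = \<Theta> $$ (i, j) / (sqrt (D i) * sqrt (D j))"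
proof -
  define E where "E = mat_diag K (\<lambda>i. 1 / sqrt (D i))"
  have E: "E * \<Theta> = Matrix.mat K K (\<lambda>(i, j). 1 / sqrt (D i) * \<Theta> $$ (i, j))"
    unfolding E_def by (rule mat_diag_mult_left[OF \<Theta>_carrier])
  have "R = E * \<Theta> * E" by (simp add: normalized_def E_def Let_def)
  also have "\<dots> = Matrix.mat K K (\<lambda>(i, j). (E * \<Theta>) $$ (i, j) * (1 / sqrt (D j)))"
    unfolding E_def by (rule mat_diag_mult_right) (simp add: E[unfolded E_def])
  finally show ?thesis using assms by (simp add: E)
qed

lemma R_sym: "R\<^sup>T = R"
  using R_carrier by (intro eq_matI) (auto simp: R_index \<Theta>_sym mult.commute)

text \<open>The substitution \<open>x i = sqrt (D i) * u i\<close> turns the form of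
  \<open>R\<close> into that of \<open>\<Theta>\<close>. This is the coercivity hypothesis of
  \<open>ridge_deterministic_bound\<close> with \<open>m = rho_min R\<close>.\<close>

lemma rho_min_R_lower:
  "rho_min R * (\<Sum>i<K. D i * (u i)\<^sup>2) \<le> (\<Sum>k<n. (\<Sum>i<K. u i * \<phi> i k)\<^sup>2)"
proof -
  define x where "x = Matrix.vec K (\<lambda>i. sqrt (D i) * u i)"
  have x: "x \<in> carrier_vec K" by (simp add: x_def)
  have "x \<bullet> x = (\<Sum>i<K. D i * (u i)\<^sup>2)"
    unfolding scalar_prod_def[of x] carrier_vecD[OF x] atLeast0LessThan
  proof (intro sum.cong refl)
    fix i assume "i \<in> {..<K}"
    then show "x $ i * x $ i = D i * (u i)\<^sup>2"
      using D_pos[of i] by (simp add: x_def power2_eq_square)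
  qed
  moreover have "x \<bullet> (R *\<^sub>v x) = (\<Sum>i<K. \<Sum>j<K. u i * \<Theta> $$ (i, j) * u j)"
    unfolding quadratic_form_sum[OF R_carrier x x]
  proof (intro sum.cong refl)
    fix i j assume "i \<in> {..<K}" "j \<in> {..<K}"
    then have "i < K" "j < K" "0 < sqrt (D i)" "0 < sqrt (D j)" using D_pos by auto
    then show "x $ i * R $$ (i, j) * x $ j = u i * \<Theta> $$ (i, j) * u j"
      by (simp add: x_def R_index)
  qed
  ultimately show ?thesis
    using rho_min_le_rayleigh[OF R_carrier R_sym _ x] K_pos by (simp add: \<Theta>_form)
qed

text \<open>The diagonal of \<open>R\<close> consists of ones, which places 1 between
  \<open>rho_min R\<close> and \<open>rho R\<close>. Hence \<open>1 / rho_min R\<close> can be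
  replaced by the condition number, which is itself at least 1.\<close>

lemma rho_R_ge: "1 \<le> rho R"
proof -
  have K0: "0 < K" using K_pos by simp
  have "R $$ (0, 0) = 1" using R_index[OF K0 K0] D_pos[OF K0] by simp
  then have "1 = unit_vec K 0 \<bullet> (R *\<^sub>v unit_vec K 0)"
    using K0 by (subst mat_entry_scalar_prod[OF R_carrier]) auto
  also have "\<dots> \<le> rho R * (unit_vec K 0 \<bullet> unit_vec K 0)"
    by (rule rayleigh_le_rho[OF R_carrier R_sym K0]) simp
  also have "unit_vec K 0 \<bullet> unit_vec K 0 = (1 :: real)" using K0 by simp
  finally show ?thesis by simp
qed

lemma inverse_rho_min_le: "1 / rho_min R \<le> cond_number R"
  unfolding cond_number_def using rho_R_ge rho_min_pos by (intro divide_right_mono) auto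

lemma rho_min_R_le_1: "rho_min R \<le> 1"
proof -
  have K0: "0 < K" using K_pos by simp
  have "rho_min R * (unit_vec K 0 \<bullet> unit_vec K 0) \<le> unit_vec K 0 \<bullet> (R *\<^sub>v unit_vec K 0)"
    by (rule rho_min_le_rayleigh[OF R_carrier R_sym K0]) simp
  also have "\<dots> = 1"
    using R_index[OF K0 K0] D_pos[OF K0] K0 by (subst mat_entry_scalar_prod[OF R_carrier]) auto
  also have "unit_vec K 0 \<bullet> unit_vec K 0 = (1 :: real)" using K0 by simp
  finally show ?thesis by simp
qed

lemma cond_R_ge: "1 \<le> cond_number R"
  using inverse_rho_min_le rho_min_R_le_1 rho_min_pos by (intro order_trans[OF _ inverse_rho_min_le]) simp

lemma cond_D: "i < K \<Longrightarrow> j < K \<Longrightarrow> D i \<le> cond_number (diag_part \<Theta>) * D j"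
  unfolding diag_part_def \<Theta>_dims by (rule le_cond_number_diag[OF D_pos])

lemma cond_D_ge: "1 \<le> cond_number (diag_part \<Theta>)"
  using cond_D[of 0 0] D_pos[of 0] K_pos by simp

text \<open>
  The entries \<open>(i, i + 2)\<close> and \<open>(i + 1, i + 1)\<close> of the Hankel matrix \<open>\<Theta>\<close> agree, so its
  normalization can only be well conditioned if the ratios of consecutive diagonal entries grow
  geometrically.
\<close>
lemma K_le_cond: "real K \<le> 2 * cond_number R * cond_number (diag_part \<Theta>)"
proof (rule dimension_le_condition_numbers[of K _ D])
  show "D (i + 1) \<le> (1 - 1 / cond_number R) * sqrt (D i * D (i + 2))" if i: "i + 2 < K" for i
  proof -
    let ?j = "i + 2"
    \<comment> \<open>The Rayleigh quotient of \<open>R\<close> at this vector is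
      \<open>1 - R $$ (i, i + 2)\<close>, so \<open>rho_min R\<close> keeps that correlation away
      from 1.\<close>
    let ?e = "unit_vec K i - unit_vec K ?j :: real vec"
    have ij: "i < K" "?j < K" using i by auto
    have Re: "R *\<^sub>v unit_vec K l \<in> carrier_vec K" for l using R_carrier by simp
    have e: "?e \<in> carrier_vec K" by simp
    have "?e \<bullet> ?e = 2"
      using ij by (simp add: minus_scalar_prod_distrib[of _ K] scalar_prod_minus_distrib[of _ K])
    moreover have "R *\<^sub>v ?e = R *\<^sub>v unit_vec K i - R *\<^sub>v unit_vec K ?j"
      using R_carrier by (intro mult_minus_distrib_mat_vec) auto
    then have "?e \<bullet> (R *\<^sub>v ?e) = R $$ (i, i) - R $$ (i, ?j) - (R $$ (?j, i) - R $$ (?j, ?j))"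
      using ij Re by (simp add: minus_scalar_prod_distrib[of _ K] scalar_prod_minus_distrib[of _ K]
          mat_entry_scalar_prod[OF R_carrier])
    ultimately have "rho_min R * 2 \<le> R $$ (i, i) - R $$ (i, ?j) - (R $$ (?j, i) - R $$ (?j, ?j))"
      using rho_min_le_rayleigh[OF R_carrier R_sym _ e] ij by simp
    also have "\<dots> = 2 - 2 * R $$ (i, ?j)"
      using ij D_pos[OF ij(1)] D_pos[OF ij(2)] \<Theta>_sym[OF ij] by (simp add: R_index mult.commute)
    finally have "R $$ (i, ?j) \<le> 1 - rho_min R" by simp
    also have "1 / cond_number R \<le> rho_min R"
      using inverse_rho_min_le rho_min_pos cond_R_ge by (simp add: field_simps)
    then have "1 - rho_min R \<le> 1 - 1 / cond_number R" by simp
    finally have "R $$ (i, ?j) \<le> 1 - 1 / cond_number R" .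
    moreover have "R $$ (i, ?j) = D (i + 1) / sqrt (D i * D ?j)"
      using ij by (simp add: R_index real_sqrt_mult Theta_index_moment)
    ultimately show ?thesis
      using D_pos[OF ij(1)] D_pos[OF ij(2)] by (simp add: pos_divide_le_eq)
  qed
qed (use K_pos cond_R_ge D_pos cond_D in auto)

section \<open>The inverse of \<open>\<Theta>\<close> and the coefficients
  \<open>\<Lambda>\<close>\<close>

lemma \<Theta>_pos_def:
  assumes "x \<in> carrier_vec K" "x \<noteq> 0\<^sub>v K"
  shows "0 < x \<bullet> (\<Theta> *\<^sub>v x)"
proof -
  obtain i where i: "i < K" "x $ i \<noteq> 0" using assms by (auto simp: vec_eq_iff)
  have "0 < (\<Sum>i<K. D i * (x $ i)\<^sup>2)"
    using i D_pos by (intro sum_pos2[of _ i]) (auto intro!: mult_nonneg_nonneg less_imp_le[OF D_pos])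
  then have "0 < rho_min R * (\<Sum>i<K. D i * (x $ i)\<^sup>2)" using rho_min_pos by simp
  also have "\<dots> \<le> (\<Sum>i<K. \<Sum>j<K. x $ i * \<Theta> $$ (i, j) * x $ j)"
    unfolding \<Theta>_form by (rule rho_min_R_lower)
  finally show ?thesis using quadratic_form_sum[OF \<Theta>_carrier assms(1,1)] by simp
qed

lemma det_\<Theta>: "det \<Theta> \<noteq> 0"
proof
  assume "det \<Theta> = 0"
  then obtain x where x: "x \<in> carrier_vec K" "x \<noteq> 0\<^sub>v K" "\<Theta> *\<^sub>v x = 0\<^sub>v K"
    using det_0_iff_vec_prod_zero[OF \<Theta>_carrier] by auto
  then show False using \<Theta>_pos_def[OF x(1,2)] by simp
qed

lemmas minv_\<Theta> = minv_mat[OF \<Theta>_carrier det_\<Theta>]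

lemma \<Lambda>_carrier [simp]: "\<Lambda> \<in> carrier_vec K"
  unfolding Lambda_def using minv_\<Theta>(1)
  by (rule mult_mat_vec_carrier) (intro mult_mat_vec_carrier[of _ K p], auto)

lemma dim_\<Lambda> [simp]: "dim_vec \<Lambda> = K" by (rule carrier_vecD[OF \<Lambda>_carrier])

lemma \<Theta>_\<Lambda>: "\<Theta> *\<^sub>v \<Lambda> = G\<^sup>T *\<^sub>v \<sigma>"
proof -
  have Gs: "G\<^sup>T *\<^sub>v \<sigma> \<in> carrier_vec K" by (intro mult_mat_vec_carrier[of _ K p]) auto
  have "\<Theta> *\<^sub>v \<Lambda> = (\<Theta> * minv \<Theta>) *\<^sub>v (G\<^sup>T *\<^sub>v \<sigma>)"
    unfolding Lambda_def by (rule assoc_mult_mat_vec[OF \<Theta>_carrier minv_\<Theta>(1) Gs, symmetric])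
  then show ?thesis using Gs by (simp add: minv_\<Theta>(2))
qed

lemma \<Lambda>_normal: "i < K \<Longrightarrow> (\<Sum>j<K. \<Theta> $$ (i, j) * \<Lambda> $ j) = Spow i \<sigma> \<bullet> \<sigma>"
proof -
  assume i: "i < K"
  have "(\<Theta> *\<^sub>v \<Lambda>) $ i = Spow i \<sigma> \<bullet> \<sigma>"
    unfolding \<Theta>_\<Lambda> using i by (intro krylov_transpose_mult_vec) auto
  moreover have "(\<Theta> *\<^sub>v \<Lambda>) $ i = (\<Sum>j<K. \<Theta> $$ (i, j) * \<Lambda> $ j)"
    using i by (simp add: scalar_prod_def atLeast0LessThan)
  ultimately show ?thesis by simp
qed

text \<open>Transfers symmetry and positivity from \<open>\<Theta>\<close> to its inverse.\<close>

lemma minv_\<Theta>_form: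
  assumes x: "x \<in> carrier_vec K" and y: "y \<in> carrier_vec K"
  shows "x \<bullet> (minv \<Theta> *\<^sub>v y) = (minv \<Theta> *\<^sub>v x) \<bullet> (\<Theta> *\<^sub>v (minv \<Theta> *\<^sub>v y))"
proof -
  have M: "minv \<Theta> *\<^sub>v x \<in> carrier_vec K" "minv \<Theta> *\<^sub>v y \<in> carrier_vec K"
    using minv_\<Theta>(1) x y by auto
  have "\<Theta>\<^sup>T = \<Theta>" by (intro eq_matI) (auto simp: \<Theta>_sym)
  then have "(minv \<Theta> *\<^sub>v x) \<bullet> (\<Theta> *\<^sub>v (minv \<Theta> *\<^sub>v y)) = (\<Theta> *\<^sub>v (minv \<Theta> *\<^sub>v x)) \<bullet> (minv \<Theta> *\<^sub>v y)"
    using scalar_prod_sym_mat[OF \<Theta>_carrier _ M] by simp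
  also have "\<Theta> *\<^sub>v (minv \<Theta> *\<^sub>v x) = x"
    using assoc_mult_mat_vec[OF \<Theta>_carrier minv_\<Theta>(1) x] x by (simp add: minv_\<Theta>(2))
  finally show ?thesis by simp
qed

lemma rho_pos: "0 < \<rho>"
proof -
  have "0 < \<sigma> \<bullet> (S *\<^sub>v \<sigma>)"
    using D_pos[of 0] K_pos Theta_index[OF \<sigma>_carrier, of 0 K 0] by simp
  also have "\<dots> \<le> \<rho> * (\<sigma> \<bullet> \<sigma>)" by (rule rayleigh_le_rho[OF S_carrier S_sym p_pos]) simp
  finally show ?thesis using scalar_prod_self_nonneg[of \<sigma>] by (simp add: zero_less_mult_iff)
qed

text \<open>
  Since \<open>\<Theta>\<close> is the Gram matrix of the Krylov vectors \<open>g\<^sub>0, g\<^sub>1, \<dots>\<close> for the form of \<open>S\<close> and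
  \<open>S g\<^sub>j = g\<^sub>j\<^sub>+\<^sub>1\<close>, the matrix \<open>\<Theta>\<^sup>-\<^sup>1 G\<^sup>T G\<close> is a companion matrix with first column \<open>\<Lambda>\<close>: its trace is
  the first coefficient of \<open>\<Lambda>\<close>. As \<open>G\<^sup>T G - \<Theta> / \<rho>\<close> is positive semidefinite, this trace is
  at least \<open>K / \<rho>\<close>.
\<close>
lemma \<Lambda>_0_ge: "1 / \<rho> \<le> \<Lambda> $ 0"
proof -
  let ?M = "minv \<Theta>"
  define g where "g i = Spow i \<sigma>" for i
  define N where "N i j = g i \<bullet> g j - \<Theta> $$ (i, j) / \<rho>" for i j
  have K0: "0 < K" using K_pos by simp
  have g: "g i \<in> carrier_vec p" for i by (simp add: g_def)
  have M: "?M \<in> carrier_mat K K" by (rule minv_\<Theta>(1))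
  have "0 \<le> (\<Sum>i<K. \<Sum>j<K. ?M $$ (i, j) * N i j)"
  proof (rule psd_trace_product_nonneg)
    fix i j assume ij: "i < K" "j < K"
    have "x \<bullet> (?M *\<^sub>v y) = y \<bullet> (?M *\<^sub>v x)" if "x \<in> carrier_vec K" "y \<in> carrier_vec K" for x y
    proof -
      have "\<Theta> *\<^sub>v (?M *\<^sub>v y) = y"
        using assoc_mult_mat_vec[OF \<Theta>_carrier M that(2)] that by (simp add: minv_\<Theta>(2))
      then show ?thesis
        using minv_\<Theta>_form[OF that] comm_scalar_prod[OF mult_mat_vec_carrier[OF M that(1)] that(2)] by simp
    qed
    from this[of "unit_vec K i" "unit_vec K j"] show "?M $$ (i, j) = ?M $$ (j, i)"
      using ij by (simp only: mat_entry_scalar_prod[OF M] unit_vec_carrier)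
  next
    fix x :: "nat \<Rightarrow> real"
    let ?x = "Matrix.vec K x"
    show "0 \<le> (\<Sum>i<K. \<Sum>j<K. x i * ?M $$ (i, j) * x j)"
    proof (cases "?M *\<^sub>v ?x = 0\<^sub>v K")
      case True
      then show ?thesis unfolding quadratic_form_sum_vec[OF M] by simp
    next
      case False
      then show ?thesis
        unfolding quadratic_form_sum_vec[OF M] minv_\<Theta>_form[OF vec_carrier vec_carrier]
        by (intro less_imp_le \<Theta>_pos_def mult_mat_vec_carrier[OF M]) auto
    qed
  next
    fix x :: "nat \<Rightarrow> real"
    \<comment> \<open>With \<open>y = G x\<close>, the form of \<open>N\<close> at \<open>x\<close>
      is \<open>y \<bullet> y - (y \<bullet> S y) / \<rho>\<close>, nonnegative by the Rayleigh
      bound.\<close>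
    define y where "y = G *\<^sub>v Matrix.vec K x"
    have y: "y \<in> carrier_vec p" unfolding y_def by (rule mult_mat_vec_carrier[of _ p K]) auto
    have "(\<Sum>i<K. \<Sum>j<K. x i * (g i \<bullet> g j) * x j) = (\<Sum>a<p. (\<Sum>i<K. x i * g i $ a)\<^sup>2)"
      unfolding gram_quadratic_form[symmetric] scalar_prod_def carrier_vecD[OF g]
      by (simp add: atLeast0LessThan)
    also have "\<dots> = y \<bullet> y"
      unfolding scalar_prod_def[of y] carrier_vecD[OF y] atLeast0LessThan power2_eq_square
    proof (intro sum.cong refl)
      fix a assume "a \<in> {..<p}"
      then have "y $ a = (\<Sum>i<K. x i * g i $ a)"
        unfolding y_def g_def by (subst krylov_mult_vec) auto
      then show "(\<Sum>i<K. x i * g i $ a) * (\<Sum>i<K. x i * g i $ a) = y $ a * y $ a" by simp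
    qed
    finally have 1: "(\<Sum>i<K. \<Sum>j<K. x i * (g i \<bullet> g j) * x j) = y \<bullet> y" .
    have "(\<Sum>i<K. \<Sum>j<K. x i * \<Theta> $$ (i, j) * x j) = (\<Sum>k<n. fit y k * fit y k)"
      unfolding \<Theta>_form power2_eq_square
    proof (intro sum.cong refl)
      fix k assume "k \<in> {..<n}"
      then have "fit y k = (\<Sum>i<K. x i * \<phi> i k)"
        unfolding y_def by (subst fit_krylov) auto
      then show "(\<Sum>i<K. x i * \<phi> i k) * (\<Sum>i<K. x i * \<phi> i k) = fit y k * fit y k" by simp
    qed
    also have "\<dots> = y \<bullet> (S *\<^sub>v y)" by (rule sum_fit_fit[OF y y])
    also have "\<dots> \<le> \<rho> * (y \<bullet> y)" by (rule rayleigh_le_rho[OF S_carrier S_sym p_pos y])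
    finally have "(\<Sum>i<K. \<Sum>j<K. x i * \<Theta> $$ (i, j) * x j) / \<rho> \<le> y \<bullet> y"
      using rho_pos by (simp add: pos_divide_le_eq mult.commute)
    moreover have "(\<Sum>i<K. \<Sum>j<K. x i * N i j * x j)
      = (\<Sum>i<K. \<Sum>j<K. x i * (g i \<bullet> g j) * x j) - (\<Sum>i<K. \<Sum>j<K. x i * \<Theta> $$ (i, j) * x j) / \<rho>"
      by (simp add: N_def algebra_simps sum_subtractf sum_divide_distrib)
    ultimately show "0 \<le> (\<Sum>i<K. \<Sum>j<K. x i * N i j * x j)" using 1 by simp
  qed
  also have "\<dots> = (\<Sum>i<K. \<Sum>j<K. ?M $$ (i, j) * (g i \<bullet> g j)) - (\<Sum>i<K. \<Sum>j<K. ?M $$ (i, j) * \<Theta> $$ (i, j)) / \<rho>"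
    by (simp add: N_def algebra_simps sum_subtractf sum_divide_distrib)
  also have "(\<Sum>i<K. \<Sum>j<K. ?M $$ (i, j) * (g i \<bullet> g j)) = (\<Sum>i<K. if i = 0 then \<Lambda> $ 0 else 0)"
  proof (intro sum.cong refl)
    fix i assume "i \<in> {..<K}"
    then have i: "i < K" by simp
    show "(\<Sum>j<K. ?M $$ (i, j) * (g i \<bullet> g j)) = (if i = 0 then \<Lambda> $ 0 else 0)"
    proof (cases i)
      case 0
      have "\<Lambda> $ 0 = (\<Sum>j<K. ?M $$ (0, j) * (G\<^sup>T *\<^sub>v \<sigma>) $ j)"
        unfolding Lambda_def using K0 M by (simp add: scalar_prod_def[of "row ?M 0"] atLeast0LessThan)
      also have "\<dots> = (\<Sum>j<K. ?M $$ (0, j) * (g 0 \<bullet> g j))"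
      proof (intro sum.cong refl)
        fix j assume j: "j \<in> {..<K}"
        have "(G\<^sup>T *\<^sub>v \<sigma>) $ j = g j \<bullet> g 0"
          using j krylov_transpose_mult_vec[of \<sigma> j K \<sigma>] by (simp add: g_def)
        then show "?M $$ (0, j) * (G\<^sup>T *\<^sub>v \<sigma>) $ j = ?M $$ (0, j) * (g 0 \<bullet> g j)"
          using comm_scalar_prod[OF g g] by simp
      qed
      finally show ?thesis using 0 by simp
    next
      \<comment> \<open>The companion structure: \<open>g (i' + 1) \<bullet> g j\<close> is the
        entry \<open>(j, i')\<close> of \<open>\<Theta>\<close>, so the sum is the entry
        \<open>(i' + 1, i')\<close> of the identity matrix.\<close>
      case (Suc i')
      then have i': "i' < K" using i by simp
      have "(\<Sum>j<K. ?M $$ (i, j) * (g i \<bullet> g j)) = (\<Sum>j<K. ?M $$ (i, j) * \<Theta> $$ (j, i'))"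
      proof (intro sum.cong refl)
        fix j assume "j \<in> {..<K}"
        then have "\<Theta> $$ (j, i') = g i \<bullet> g j"
          using i' Suc by (simp add: Theta_index_moment g_def Spow_scalar_prod_Spow add.commute)
        then show "?M $$ (i, j) * (g i \<bullet> g j) = ?M $$ (i, j) * \<Theta> $$ (j, i')" by simp
      qed
      also have "\<dots> = (?M * \<Theta>) $$ (i, i')"
        using M i i' by (simp add: scalar_prod_def atLeast0LessThan)
      also have "\<dots> = 0" using i i' Suc by (simp add: minv_\<Theta>(3))
      finally show ?thesis using Suc by simp
    qed
  qed
  also have "\<dots> = \<Lambda> $ 0" using K0 by simp
  also have "(\<Sum>i<K. \<Sum>j<K. ?M $$ (i, j) * \<Theta> $$ (i, j)) = (\<Sum>i<K. (?M * \<Theta>) $$ (i, i))"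
    using M by (intro sum.cong refl) (auto simp: scalar_prod_def atLeast0LessThan \<Theta>_sym intro!: sum.cong)
  also have "\<dots> = real K" by (simp add: minv_\<Theta>(3))
  finally have "real K / \<rho> \<le> \<Lambda> $ 0" by simp
  moreover have "1 / \<rho> \<le> real K / \<rho>" using K_pos rho_pos by (intro divide_right_mono) auto
  ultimately show ?thesis by simp
qed

end

section \<open>The ridge PLS estimator\<close>

context pls begin

section \<open>The population least squares problem\<close>

definition res :: "nat \<Rightarrow> real" where "res k = (\<Sum>j<K. \<Lambda> $ j * \<phi> j k) - fit \<beta> k"

definition bias :: real where "bias = (\<Sum>k<n. (res k)\<^sup>2)"

text \<open>Because \<open>S \<beta> = \<sigma>\<close>, the system defining
  \<open>\<Lambda>\<close> consists of the normal equations for approximating \<open>\<beta>\<close>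
  from the span of \<open>G\<close> in the seminorm of \<open>S\<close>.\<close>

lemma res_orthogonal:
  assumes i: "i < K"
  shows "(\<Sum>k<n. \<phi> i k * res k) = 0"
proof -
  have "(\<Sum>k<n. \<phi> i k * (\<Sum>j<K. \<Lambda> $ j * \<phi> j k)) = (\<Sum>j<K. \<Theta> $$ (i, j) * \<Lambda> $ j)"
    using i by (simp add: \<Theta>_index sum_distrib_left sum_distrib_right mult_ac sum.swap[of _ "{..<K}"])
  also have "\<dots> = (\<Sum>k<n. \<phi> i k * fit \<beta> k)"
    unfolding \<Lambda>_normal[OF i] sum_fit_fit[OF Spow_carrier[OF \<sigma>_carrier] \<beta>_carrier] by (simp only: sigma_def)
  finally show ?thesis by (simp add: res_def right_diff_distrib sum_subtractf)
qed

lemma bias_le: "bias \<le> (\<Sum>k<n. ((\<Sum>j<K. z j * \<phi> j k) - fit \<beta> k)\<^sup>2)"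
proof -
  define w where "w j = z j - \<Lambda> $ j" for j
  have split: "(\<Sum>j<K. z j * \<phi> j k) - fit \<beta> k = res k + (\<Sum>j<K. w j * \<phi> j k)" for k
    by (simp add: res_def w_def left_diff_distrib sum_subtractf)
  have "(\<Sum>k<n. res k * (\<Sum>j<K. w j * \<phi> j k)) = (\<Sum>j<K. w j * (\<Sum>k<n. \<phi> j k * res k))"
    unfolding sum_distrib_left by (subst sum.swap) (simp add: mult_ac)
  also have "\<dots> = 0" by (simp add: res_orthogonal)
  finally have cross: "(\<Sum>k<n. res k * (\<Sum>j<K. w j * \<phi> j k)) = 0" .
  have "(\<Sum>k<n. ((\<Sum>j<K. z j * \<phi> j k) - fit \<beta> k)\<^sup>2)
      = bias + 2 * (\<Sum>k<n. res k * (\<Sum>j<K. w j * \<phi> j k)) + (\<Sum>k<n. (\<Sum>j<K. w j * \<phi> j k)\<^sup>2)"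
    unfolding split bias_def power2_sum sum.distrib by (simp add: sum_distrib_left mult_ac)
  moreover have "0 \<le> (\<Sum>k<n. (\<Sum>j<K. w j * \<phi> j k)\<^sup>2)" by (intro sum_nonneg) auto
  ultimately show ?thesis using cross by simp
qed

lemma bias_le_INF: "real n * bias \<le> (INF v\<in>col_span G. (vec_norm (X *\<^sub>v (\<beta> - v)))\<^sup>2)"
proof -
  have dim: "dim_row G = p" by (simp add: carrier_vecD[OF \<sigma>_carrier])
  have G: "G \<in> carrier_mat p K" by simp
  have col: "col_span G = {y \<in> carrier_vec p. \<exists>x\<in>carrier_vec K. G *\<^sub>v x = y}"
    unfolding col_span_def dim vec_space.col_space_eq[OF G] by (simp add: carrier_vecD[OF \<sigma>_carrier])
  show ?thesis
  proof (rule cINF_greatest)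
    have "G *\<^sub>v 0\<^sub>v K \<in> col_span G"
      unfolding col by (auto intro: mult_mat_vec_carrier[OF G])
    then show "col_span G \<noteq> {}" by blast
  next
    fix v assume "v \<in> col_span G"
    then obtain z where z: "z \<in> carrier_vec K" and v: "v = G *\<^sub>v z" "v \<in> carrier_vec p"
      unfolding col by auto
    have "(vec_norm (X *\<^sub>v (\<beta> - v)))\<^sup>2 = real n * (\<Sum>k<n. (fit (\<beta> - v) k)\<^sup>2)"
      using v(2) by (intro norm_X_eq_fit) auto
    also have "(\<Sum>k<n. (fit (\<beta> - v) k)\<^sup>2) = (\<Sum>k<n. ((\<Sum>j<K. z $ j * \<phi> j k) - fit \<beta> k)\<^sup>2)"
    proof (intro sum.cong refl)
      fix k assume "k \<in> {..<n}"
      then have "fit (\<beta> - v) k = fit \<beta> k - (\<Sum>j<K. z $ j * \<phi> j k)"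
        using v(2) fit_krylov[OF \<sigma>_carrier z, of k] by (simp add: fit_diff v(1)[symmetric])
      then show "(fit (\<beta> - v) k)\<^sup>2 = ((\<Sum>j<K. z $ j * \<phi> j k) - fit \<beta> k)\<^sup>2"
        by (simp only: power2_commute)
    qed
    finally show "real n * bias \<le> (vec_norm (X *\<^sub>v (\<beta> - v)))\<^sup>2"
      using bias_le[of "\<lambda>j. z $ j"] by (simp add: mult_left_mono)
  qed
qed

section \<open>The ridge system and its normal equations\<close>

definition ridge_mat :: "(nat \<Rightarrow> real) \<Rightarrow> real vec \<Rightarrow> real mat" where
  "ridge_mat \<alpha> s = Theta K S s + mat_diag K (\<lambda>i. \<alpha> (Suc i))"

lemma ridge_mat_carrier: "s \<in> carrier_vec p \<Longrightarrow> ridge_mat \<alpha> s \<in> carrier_mat K K"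
  unfolding ridge_mat_def by (intro add_carrier_mat mat_diag_dim)

lemma ridge_mat_index:
  assumes "s \<in> carrier_vec p" "i < K" "j < K"
  shows "ridge_mat \<alpha> s $$ (i, j)
    = (\<Sum>k<n. fit (Spow i s) k * fit (Spow j s) k) + (if i = j then \<alpha> (Suc i) else 0)"
proof -
  have "ridge_mat \<alpha> s $$ (i, j) = Theta K S s $$ (i, j) + (if i = j then \<alpha> (Suc i) else 0)"
    unfolding ridge_mat_def using assms by (subst index_add_mat) (auto simp: mat_diag_def)
  then show ?thesis
    using assms by (simp only: Theta_index sum_fit_fit Spow_carrier)
qed

text \<open>A Gram matrix plus a positive diagonal is positive definite. The estimator is thus given
  by a genuine inverse for every realization of the noise, and \<open>minv\<close> never meets a
  singular matrix.\<close>

lemma det_ridge_mat: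
  assumes s: "s \<in> carrier_vec p" and \<alpha>: "\<forall>i<K. 0 < \<alpha> (Suc i)"
  shows "det (ridge_mat \<alpha> s) \<noteq> 0"
proof
  note M = ridge_mat_carrier[OF s, of \<alpha>]
  assume "det (ridge_mat \<alpha> s) = 0"
  then obtain x where x: "x \<in> carrier_vec K" "x \<noteq> 0\<^sub>v K" "ridge_mat \<alpha> s *\<^sub>v x = 0\<^sub>v K"
    using det_0_iff_vec_prod_zero[OF M] by auto
  obtain i where i: "i < K" "x $ i \<noteq> 0" using x by (auto simp: vec_eq_iff)
  have "x \<bullet> (ridge_mat \<alpha> s *\<^sub>v x)
      = (\<Sum>i<K. \<Sum>j<K. x $ i * (\<Sum>k<n. fit (Spow i s) k * fit (Spow j s) k) * x $ j
          + (if j = i then x $ i * \<alpha> (Suc i) * x $ i else 0))"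
    unfolding quadratic_form_sum[OF M x(1,1)]
    by (intro sum.cong refl) (simp add: ridge_mat_index[OF s] algebra_simps)
  also have "\<dots> = (\<Sum>k<n. (\<Sum>i<K. x $ i * fit (Spow i s) k)\<^sup>2) + (\<Sum>i<K. x $ i * \<alpha> (Suc i) * x $ i)"
    by (simp add: sum.distrib gram_quadratic_form)
  finally have eq: "(\<Sum>k<n. (\<Sum>i<K. x $ i * fit (Spow i s) k)\<^sup>2) + (\<Sum>i<K. x $ i * \<alpha> (Suc i) * x $ i) = 0"
    using x by simp
  have sq: "x $ i * \<alpha> (Suc i) * x $ i = \<alpha> (Suc i) * (x $ i)\<^sup>2" for i by (simp add: power2_eq_square)
  have "0 < (\<Sum>i<K. x $ i * \<alpha> (Suc i) * x $ i)"
    unfolding sq using i \<alpha> by (intro sum_pos2[of _ i]) (auto simp: less_imp_le)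
  moreover have "0 \<le> (\<Sum>k<n. (\<Sum>i<K. x $ i * fit (Spow i s) k)\<^sup>2)" by (intro sum_nonneg) auto
  ultimately show False using eq by simp
qed

definition ridge_coef :: "(nat \<Rightarrow> real) \<Rightarrow> real vec \<Rightarrow> real vec" where
  "ridge_coef \<alpha> s = minv (ridge_mat \<alpha> s) *\<^sub>v ((krylov K S s)\<^sup>T *\<^sub>v s)"

lemma krylov_transpose_carrier: "s \<in> carrier_vec p \<Longrightarrow> (krylov K S s)\<^sup>T *\<^sub>v s \<in> carrier_vec K"
  by (intro mult_mat_vec_carrier[of _ K p]) auto

lemma
  assumes s: "s \<in> carrier_vec p" and \<alpha>: "\<forall>i<K. 0 < \<alpha> (Suc i)"
  shows ridge_coef_carrier: "ridge_coef \<alpha> s \<in> carrier_vec K"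
    and ridge_mat_coef: "ridge_mat \<alpha> s *\<^sub>v ridge_coef \<alpha> s = (krylov K S s)\<^sup>T *\<^sub>v s"
proof -
  note M = ridge_mat_carrier[OF s, of \<alpha>] and g = krylov_transpose_carrier[OF s]
  note V = minv_mat[OF M det_ridge_mat[where \<alpha> = \<alpha>, OF s \<alpha>]]
  show "ridge_coef \<alpha> s \<in> carrier_vec K"
    unfolding ridge_coef_def by (rule mult_mat_vec_carrier[OF V(1) g])
  show "ridge_mat \<alpha> s *\<^sub>v ridge_coef \<alpha> s = (krylov K S s)\<^sup>T *\<^sub>v s"
    unfolding ridge_coef_def assoc_mult_mat_vec[OF M V(1) g, symmetric] V(2) using g by simp
qed

text \<open>Paired with the Krylov vectors of \<open>s = \<sigma> + \<eta>\<close>, the true fit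
  reproduces only the part \<open>Spow i s \<bullet> \<sigma>\<close> of the right-hand side. The
  rest, \<open>Spow i s \<bullet> \<eta>\<close>, is split into a part linear in the noise,
  controlled through \<open>D\<close> and \<open>rho_min R\<close>, and a quadratic part, controlled
  through the penalties.\<close>

lemma ridge_normal_equation:
  assumes \<eta>: "\<eta> \<in> carrier_vec p" and \<alpha>: "\<forall>i<K. 0 < \<alpha> (Suc i)" and i: "i < K"
  defines "l \<equiv> ridge_coef \<alpha> (\<sigma> + \<eta>)" and "\<psi> \<equiv> \<lambda>i. fit (Spow i \<eta>)"
  shows "(\<Sum>k<n. (\<phi> i k + \<psi> i k) * ((\<Sum>j<K. l $ j * (\<phi> j k + \<psi> j k)) - fit \<beta> k)) + \<alpha> (Suc i) * l $ i
    = Spow i \<sigma> \<bullet> \<eta> + \<eta> \<bullet> Spow i \<eta>"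
proof -
  define s where "s = \<sigma> + \<eta>"
  have s: "s \<in> carrier_vec p" using \<eta> by (simp add: s_def)
  define h where "h i k = fit (Spow i s) k" for i k
  have Spow_s: "Spow j s = Spow j \<sigma> + Spow j \<eta>" for j
    unfolding s_def using \<eta> by (intro mult_add_distrib_mat_vec[of _ p p]) auto
  have h: "h j k = \<phi> j k + \<psi> j k" if "k < n" for j k
    unfolding h_def Spow_s \<psi>_def using \<eta> that by (intro fit_add) auto
  have l: "l \<in> carrier_vec K" unfolding l_def s_def[symmetric] by (rule ridge_coef_carrier[where \<alpha> = \<alpha>, OF s \<alpha>])
  have "(\<Sum>j<K. ridge_mat \<alpha> s $$ (i, j) * l $ j) = (ridge_mat \<alpha> s *\<^sub>v l) $ i"
    using i l ridge_mat_carrier[OF s, of \<alpha>] by (simp add: scalar_prod_def atLeast0LessThan)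
  also have "\<dots> = Spow i s \<bullet> s"
    unfolding l_def s_def[symmetric] ridge_mat_coef[where \<alpha> = \<alpha>, OF s \<alpha>] by (rule krylov_transpose_mult_vec[OF s i])
  also have "(\<Sum>j<K. ridge_mat \<alpha> s $$ (i, j) * l $ j)
      = (\<Sum>j<K. (\<Sum>k<n. h i k * h j k) * l $ j + (if j = i then \<alpha> (Suc i) * l $ i else 0))"
    by (intro sum.cong refl) (auto simp: ridge_mat_index[OF s i] h_def algebra_simps)
  finally have "(\<Sum>j<K. (\<Sum>k<n. h i k * h j k) * l $ j + (if j = i then \<alpha> (Suc i) * l $ i else 0)) = Spow i s \<bullet> s" .
  moreover have "(\<Sum>j<K. (if j = i then \<alpha> (Suc i) * l $ i else 0)) = \<alpha> (Suc i) * l $ i"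
    using i by simp
  ultimately have "(\<Sum>j<K. (\<Sum>k<n. h i k * h j k) * l $ j) + \<alpha> (Suc i) * l $ i = Spow i s \<bullet> s"
    by (simp add: sum.distrib)
  moreover have "(\<Sum>j<K. (\<Sum>k<n. h i k * h j k) * l $ j) = (\<Sum>k<n. h i k * (\<Sum>j<K. l $ j * h j k))"
    unfolding sum_distrib_left sum_distrib_right by (subst sum.swap) (simp add: mult_ac)
  moreover have "(\<Sum>k<n. h i k * fit \<beta> k) = Spow i s \<bullet> \<sigma>"
    unfolding h_def using s by (subst sum_fit_fit) (auto simp: sigma_def)
  moreover have "Spow i s \<bullet> s = Spow i s \<bullet> \<sigma> + (Spow i \<sigma> \<bullet> \<eta> + \<eta> \<bullet> Spow i \<eta>)"
  proof -
    have "Spow i s \<bullet> s = Spow i s \<bullet> \<sigma> + Spow i s \<bullet> \<eta>"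
      using s \<eta> unfolding s_def[symmetric]
      by (subst (2) s_def) (rule scalar_prod_add_distrib[of _ p], auto)
    also have "Spow i s \<bullet> \<eta> = Spow i \<sigma> \<bullet> \<eta> + Spow i \<eta> \<bullet> \<eta>"
      unfolding Spow_s using \<eta> by (intro add_scalar_prod_distrib[of _ p]) auto
    also have "Spow i \<eta> \<bullet> \<eta> = \<eta> \<bullet> Spow i \<eta>" using \<eta> by (intro comm_scalar_prod[of _ p]) auto
    finally show ?thesis .
  qed
  moreover have "(\<Sum>k<n. (\<phi> i k + \<psi> i k) * ((\<Sum>j<K. l $ j * (\<phi> j k + \<psi> j k)) - fit \<beta> k))
      = (\<Sum>k<n. h i k * (\<Sum>j<K. l $ j * h j k)) - (\<Sum>k<n. h i k * fit \<beta> k)"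
    unfolding sum_subtractf[symmetric] right_diff_distrib[symmetric]
    by (intro sum.cong refl) (simp add: h)
  ultimately show ?thesis by linarith
qed

lemma ridge_pls_loss:
  assumes \<eta>: "\<eta> \<in> carrier_vec p" and \<alpha>: "\<forall>i<K. 0 < \<alpha> (Suc i)"
    and hat: "sigma_hat X Y = \<sigma> + \<eta>"
  shows "1 / real n * (vec_norm (X *\<^sub>v ridge_pls K \<alpha> X Y - X *\<^sub>v \<beta>))\<^sup>2
    = (\<Sum>k<n. ((\<Sum>j<K. ridge_coef \<alpha> (\<sigma> + \<eta>) $ j * (\<phi> j k + fit (Spow j \<eta>) k)) - fit \<beta> k)\<^sup>2)"
proof -
  define s where "s = \<sigma> + \<eta>"
  have s: "s \<in> carrier_vec p" using \<eta> by (simp add: s_def)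
  define l where "l = ridge_coef \<alpha> s"
  have l: "l \<in> carrier_vec K" unfolding l_def by (rule ridge_coef_carrier[where \<alpha> = \<alpha>, OF s \<alpha>])
  have pls: "ridge_pls K \<alpha> X Y = krylov K S s *\<^sub>v l"
    by (simp only: ridge_pls_def Let_def hat s_def[symmetric] l_def ridge_coef_def ridge_mat_def)
  have C: "krylov K S s *\<^sub>v l \<in> carrier_vec p"
    by (rule mult_mat_vec_carrier[OF krylov_carrier[OF s] l])
  have "X *\<^sub>v ridge_pls K \<alpha> X Y - X *\<^sub>v \<beta> = X *\<^sub>v (krylov K S s *\<^sub>v l - \<beta>)"
    unfolding pls by (rule mult_minus_distrib_mat_vec[OF X_carrier C \<beta>_carrier, symmetric])
  then have "1 / real n * (vec_norm (X *\<^sub>v ridge_pls K \<alpha> X Y - X *\<^sub>v \<beta>))\<^sup>2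
      = (\<Sum>k<n. (fit (krylov K S s *\<^sub>v l - \<beta>) k)\<^sup>2)"
    using norm_X_eq_fit[of "krylov K S s *\<^sub>v l - \<beta>"] C n_pos by simp
  also have "\<dots> = (\<Sum>k<n. ((\<Sum>j<K. l $ j * (\<phi> j k + fit (Spow j \<eta>) k)) - fit \<beta> k)\<^sup>2)"
  proof (intro sum.cong refl)
    fix k assume "k \<in> {..<n}"
    then have k: "k < n" by simp
    have "fit (Spow j s) k = \<phi> j k + fit (Spow j \<eta>) k" for j
    proof -
      have "Spow j s = Spow j \<sigma> + Spow j \<eta>"
        unfolding s_def using \<eta> by (intro mult_add_distrib_mat_vec[of _ p p]) auto
      then show ?thesis using \<eta> k by (simp only: fit_add Spow_carrier \<sigma>_carrier)
    qed
    then show "(fit (krylov K S s *\<^sub>v l - \<beta>) k)\<^sup>2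
        = ((\<Sum>j<K. l $ j * (\<phi> j k + fit (Spow j \<eta>) k)) - fit \<beta> k)\<^sup>2"
      by (simp only: fit_diff[OF C \<beta>_carrier k] fit_krylov[OF s l k])
  qed
  finally show ?thesis unfolding l_def s_def .
qed

lemma norm_\<Lambda>_sq: "(vec_norm \<Lambda>)\<^sup>2 = (\<Sum>i<K. (\<Lambda> $ i)\<^sup>2)"
  unfolding vec_norm_def real_sqrt_pow2[OF scalar_prod_self_nonneg]
  by (simp add: scalar_prod_def atLeast0LessThan power2_eq_square)

text \<open>The odd moment \<open>y i\<close> is the squared length of the fitted noise vector
  \<open>Spow i \<eta>\<close>, that is, of the noise design at index \<open>i\<close>.\<close>

lemma ridge_pls_deterministic_bound:
  assumes \<eta>: "\<eta> \<in> carrier_vec p" and \<alpha>: "\<forall>i<K. 0 < \<alpha> (Suc i)"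
    and hat: "sigma_hat X Y = \<sigma> + \<eta>"
  defines "y \<equiv> \<lambda>i. \<eta> \<bullet> Spow (Suc (2 * i)) \<eta>"
  shows "1 / real n * (vec_norm (X *\<^sub>v ridge_pls K \<alpha> X Y - X *\<^sub>v \<beta>))\<^sup>2
    \<le> 2 * bias + 2 * (vec_norm \<Lambda>)\<^sup>2 * (\<Sum>i<K. y i) + (\<Sum>i<K. \<alpha> (Suc i) * (\<Lambda> $ i)\<^sup>2)
      + 4 * (1 + (\<Sum>i<K. y i / \<alpha> (Suc i))) * (\<Sum>i<K. (Spow i \<sigma> \<bullet> \<eta>)\<^sup>2 / D i) / rho_min R
      + 2 * (\<Sum>i<K. (\<eta> \<bullet> Spow i \<eta>)\<^sup>2 / \<alpha> (Suc i))"
proof -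
  have y: "(\<Sum>k<n. (fit (Spow i \<eta>) k)\<^sup>2) = y i" for i
    using sum_fit_fit[of "Spow i \<eta>" "Spow i \<eta>"] moment_split(2)[OF \<eta>] \<eta>
    by (simp add: y_def power2_eq_square)
  show ?thesis
    unfolding ridge_pls_loss[where \<alpha> = \<alpha>, OF \<eta> \<alpha> hat] norm_\<Lambda>_sq bias_def res_def y[symmetric]
    by (rule ridge_deterministic_bound[where z = "\<lambda>i. \<eta> \<bullet> Spow i \<eta>"])
      (use \<alpha> D_pos rho_min_pos ridge_normal_equation[where \<alpha> = \<alpha>, OF \<eta> \<alpha>] rho_min_R_lower in auto)
qed

end

text \<open>The lower bound keeps the penalties positive. The upper bound may be as crude as linear
  in \<open>K\<close>, because \<open>K_le_cond\<close> can pay for one factor \<open>K\<close>;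
  \<open>1 \<le> K / \<delta>\<close> merges the additive constant into it.\<close>

lemma
  assumes \<delta>: "0 < \<delta>" "\<delta> < 1" and K: "1 \<le> K"
  shows C_const_ge_1: "1 \<le> C_const \<delta> K" and C_const_le: "C_const \<delta> K \<le> 20 * real K / \<delta>"
proof -
  define r where "r = real K / \<delta>"
  define x where "x = x_const \<delta> K"
  have r: "1 \<le> r" using \<delta> K by (simp add: r_def)
  have x_eq: "x = ln (6 * r)" by (simp add: x_def x_const_def r_def)
  have x0: "0 \<le> x" using r by (simp add: x_eq)
  have xr: "x \<le> 6 * r" using ln_le_minus_one[of "6 * r"] r by (simp add: x_eq)
  have sq: "2 * sqrt y \<le> 1 + y" if "0 \<le> y" for y :: real
  proof -
    have "0 \<le> (sqrt y - 1)\<^sup>2" by simp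
    then show ?thesis using that by (simp add: power2_diff)
  qed
  have "1 \<le> g_fun x" using x0 by (simp add: g_fun_def)
  then show "1 \<le> C_const \<delta> K" by (simp add: C_const_def x_def)
  have "g_fun x \<le> 2 + 3 * x" using sq[OF x0] by (simp add: g_fun_def)
  moreover have "2 * sqrt (2 * x) \<le> 2 + 3 * x" using sq[of "2 * x"] x0 by linarith
  ultimately have "C_const \<delta> K \<le> 2 + 3 * x" by (simp add: C_const_def x_def)
  also have "\<dots> \<le> 20 * r" using xr r by linarith
  finally show "C_const \<delta> K \<le> 20 * real K / \<delta>" by (simp add: r_def)
qed

lemma
  fixes f :: "'i \<Rightarrow> 'a \<Rightarrow> real"
  assumes "\<And>i. i \<in> I \<Longrightarrow> integrable M (f i)"
  shows integrable_sum_divide: "integrable M (\<lambda>x. \<Sum>i\<in>I. f i x / c i)"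
    and integral_sum_divide: "(\<integral>x. (\<Sum>i\<in>I. f i x / c i) \<partial>M) = (\<Sum>i\<in>I. (\<integral>x. f i x \<partial>M) / c i)"
proof -
  have int: "integrable M (\<lambda>x. f i x / c i)" if "i \<in> I" for i
    using assms[OF that] by simp
  then show "integrable M (\<lambda>x. \<Sum>i\<in>I. f i x / c i)" by (rule Bochner_Integration.integrable_sum)
  show "(\<integral>x. (\<Sum>i\<in>I. f i x / c i) \<partial>M) = (\<Sum>i\<in>I. (\<integral>x. f i x \<partial>M) / c i)"
    by (subst Bochner_Integration.integral_sum[OF int]) simp_all
qed

context pls begin

text \<open>\<open>measure\<close> is 0 on sets outside the sigma-algebra, so a lower bound on a
  probability requires the event to be measurable.\<close>

lemma measurable_ridge_pls_loss:
  assumes \<alpha>: "\<forall>i<K. 0 < \<alpha> (Suc i)"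
  shows "(\<lambda>\<epsilon>. 1 / real n * (vec_norm (X *\<^sub>v ridge_pls K \<alpha> X (response X \<beta> \<epsilon>) - X *\<^sub>v \<beta>))\<^sup>2)
    \<in> borel_measurable (gauss_noise n \<tau>)"
proof -
  let ?M = "gauss_noise n \<tau>"
  define s where "s \<epsilon> = \<sigma> + noise \<epsilon>" for \<epsilon>
  have s: "s \<epsilon> \<in> carrier_vec p" for \<epsilon> by (simp add: s_def)
  have "(s \<epsilon>) $ a = \<sigma> $ a + noise \<epsilon> $ a" if "a < p" for a \<epsilon>
    using that by (simp add: s_def)
  then have s_meas: "(\<lambda>\<epsilon>. s \<epsilon> $ a) \<in> borel_measurable ?M" if "a < p" for a
    using that by simp
  have pow_meas: "(\<lambda>\<epsilon>. Spow j (s \<epsilon>) $ a) \<in> borel_measurable ?M"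
    "(\<lambda>\<epsilon>. Spow j (noise \<epsilon>) $ a) \<in> borel_measurable ?M" if "a < p" for j a
    using that s s_meas by (intro measurable_mult_mat_vec[of _ p p]; simp)+
  have fit_measI: "(\<lambda>\<epsilon>. fit (f \<epsilon>) k) \<in> borel_measurable ?M"
    if "k < n" "\<And>\<epsilon>. f \<epsilon> \<in> carrier_vec p" "\<And>a. a < p \<Longrightarrow> (\<lambda>\<epsilon>. f \<epsilon> $ a) \<in> borel_measurable ?M" for f k
    unfolding fit_def
    by (intro borel_measurable_divide borel_measurable_const
        measurable_mult_mat_vec[OF X_carrier that(2) _ that(3,1)])
  have fit_meas: "(\<lambda>\<epsilon>. fit (Spow j (s \<epsilon>)) k) \<in> borel_measurable ?M" if "k < n" for j k
    by (rule fit_measI[OF that Spow_carrier[OF s]]) (rule pow_meas(1))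
  have fit_noise_meas: "(\<lambda>\<epsilon>. fit (Spow j (noise \<epsilon>)) k) \<in> borel_measurable ?M" if "k < n" for j k
    by (rule fit_measI[OF that Spow_carrier[OF noise_carrier]]) (rule pow_meas(2))
  have M: "ridge_mat \<alpha> (s \<epsilon>) \<in> carrier_mat K K" for \<epsilon> by (rule ridge_mat_carrier[OF s])
  have det: "det (ridge_mat \<alpha> (s \<epsilon>)) \<noteq> 0" for \<epsilon> by (rule det_ridge_mat[OF s \<alpha>])
  have M_meas: "(\<lambda>\<epsilon>. ridge_mat \<alpha> (s \<epsilon>) $$ (i, j)) \<in> borel_measurable ?M" if "i < K" "j < K" for i j
    unfolding ridge_mat_index[OF s that]
    by (intro borel_measurable_add borel_measurable_const borel_measurable_sum borel_measurable_times fit_meas) auto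
  have g_meas: "(\<lambda>\<epsilon>. ((krylov K S (s \<epsilon>))\<^sup>T *\<^sub>v s \<epsilon>) $ i) \<in> borel_measurable ?M" if "i < K" for i
    unfolding krylov_transpose_mult_vec[OF s that]
    by (rule measurable_scalar_prod[OF s pow_meas(1) s_meas])
  have coef_meas: "(\<lambda>\<epsilon>. ridge_coef \<alpha> (s \<epsilon>) $ i) \<in> borel_measurable ?M" if "i < K" for i
    unfolding ridge_coef_def
    by (rule measurable_mult_mat_vec[OF minv_mat(1)[OF M det] krylov_transpose_carrier[OF s]
          measurable_minv[OF M det M_meas] g_meas that])
  have "(\<lambda>\<epsilon>. \<Sum>k<n. ((\<Sum>j<K. ridge_coef \<alpha> (s \<epsilon>) $ j * (\<phi> j k + fit (Spow j (noise \<epsilon>)) k)) - fit \<beta> k)\<^sup>2)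
      \<in> borel_measurable ?M"
    by (intro borel_measurable_sum borel_measurable_power borel_measurable_diff borel_measurable_times
        borel_measurable_add borel_measurable_const coef_meas fit_noise_meas) auto
  then show ?thesis
    unfolding ridge_pls_loss[OF noise_carrier \<alpha> sigma_hat_response[OF \<beta>_carrier]] s_def .
qed

section \<open>Size of the penalties and the effective rank\<close>

lemma trace_pos: "0 < T i"
  using rho_power_le_trace[of "Suc i"] rho_pos by (meson less_le_trans zero_less_power)

text \<open>Up to the common factor
  \<open>16 * C_const \<delta> K * real K * \<tau>\<^sup>2 / real n\<close>, this is the sum of the
  penalties.\<close>

definition trace_sum :: real where "trace_sum = (\<Sum>i<K. \<rho> ^ Suc i * T i)"

lemma trace_sum_pos: "0 < trace_sum"
proof -
  have "{..<K} \<noteq> {}" using K_pos by (simp add: lessThan_empty_iff)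
  then show ?thesis unfolding trace_sum_def using rho_pos trace_pos by (intro sum_pos) auto
qed

lemma \<Lambda>_sq_le: "i < K \<Longrightarrow> (\<Lambda> $ i)\<^sup>2 \<le> (vec_norm \<Lambda>)\<^sup>2"
  unfolding norm_\<Lambda>_sq by (rule member_le_sum) auto

text \<open>This is where \<open>\<Lambda>_0_ge\<close> enters: it lets the right-hand side absorb the noise terms.\<close>
lemma effective_rank_le: "T 0 / \<rho> \<le> (vec_norm \<Lambda>)\<^sup>2 * trace_sum"
proof -
  have K0: "0 < K" using K_pos by simp
  have "(1 / \<rho>)\<^sup>2 \<le> (\<Lambda> $ 0)\<^sup>2" using \<Lambda>_0_ge rho_pos by (intro power_mono) auto
  then have "(1 / \<rho>)\<^sup>2 * (\<rho> * T 0) \<le> (vec_norm \<Lambda>)\<^sup>2 * (\<rho> * T 0)"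
    using \<Lambda>_sq_le[OF K0] rho_pos trace_pos[of 0] by (intro mult_right_mono) auto
  also have "\<rho> * T 0 \<le> trace_sum"
    unfolding trace_sum_def using K0 member_le_sum[of 0 "{..<K}" "\<lambda>i. \<rho> ^ Suc i * T i"] rho_pos trace_pos
    by (auto simp: less_imp_le)
  finally show ?thesis
    using rho_pos by (simp add: power2_eq_square mult_left_mono)
qed

text \<open>Noise terms that carry neither \<open>\<Lambda>\<close> nor traces are multiplied by
  this quantity to reach the common scale of the bound.\<close>

lemma one_le_effective_rank: "1 \<le> (vec_norm \<Lambda>)\<^sup>2 * trace_sum"
  using rho_power_le_trace[of 1] rho_pos effective_rank_le by (simp add: pos_le_divide_eq order_trans[OF _ effective_rank_le])

lemma trace_le: "T i \<le> \<rho> ^ i * T 0"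
  using trace_add_le[of i 1] by simp

text \<open>The four noise sums are normalized so that each has expectation at most 1 when
  \<open>\<eta>\<close> is the Gaussian noise. Every term of the deterministic bound except the bias
  is then compared with \<open>t * real K * W\<close>, where \<open>W\<close> is the quantity from
  \<open>one_le_effective_rank\<close>.\<close>

lemma ridge_pls_bound_of_noise:
  fixes \<delta> \<tau> :: real and \<eta> :: "real vec"
  defines "\<alpha> \<equiv> alpha \<delta> K \<tau> X" and "h \<equiv> 8 / \<delta>" and "t \<equiv> \<tau>\<^sup>2 / real n"
    and "d \<equiv> cond_number (diag_part \<Theta>)" and "\<kappa> \<equiv> cond_number R"
    and "y \<equiv> \<lambda>i. \<eta> \<bullet> Spow (Suc (2 * i)) \<eta>" and "z \<equiv> \<lambda>i. \<eta> \<bullet> Spow i \<eta>"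
  assumes \<delta>: "0 < \<delta>" "\<delta> < 1" and \<tau>: "0 < \<tau>" and \<eta>: "\<eta> \<in> carrier_vec p"
    and hat: "sigma_hat X Y = \<sigma> + \<eta>"
    and 1: "(\<Sum>i<K. y i / \<alpha> (Suc i)) \<le> h"
    and 2: "(\<Sum>i<K. y i / (t * trace_sum)) \<le> h"
    and 3: "(\<Sum>i<K. (Spow i \<sigma> \<bullet> \<eta>)\<^sup>2 / (D i * (t * real K))) \<le> h"
    and 4: "(\<Sum>i<K. z i / (t * T i * real K)) \<le> h"
  shows "1 / real n * (vec_norm (X *\<^sub>v ridge_pls K \<alpha> X Y - X *\<^sub>v \<beta>))\<^sup>2
    \<le> 2 * bias + (86 * h + 6 * h\<^sup>2) * \<kappa> ^ 4 * t * (d * (vec_norm \<Lambda>)\<^sup>2 * real K * trace_sum)"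
proof -
  define C where "C = C_const \<delta> K"
  define W where "W = (vec_norm \<Lambda>)\<^sup>2 * trace_sum"
  define m where "m = rho_min R"
  define N where "N = (\<Sum>i<K. (Spow i \<sigma> \<bullet> \<eta>)\<^sup>2 / D i)"
  define c where "c = (\<Sum>i<K. y i / \<alpha> (Suc i))"
  have t: "0 < t" using \<tau> n_pos by (simp add: t_def)
  have h: "0 \<le> h" using \<delta> by (simp add: h_def)
  have K: "1 \<le> real K" using K_pos by simp
  have C1: "1 \<le> C" unfolding C_def by (rule C_const_ge_1[OF \<delta> K_pos])
  have W1: "1 \<le> W" unfolding W_def by (rule one_le_effective_rank)
  have \<kappa>: "1 \<le> \<kappa>" unfolding \<kappa>_def by (rule cond_R_ge)
  have d: "1 \<le> d" unfolding d_def by (rule cond_D_ge)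
  have m: "0 < m" "1 / m \<le> \<kappa>" unfolding m_def \<kappa>_def by (rule rho_min_pos, rule inverse_rho_min_le)
  have \<alpha>_eq: "\<alpha> (Suc i) = 16 * C * real K * t * \<rho> ^ Suc i * T i" for i
    unfolding \<alpha>_def alpha_def C_def t_def design_dims ..
  have \<alpha>_pos: "0 < \<alpha> (Suc i)" for i
    unfolding \<alpha>_eq using C1 K t rho_pos trace_pos[of i] by (intro mult_pos_pos zero_less_power) auto
  have y0: "0 \<le> y i" for i unfolding y_def by (rule moment_nonneg[OF \<eta>])
  have z0: "0 \<le> z i" for i unfolding z_def by (rule moment_nonneg[OF \<eta>])
  have c0: "0 \<le> c" unfolding c_def using y0 \<alpha>_pos by (intro sum_nonneg divide_nonneg_pos) auto
  have N0: "0 \<le> N" unfolding N_def using D_pos by (intro sum_nonneg divide_nonneg_pos) auto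

  have "(\<Sum>i<K. y i) \<le> h * (t * trace_sum)"
    using 2 t trace_sum_pos by (simp add: sum_divide_distrib[symmetric] pos_divide_le_eq)
  then have "2 * (vec_norm \<Lambda>)\<^sup>2 * (\<Sum>i<K. y i) \<le> 2 * (vec_norm \<Lambda>)\<^sup>2 * (h * (t * trace_sum))"
    by (intro mult_left_mono) auto
  also have "\<dots> = 1 * (2 * h * t * W)" by (simp add: W_def)
  also have "\<dots> \<le> real K * (2 * h * t * W)" using K h t W1 by (intro mult_right_mono) auto
  finally have A1: "2 * (vec_norm \<Lambda>)\<^sup>2 * (\<Sum>i<K. y i) \<le> 2 * h * (t * real K * W)" by (simp add: mult_ac)

  have "(\<Sum>i<K. \<alpha> (Suc i) * (\<Lambda> $ i)\<^sup>2) \<le> (\<Sum>i<K. \<alpha> (Suc i) * (vec_norm \<Lambda>)\<^sup>2)"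
    using \<alpha>_pos \<Lambda>_sq_le by (intro sum_mono mult_left_mono) (auto simp: less_imp_le)
  also have "\<dots> = 16 * C * (t * real K * W)"
    unfolding \<alpha>_eq W_def trace_sum_def by (simp add: sum_distrib_left mult_ac)
  finally have A2: "(\<Sum>i<K. \<alpha> (Suc i) * (\<Lambda> $ i)\<^sup>2) \<le> 16 * C * (t * real K * W)" .

  have "N \<le> h * (t * real K)"
  proof -
    have "(\<Sum>i<K. (Spow i \<sigma> \<bullet> \<eta>)\<^sup>2 / (D i * (t * real K))) = N / (t * real K)"
      unfolding N_def sum_divide_distrib by (simp add: divide_divide_eq_left)
    then show ?thesis using 3 t K by (simp add: pos_divide_le_eq)
  qed
  have "4 * (1 + c) * N / m = 4 * ((1 + c) * (N * (1 / m)))" by simp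
  also have "\<dots> \<le> 4 * ((1 + h) * (h * (t * real K) * \<kappa>))"
    using 1 \<open>N \<le> h * (t * real K)\<close> m h N0 c0 t \<kappa> unfolding c_def[symmetric]
    by (intro mult_left_mono mult_mono) auto
  also have "\<dots> = 4 * (1 + h) * h * \<kappa> * (t * real K) * 1" by simp
  also have "\<dots> \<le> 4 * (1 + h) * h * \<kappa> * (t * real K) * W"
    using W1 h \<kappa> t by (intro mult_left_mono) auto
  finally have A3: "4 * (1 + c) * N / m \<le> 4 * (1 + h) * h * \<kappa> * (t * real K * W)" by (simp add: mult_ac)

  \<comment> \<open>For the Gaussian noise \<open>t * T i\<close> is the expectation of
    \<open>z i\<close>, so \<open>w i\<close> has mean 1.\<close>
  define w where "w i = z i / (t * T i)" for i
  have w0: "0 \<le> w i" for i unfolding w_def using z0 t trace_pos by (simp add: divide_nonneg_pos)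
  have "(\<Sum>i<K. w i) \<le> h * real K"
  proof -
    have "(\<Sum>i<K. z i / (t * T i * real K)) = (\<Sum>i<K. w i) / real K"
      unfolding w_def sum_divide_distrib by (simp add: divide_divide_eq_left)
    then show ?thesis using 4 K by (simp add: pos_divide_le_eq)
  qed
  then have "(\<Sum>i<K. w i)\<^sup>2 \<le> (h * real K)\<^sup>2" using w0 by (intro power_mono sum_nonneg) auto
  \<comment> \<open>Passing through the square of the sum avoids fourth moments of the noise. It
    costs \<open>K^2\<close>, of which the factor \<open>K\<close> in the penalties takes one power
    back.\<close>
  moreover have "(\<Sum>i<K. (w i)\<^sup>2) \<le> (\<Sum>i<K. w i)\<^sup>2"
  proof -
    have "(\<Sum>i<K. (w i)\<^sup>2) \<le> (\<Sum>i<K. w i * (\<Sum>j<K. w j))"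
      unfolding power2_eq_square using w0 by (intro sum_mono mult_left_mono member_le_sum) auto
    then show ?thesis by (simp add: power2_eq_square sum_distrib_right)
  qed
  ultimately have w_sq: "(\<Sum>i<K. (w i)\<^sup>2) \<le> (h * real K)\<^sup>2" by linarith
  have "(z i)\<^sup>2 / \<alpha> (Suc i) \<le> (w i)\<^sup>2 * (t * W / real K)" for i
  proof -
    have "z i = w i * (t * T i)" using t trace_pos[of i] by (simp add: w_def)
    then have "(z i)\<^sup>2 / \<alpha> (Suc i) = (w i)\<^sup>2 * (t / real K) * (T i / (16 * C * \<rho> ^ Suc i))"
      unfolding \<alpha>_eq using t trace_pos[of i] K C1 rho_pos by (simp add: power2_eq_square field_simps)
    \<comment> \<open>The power of \<open>\<rho>\<close> in the penalty cancels the growth of the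
      trace. What remains is at most the effective rank \<open>T 0 / \<rho>\<close>, and
      \<open>W\<close> dominates it.\<close>
    also have "\<dots> \<le> (w i)\<^sup>2 * (t / real K) * W"
    proof (intro mult_left_mono)
      have "T i \<le> \<rho> ^ i * T 0" by (rule trace_le)
      also have "\<dots> = \<rho> ^ Suc i * (T 0 / \<rho>)" using rho_pos by simp
      also have "\<dots> \<le> \<rho> ^ Suc i * W" unfolding W_def using rho_pos by (intro mult_left_mono effective_rank_le) auto
      also have "\<dots> = 1 * (\<rho> ^ Suc i * W)" by simp
      also have "\<dots> \<le> (16 * C) * (\<rho> ^ Suc i * W)" using C1 rho_pos W1 by (intro mult_right_mono) auto
      finally show "T i / (16 * C * \<rho> ^ Suc i) \<le> W" using C1 rho_pos by (simp add: pos_divide_le_eq mult_ac)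
    qed (use t in simp)
    finally show ?thesis by simp
  qed
  then have "(\<Sum>i<K. (z i)\<^sup>2 / \<alpha> (Suc i)) \<le> (\<Sum>i<K. (w i)\<^sup>2 * (t * W / real K))" by (intro sum_mono)
  also have "\<dots> = (\<Sum>i<K. (w i)\<^sup>2) * (t * W / real K)" by (simp only: sum_distrib_right)
  also have "\<dots> \<le> (h * real K)\<^sup>2 * (t * W / real K)" using w_sq t W1 by (intro mult_right_mono) auto
  also have "\<dots> = h\<^sup>2 * (t * real K * W)" using K by (simp add: power2_eq_square field_simps)
  finally have A4: "(\<Sum>i<K. (z i)\<^sup>2 / \<alpha> (Suc i)) \<le> h\<^sup>2 * (t * real K * W)" .

  \<comment> \<open>In terms of \<open>h = 8 / \<delta>\<close> the factor
    \<open>20 / \<delta>\<close> is \<open>5 / 2 * h\<close>; one factor \<open>K\<close> is traded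
    for \<open>2 * \<kappa> * d\<close>.\<close>
  have C_le: "C \<le> 5 * h * (\<kappa> * d)"
  proof -
    have "C \<le> 5 / 2 * h * real K" using C_const_le[OF \<delta> K_pos] by (simp add: C_def h_def)
    also have "\<dots> \<le> 5 / 2 * h * (2 * \<kappa> * d)"
      unfolding \<kappa>_def d_def using h by (intro mult_left_mono K_le_cond) auto
    finally show ?thesis by (simp add: mult_ac)
  qed
  have \<kappa>4: "\<kappa> \<le> \<kappa> ^ 4" "1 \<le> \<kappa> ^ 4" using \<kappa> by (auto intro: self_le_power)
  \<comment> \<open>A common majorant of the factors 1, \<open>\<kappa>\<close> and
    \<open>\<kappa> * d\<close> that occur in the four estimates.\<close>
  define q where "q = \<kappa> ^ 4 * d"
  have q: "\<kappa> * d \<le> q" "\<kappa> \<le> q" "1 \<le> q"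
    unfolding q_def using \<kappa>4 d mult_mono[OF \<kappa>4(1) d] mult_mono[OF \<kappa>4(2) d] by (auto intro: mult_right_mono)
  have "1 / real n * (vec_norm (X *\<^sub>v ridge_pls K \<alpha> X Y - X *\<^sub>v \<beta>))\<^sup>2
      \<le> 2 * bias + 2 * (vec_norm \<Lambda>)\<^sup>2 * (\<Sum>i<K. y i) + (\<Sum>i<K. \<alpha> (Suc i) * (\<Lambda> $ i)\<^sup>2)
        + 4 * (1 + c) * N / m + 2 * (\<Sum>i<K. (z i)\<^sup>2 / \<alpha> (Suc i))"
    using ridge_pls_deterministic_bound[OF \<eta> _ hat, of \<alpha>] \<alpha>_pos
    by (simp add: y_def z_def c_def N_def m_def)
  also have "\<dots> \<le> 2 * bias + (2 * h + 16 * C + 4 * (1 + h) * h * \<kappa> + 2 * h\<^sup>2) * (t * real K * W)"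
    using A1 A2 A3 A4 unfolding distrib_right by linarith
  \<comment> \<open>Here 86 = 2 + 16 * 5 + 4 collects the terms of first order in \<open>h\<close>,
    with \<open>C \<le> 5 * h * q\<close>, and 6 = 4 + 2 those of second order.\<close>
  also have "\<dots> \<le> 2 * bias + (86 * h + 6 * h\<^sup>2) * q * (t * real K * W)"
  proof -
    have "h * 1 \<le> h * q" "h\<^sup>2 * 1 \<le> h\<^sup>2 * q" "4 * (1 + h) * h * \<kappa> \<le> 4 * (1 + h) * h * q"
      using q h by (intro mult_left_mono; simp)+
    moreover have "C \<le> 5 * h * q"
      using order_trans[OF C_le mult_left_mono[OF q(1), of "5 * h"]] h by simp
    moreover have "4 * (1 + h) * h * q = 4 * (h * q) + 4 * (h\<^sup>2 * q)"
      "(86 * h + 6 * h\<^sup>2) * q = 86 * (h * q) + 6 * (h\<^sup>2 * q)" "5 * h * q = 5 * (h * q)"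
      by (simp_all add: algebra_simps power2_eq_square)
    ultimately have "2 * h + 16 * C + 4 * (1 + h) * h * \<kappa> + 2 * h\<^sup>2 \<le> (86 * h + 6 * h\<^sup>2) * q"
      by linarith
    then show ?thesis using t W1 K by (intro add_left_mono mult_right_mono) auto
  qed
  finally show ?thesis by (simp add: q_def W_def mult_ac)
qed

text \<open>Markov's inequality for the total of four noise sums, each of expectation at most 1. The
  threshold \<open>8 / \<delta>\<close> leaves a failure probability of at most
  \<open>\<delta> / 2\<close>, which gives the strict inequality.\<close>

lemma ridge_pls_probability_bound:
  fixes \<delta> \<tau> B :: real
  defines "\<alpha> \<equiv> alpha \<delta> K \<tau> X" and "h \<equiv> 8 / \<delta>"
  assumes \<delta>: "0 < \<delta>" "\<delta> < 1" and \<tau>: "0 < \<tau>"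
    and B: "2 * bias + (86 * h + 6 * h\<^sup>2) * cond_number R ^ 4 * (\<tau>\<^sup>2 / real n)
      * (cond_number (diag_part \<Theta>) * (vec_norm \<Lambda>)\<^sup>2 * real K * trace_sum) \<le> B"
  shows "1 - \<delta> < measure (gauss_noise n \<tau>) {\<epsilon> \<in> space (gauss_noise n \<tau>).
    1 / real n * (vec_norm (X *\<^sub>v ridge_pls K \<alpha> X (response X \<beta> \<epsilon>) - X *\<^sub>v \<beta>))\<^sup>2 \<le> B}"
    (is "_ < measure ?M ?E")
proof -
  interpret prob_space ?M by (rule prob_space_gauss_noise[OF \<tau>])
  define t where "t = \<tau>\<^sup>2 / real n"
  define C where "C = C_const \<delta> K"
  have t: "0 < t" using \<tau> n_pos by (simp add: t_def)
  have h: "0 < h" using \<delta> by (simp add: h_def)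
  have K: "1 \<le> real K" using K_pos by simp
  have C1: "1 \<le> C" unfolding C_def by (rule C_const_ge_1[OF \<delta> K_pos])
  have \<alpha>_eq: "\<alpha> (Suc i) = 16 * C * real K * t * \<rho> ^ Suc i * T i" for i
    unfolding \<alpha>_def alpha_def C_def t_def design_dims ..
  have \<alpha>_pos: "0 < \<alpha> (Suc i)" for i
    unfolding \<alpha>_eq using C1 K t rho_pos trace_pos[of i] by (intro mult_pos_pos zero_less_power) auto
  define V1 where "V1 \<epsilon> = (\<Sum>i<K. noise \<epsilon> \<bullet> Spow (Suc (2 * i)) (noise \<epsilon>) / \<alpha> (Suc i))" for \<epsilon>
  define V2 where "V2 \<epsilon> = (\<Sum>i<K. noise \<epsilon> \<bullet> Spow (Suc (2 * i)) (noise \<epsilon>) / (t * trace_sum))" for \<epsilon>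
  define V3 where "V3 \<epsilon> = (\<Sum>i<K. (Spow i \<sigma> \<bullet> noise \<epsilon>)\<^sup>2 / (D i * (t * real K)))" for \<epsilon>
  define V4 where "V4 \<epsilon> = (\<Sum>i<K. noise \<epsilon> \<bullet> Spow i (noise \<epsilon>) / (t * T i * real K))" for \<epsilon>
  note defs = V1_def V2_def V3_def V4_def
  have nonneg: "0 \<le> V1 \<epsilon>" "0 \<le> V2 \<epsilon>" "0 \<le> V3 \<epsilon>" "0 \<le> V4 \<epsilon>" for \<epsilon>
    unfolding defs using t K \<alpha>_pos trace_sum_pos trace_pos D_pos
    by (auto intro!: sum_nonneg divide_nonneg_pos moment_nonneg mult_pos_pos)
  note int_moment = integrable_noise_moment[OF \<tau>] and int_linear = integrable_noise_linear[OF \<tau> Spow_carrier[OF \<sigma>_carrier]]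
  have int: "integrable ?M V1" "integrable ?M V2" "integrable ?M V3" "integrable ?M V4"
    unfolding defs by (intro integrable_sum_divide int_moment int_linear)+
  \<comment> \<open>Half of the exponent \<open>2 * i + 2\<close> is traded for powers of
    \<open>\<rho>\<close>. The result is exactly the shape of the penalty, which therefore dominates
    the fitted noise on average.\<close>
  have y_le: "t * mat_trace (S ^\<^sub>m Suc (Suc (2 * i))) \<le> t * (\<rho> ^ Suc i * T i)" for i
    using trace_add_le[of "Suc i" "Suc i"] t by (intro mult_left_mono) (simp_all add: mult_2)
  have E1: "integral\<^sup>L ?M V1 \<le> 1"
  proof -
    have "integral\<^sup>L ?M V1 = (\<Sum>i<K. t * mat_trace (S ^\<^sub>m Suc (Suc (2 * i))) / \<alpha> (Suc i))"
      unfolding V1_def integral_sum_divide[OF int_moment] integral_noise_moment[OF \<tau>] t_def ..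
    also have "\<dots> \<le> (\<Sum>i<K. 1 / real K)"
    proof (intro sum_mono)
      fix i
      have pos: "0 < t * (\<rho> ^ Suc i * T i)" using t rho_pos trace_pos by (intro mult_pos_pos zero_less_power) auto
      have "t * mat_trace (S ^\<^sub>m Suc (Suc (2 * i))) / \<alpha> (Suc i) \<le> t * (\<rho> ^ Suc i * T i) / \<alpha> (Suc i)"
        using y_le \<alpha>_pos by (intro divide_right_mono) (auto simp: less_imp_le)
      also have "\<dots> = 1 / (16 * C * real K)"
      proof -
        have "\<alpha> (Suc i) = 16 * C * real K * (t * (\<rho> ^ Suc i * T i))"
          unfolding \<alpha>_eq by (simp only: mult.assoc)
        then show ?thesis
          using nonzero_divide_mult_cancel_right[OF pos[THEN less_imp_neq, symmetric], of "16 * C * real K"]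
          by (simp only:)
      qed
      also have "\<dots> \<le> 1 / real K"
        using C1 K by (intro divide_left_mono) auto
      finally show "t * mat_trace (S ^\<^sub>m Suc (Suc (2 * i))) / \<alpha> (Suc i) \<le> 1 / real K" .
    qed
    also have "\<dots> = 1" using K_pos by simp
    finally show ?thesis .
  qed
  have E2: "integral\<^sup>L ?M V2 \<le> 1"
  proof -
    have "integral\<^sup>L ?M V2 = (\<Sum>i<K. t * mat_trace (S ^\<^sub>m Suc (Suc (2 * i))) / (t * trace_sum))"
      unfolding V2_def integral_sum_divide[OF int_moment] integral_noise_moment[OF \<tau>] t_def ..
    also have "\<dots> \<le> (\<Sum>i<K. t * (\<rho> ^ Suc i * T i) / (t * trace_sum))"
      using y_le t trace_sum_pos by (intro sum_mono divide_right_mono) auto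
    also have "\<dots> = (\<Sum>i<K. \<rho> ^ Suc i * T i / trace_sum)" using t by simp
    also have "\<dots> = 1"
      unfolding sum_divide_distrib[symmetric] trace_sum_def[symmetric] using trace_sum_pos by simp
    finally show ?thesis .
  qed
  have E3: "integral\<^sup>L ?M V3 \<le> 1"
  proof -
    have "integral\<^sup>L ?M V3 = (\<Sum>i<K. t * (Spow i \<sigma> \<bullet> (S *\<^sub>v Spow i \<sigma>)) / (D i * (t * real K)))"
      unfolding V3_def integral_sum_divide[OF int_linear] integral_noise_linear[OF \<tau> Spow_carrier[OF \<sigma>_carrier]] t_def ..
    also have "\<dots> = (\<Sum>i<K. 1 / real K)"
    proof (intro sum.cong refl)
      fix i assume "i \<in> {..<K}"
      then have i: "i < K" by simp
      have "Spow i \<sigma> \<bullet> (S *\<^sub>v Spow i \<sigma>) = D i" by (rule Theta_index[OF \<sigma>_carrier i i, symmetric])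
      then show "t * (Spow i \<sigma> \<bullet> (S *\<^sub>v Spow i \<sigma>)) / (D i * (t * real K)) = 1 / real K"
        using t D_pos[OF i] by simp
    qed
    also have "\<dots> = 1" using K_pos by simp
    finally show ?thesis by simp
  qed
  have E4: "integral\<^sup>L ?M V4 \<le> 1"
  proof -
    have "integral\<^sup>L ?M V4 = (\<Sum>i<K. t * T i / (t * T i * real K))"
      unfolding V4_def integral_sum_divide[OF int_moment] integral_noise_moment[OF \<tau>] t_def ..
    also have "\<dots> = (\<Sum>i<K. 1 / real K)"
      using t trace_pos by (intro sum.cong refl) (simp add: less_imp_neq[symmetric])
    also have "\<dots> = 1" using K_pos by simp
    finally show ?thesis by simp
  qed
  define V where "V \<epsilon> = V1 \<epsilon> + V2 \<epsilon> + (V3 \<epsilon> + V4 \<epsilon>)" for \<epsilon>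
  have V_int: "integrable ?M V" unfolding V_def using int by simp
  have V_meas: "V \<in> borel_measurable ?M" using V_int by simp
  have "integral\<^sup>L ?M V \<le> 4"
    unfolding V_def using int E1 E2 E3 E4 by simp
  then have E: "integral\<^sup>L ?M V / h \<le> 4 / h" using h by (intro divide_right_mono) auto
  have "measure ?M {\<epsilon> \<in> space ?M. V \<epsilon> \<ge> h} \<le> integral\<^sup>L ?M V / h"
  proof (rule integral_Markov_inequality_measure[OF V_int, of "{}"])
    show "AE \<epsilon> in ?M. 0 \<le> V \<epsilon>" using nonneg by (simp add: V_def)
  qed (use h in simp_all)
  also note E
  also have "4 / h = \<delta> / 2" by (simp add: h_def)
  finally have bad: "measure ?M {\<epsilon> \<in> space ?M. V \<epsilon> \<ge> h} \<le> \<delta> / 2" .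
  have bad_sets: "{\<epsilon> \<in> space ?M. V \<epsilon> \<ge> h} \<in> events"
    using V_meas by measurable
  have E_sets: "?E \<in> events"
    by (rule borel_measurable_le[OF measurable_ridge_pls_loss borel_measurable_const]) (use \<alpha>_pos in blast)
  have "space ?M - {\<epsilon> \<in> space ?M. V \<epsilon> \<ge> h} \<subseteq> ?E"
  proof
    fix \<epsilon> assume "\<epsilon> \<in> space ?M - {\<epsilon> \<in> space ?M. V \<epsilon> \<ge> h}"
    then have \<epsilon>: "\<epsilon> \<in> space ?M" "V \<epsilon> < h" by auto
    \<comment> \<open>Nonnegativity of all four sums lets the bound on their total pass to each of
      them.\<close>
    then have "V1 \<epsilon> \<le> h" "V2 \<epsilon> \<le> h" "V3 \<epsilon> \<le> h" "V4 \<epsilon> \<le> h"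
      using nonneg[of \<epsilon>] unfolding V_def by linarith+
    from ridge_pls_bound_of_noise[OF \<delta> \<tau> noise_carrier sigma_hat_response[OF \<beta>_carrier], of \<epsilon>] this
    show "\<epsilon> \<in> ?E"
      using \<epsilon>(1) B unfolding defs t_def \<alpha>_def h_def by simp
  qed
  then have "prob (space ?M - {\<epsilon> \<in> space ?M. V \<epsilon> \<ge> h}) \<le> prob ?E"
    using E_sets by (intro finite_measure_mono)
  moreover have "prob (space ?M - {\<epsilon> \<in> space ?M. V \<epsilon> \<ge> h}) = 1 - prob {\<epsilon> \<in> space ?M. V \<epsilon> \<ge> h}"
    by (rule prob_compl[OF bad_sets])
  ultimately show ?thesis using bad \<delta> by linarith
qed

end

theorem theorem4p1:
  fixes \<delta> :: real
  assumes "0 < \<delta>" and "\<delta> < 1"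
  shows "\<exists>c'>0. \<forall>(n::nat) (p::nat) (K::nat) (X::real mat) (\<beta>::real vec) (\<tau>::real).
    0 < n \<longrightarrow> 1 \<le> K \<longrightarrow> K \<le> p \<longrightarrow> X \<in> carrier_mat n p \<longrightarrow> \<beta> \<in> carrier_vec p \<longrightarrow> 0 < \<tau> \<longrightarrow>
    (let S = Sig X; s = sigma X \<beta>; G = krylov K S s; \<Theta> = Theta K S s;
         D = diag_part \<Theta>; R = normalized \<Theta>; \<Lambda> = Lambda K S s
     in (\<forall>i<K. 0 < D $$ (i, i)) \<longrightarrow> 0 < rho_min R \<longrightarrow>
        measure (gauss_noise n \<tau>)
          {\<epsilon> \<in> space (gauss_noise n \<tau>).
             1 / real n * (vec_norm (X *\<^sub>v ridge_pls K (alpha \<delta> K \<tau> X) X (response X \<beta> \<epsilon>) - X *\<^sub>v \<beta>))\<^sup>2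
             \<le> 2 / real n * (INF v\<in>col_span G. (vec_norm (X *\<^sub>v (\<beta> - v)))\<^sup>2)
               + c' * cond_number R ^ 4 * (\<tau>\<^sup>2 / real n)
                 * max (cond_number D * (vec_norm \<Lambda>)\<^sup>2 * real K
                          * (\<Sum>i=1..K. rho (S ^\<^sub>m i) * mat_trace (S ^\<^sub>m i)))
                       (sqrt (cond_number D * (vec_norm \<Lambda>)\<^sup>2
                          * (\<Sum>i=1..K. (mat_trace (S ^\<^sub>m i))\<^sup>2)))}
        > 1 - \<delta>)"
proof -
  define h where "h = 8 / \<delta>"
  define c' where "c' = 86 * h + 6 * h\<^sup>2"
  have h: "0 < h" using assms(1) by (simp add: h_def)
  then have c': "0 < c'" unfolding c'_def by (intro add_pos_pos) auto
  show ?thesis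
    unfolding Let_def
  proof (intro exI[of _ c'] conjI c' allI impI)
    fix n p K :: nat and X :: "real mat" and \<beta> :: "real vec" and \<tau> :: real
    assume "0 < n" "1 \<le> K" "K \<le> p" "X \<in> carrier_mat n p" "\<beta> \<in> carrier_vec p" and \<tau>: "0 < \<tau>"
      and "\<forall>i<K. 0 < diag_part (Theta K (Sig X) (sigma X \<beta>)) $$ (i, i)"
      and "0 < rho_min (normalized (Theta K (Sig X) (sigma X \<beta>)))"
    \<comment> \<open>The locale asks for \<open>0 < p\<close>, which comes from
      \<open>1 \<le> K\<close> and \<open>K \<le> p\<close>.\<close>
    then interpret pls X n p \<beta> K by unfold_locales auto
    define \<kappa> where "\<kappa> = cond_number R"
    define d where "d = cond_number (diag_part \<Theta>)"
    define P where "P = d * (vec_norm \<Lambda>)\<^sup>2 * real K * (\<Sum>i=1..K. rho (S ^\<^sub>m i) * mat_trace (S ^\<^sub>m i))"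
    define Q where "Q = sqrt (d * (vec_norm \<Lambda>)\<^sup>2 * (\<Sum>i=1..K. (mat_trace (S ^\<^sub>m i))\<^sup>2))"
    define I where "I = (INF v\<in>col_span G. (vec_norm (X *\<^sub>v (\<beta> - v)))\<^sup>2)"
    have \<kappa>: "0 \<le> \<kappa>" and d: "0 \<le> d"
      using cond_R_ge cond_D_ge by (simp_all add: \<kappa>_def d_def)
    have "trace_sum \<le> (\<Sum>i<K. rho (S ^\<^sub>m Suc i) * T i)"
      unfolding trace_sum_def
      by (intro sum_mono mult_right_mono rho_power_le_rho less_imp_le[OF trace_pos])
    also have "\<dots> = (\<Sum>i=1..K. rho (S ^\<^sub>m i) * mat_trace (S ^\<^sub>m i))"
      by (simp add: sum.atLeast1_atMost_eq)
    finally have "d * (vec_norm \<Lambda>)\<^sup>2 * real K * trace_sum \<le> P"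
      unfolding P_def using d by (intro mult_left_mono) auto
    then have "c' * \<kappa> ^ 4 * (\<tau>\<^sup>2 / real n) * (d * (vec_norm \<Lambda>)\<^sup>2 * real K * trace_sum)
        \<le> c' * \<kappa> ^ 4 * (\<tau>\<^sup>2 / real n) * max P Q"
      using c' \<kappa> by (intro mult_left_mono) auto
    moreover have "2 * bias \<le> 2 / real n * I"
      using bias_le_INF n_pos by (simp add: I_def field_simps)
    ultimately have "2 * bias + c' * \<kappa> ^ 4 * (\<tau>\<^sup>2 / real n) * (d * (vec_norm \<Lambda>)\<^sup>2 * real K * trace_sum)
        \<le> 2 / real n * I + c' * \<kappa> ^ 4 * (\<tau>\<^sup>2 / real n) * max P Q"
      by (rule add_mono[rotated])
    from ridge_pls_probability_bound[OF assms \<tau> this[unfolded c'_def h_def \<kappa>_def d_def]]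
    show "1 - \<delta> < measure (gauss_noise n \<tau>)
          {\<epsilon> \<in> space (gauss_noise n \<tau>).
             1 / real n * (vec_norm (X *\<^sub>v ridge_pls K (alpha \<delta> K \<tau> X) X (response X \<beta> \<epsilon>) - X *\<^sub>v \<beta>))\<^sup>2
             \<le> 2 / real n * (INF v\<in>col_span G. (vec_norm (X *\<^sub>v (\<beta> - v)))\<^sup>2)
               + c' * cond_number R ^ 4 * (\<tau>\<^sup>2 / real n)
                 * max (cond_number (diag_part \<Theta>) * (vec_norm \<Lambda>)\<^sup>2 * real K
                          * (\<Sum>i=1..K. rho (S ^\<^sub>m i) * mat_trace (S ^\<^sub>m i)))
                       (sqrt (cond_number (diag_part \<Theta>) * (vec_norm \<Lambda>)\<^sup>2
                          * (\<Sum>i=1..K. (mat_trace (S ^\<^sub>m i))\<^sup>2)))}"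
      unfolding I_def P_def Q_def d_def c'_def h_def .
  qed
qed

end
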